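(* Let $(W,S)$ be the Coxeter system associated to a based root system $(\Phi,\Pi)$ in a real vector space $V$ such that $\Pi$ is a basis of $V$, let $\underline{s}$ be an expression in $S$ (with $S$ being the set of entries of $\underline{s}$), let $w\in W$ and let $\underline{\gamma}$ be a subexpression of $\underline{s}$ with target $w$. Then any even subgraph of $\mathfrak{S}(\underline{s},w)$ supported on subexpressions $\le\underline{\gamma}$ is a sum (modulo $2$, i.e. symmetric difference) of some cycles of $\mathbf{Cyc}(\underline{s},w)$ and cycles of types $\mathrm{Tr}^1,\mathrm{Tr}^2,\mathrm{Tr}^3,\mathrm{Sq}^1,\mathrm{Sq}^2$ in $\mathfrak{S}(\underline{s},w)$, all supported on subexpressions $\le\underline{\gamma}$.
   Context: **Root systems.** $V$ is a real vector space with a symmetric bilinear form $(\cdot|\cdot)$; for $\alpha\in V$ with $(\alpha|\alpha)=1$ put $\mathbf{r}_\alpha(v)=v-2(v|\alpha)\alpha$. $\Pi$ is a finite basis of $V$ with $(\alpha|\alpha)=1$ for $\alpha\in\Pi$ and such that for distinct $\alpha,\beta\in\Pi$ either $(\alpha|\beta)=-\cos(\pi/m(\alpha,\beta))$ for an integer $m(\alpha,\beta)\ge2$, or $(\alpha|\beta)\le-1$ (then $m(\alpha,\beta)=\infty$). $S=\{\mathbf{r}_\alpha\mid\alpha\in\Pi\}$, $W=\langle S\rangle\subset \mathrm{GL}(V)$, $\Phi=W\Pi$; $(W,S)$ is a Coxeter system. $\Phi$ is the disjoint union of $\Phi^+$ (roots that are nonnegative combinations of $\Pi$) and $-\Phi^+$;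 write $\alpha>0$, $\alpha<0$ accordingly. $T=\bigcup_{w\in W}wSw^{-1}$ is the set of reflections; $\alpha\mapsto\mathbf{r}_\alpha$ is a bijection $\Phi^+\to T$ with inverse $t\mapsto\mathbf{v}_t$. $\ell$ is the length function of $(W,S)$. **Subexpressions.** An expression is a finite sequence $\underline{s}=(s_1,\ldots,s_m)$ in $S$, $|\underline{s}|=m$; a subexpression $\underline{\gamma}\subset\underline{s}$ is $\underline{\gamma}=(\gamma_1,\ldots,\gamma_m)\in\{0,1\}^m$; $\mathbf{Sub}(\underline{s})$ is the set of them. Put $\underline{\gamma}^{<i}=s_1^{\gamma_1}\cdots s_{i-1}^{\gamma_{i-1}}$, target $\underline{\gamma}^{\max}=s_1^{\gamma_1}\cdots s_m^{\gamma_m}$, $\underline{\gamma}^{\to i}=\underline{\gamma}^{<i}(-\mathbf{v}_{s_i})$. $\mathbf{f}_i$ replaces $\gamma_i$ by $1-\gamma_i$. For $i<j$, $\mathbf{f}_{i,j}\underline{\gamma}=\mathbf{f}_i\mathbf{f}_j\underline{\gamma}$, defined iff this has the same target as $\underline{\gamma}$ (equivalently $\underline{\gamma}^{\to i}=\pm\underline{\gamma}^{\to j}$). $\mathfrak{S}(\underline{s},w)$ is the graph whose vertices are the subexpressions of $\underline{s}$ with target $w$ and whose edges are the pairs of vertices at Hamming distance $2$. Order: $\underline{\delta}<\underline{\gamma}$ iff $\underline{\delta}\ne\underline{\gamma}$, $\underline{\delta}^{\max}=\underline{\gamma}^{\max}$ and $\ell(\underline{\delta}^{<i})<\ell(\underline{\gamma}^{<i})$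 for the maximal $i$ with $\delta_i\ne\gamma_i$; this is a total order on the vertices of $\mathfrak{S}(\underline{s},w)$. **Subgraphs.** A subgraph is a set of edges; sums are symmetric differences; it is even if every vertex is incident with an even number of its edges. It is supported on subexpressions $\le\underline{\gamma}$ if every endpoint of every one of its edges is $\le\underline{\gamma}$. For a map $\phi$ on vertices, $\phi(F)=\{\{\phi(a),\phi(b)\}\mid\{a,b\}\in F\}$. **Triangles and squares.** Let $\underline{\gamma}\subset\underline{s}$ have target $w$. - $\mathrm{Tr}^1_{i,j,k}(\underline{\gamma})$, $i<j<k$, if $\underline{\gamma}^{\to i}=\pm\underline{\gamma}^{\to j}$ and $\underline{\gamma}^{\to j}=\underline{\gamma}^{\to k}>0$: the triangle on $\underline{\gamma},\mathbf{f}_{i,j}\underline{\gamma},\mathbf{f}_{i,k}\underline{\gamma}$. - $\mathrm{Tr}^2_{i,j,k}(\underline{\gamma})$, $i<j<k$, if $\pm\underline{\gamma}^{\to i}=\pm\underline{\gamma}^{\to j}=\underline{\gamma}^{\to k}>0$ (independent signs): the triangle on $\underline{\gamma},\mathbf{f}_{j,k}\underline{\gamma},\mathbf{f}_{i,k}\underline{\gamma}$. - $\mathrm{Tr}^3_{i,j,k}(\underline{\gamma})$, $i<j<k$, if $\underline{\gamma}^{\to i}=\pm\underline{\gamma}^{\to j}$ and $\underline{\gamma}^{\to j}=\underline{\gamma}^{\to k}>0$: the triangle on $\underline{\gamma},\mathbf{f}_{i,j}\underline{\gamma},\mathbf{f}_{j,k}\underline{\gamma}$. - $\mathrm{Sq}^1_{i,j,k,l}(\underline{\gamma})$,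 $i<j<k<l$, if $\pm\underline{\gamma}^{\to i}=\underline{\gamma}^{\to j}>0$ and $\pm\underline{\gamma}^{\to k}=\underline{\gamma}^{\to l}>0$: the 4-cycle $\underline{\gamma},\mathbf{f}_{i,j}\underline{\gamma},\mathbf{f}_{i,j}\mathbf{f}_{k,l}\underline{\gamma},\mathbf{f}_{k,l}\underline{\gamma}$ (consecutive vertices, cyclically, joined). - $\mathrm{Sq}^2_{i,j,k,l}(\underline{\gamma})$, $i<j<k<l$, if $\pm\underline{\gamma}^{\to i}=\underline{\gamma}^{\to l}>0$ and $\pm\underline{\gamma}^{\to j}=\underline{\gamma}^{\to k}>0$: the 4-cycle $\underline{\gamma},\mathbf{f}_{j,k}\underline{\gamma},\mathbf{f}_{i,l}\mathbf{f}_{j,k}\underline{\gamma},\mathbf{f}_{i,l}\underline{\gamma}$. **Dihedral subgroups and morphisms.** A dihedral reflection subgroup $\mathcal D$ of $W$ is a subgroup generated by two distinct reflections. With $N(u)=\{t\in T\mid\ell(tu)<\ell(u)\}$ and $\chi(\mathcal D)=\{t\in T\mid N(t)\cap\mathcal D=\{t\}\}$, one has $|\chi(\mathcal D)|=2$; write $\chi(\mathcal D)=\{A,B\}$ with $A=\mathbf{r}_\alpha$, $B=\mathbf{r}_\beta$, $\alpha,\beta\in\Phi^+$ (so $\{\alpha,\beta\}$ is the canonical simple system). Then $(\mathcal D,\{A,B\})$ is a Coxeter system associated to the based root system with simple roots $\alpha,\beta$ in $\mathbb R\alpha\oplus\mathbb R\beta$, and all notation above for subexpressions is used for expressions in $A,B$,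 with $\mathbf{v}_A=\alpha$, $\mathbf{v}_B=\beta$. For an expression $\underline{t}$ in $A,B$, a morphism of positive cosign $(p,\phi):\underline{t}\to\underline{s}$ (in the category $\mathbf{Expr}_{\mathcal D}(W,S)$) consists of an increasing injection $p:\{1,\ldots,|\underline{t}|\}\to\{1,\ldots,|\underline{s}|\}$ and a map $\phi:\mathbf{Sub}(\underline{t})\to\mathbf{Sub}(\underline{s})$ such that $\phi(\underline{\delta})^{\to p(i)}=\underline{\delta}^{\to i}$ and $\phi(\mathbf{f}_i\underline{\delta})=\mathbf{f}_{p(i)}\phi(\underline{\delta})$ for all $\underline{\delta}\subset\underline{t}$ and all $i$. **Dihedral cycles.** Let $\mathcal D$ be finite, $n=|\mathcal D|/2\ge2$, $\mathfrak c\in\{A,B\}$, $\{\mathfrak c,\bar{\mathfrak c}\}=\{A,B\}$, and let $(\mathfrak c,\bar{\mathfrak c},\ldots)_z$ be the alternating sequence of length $z$ starting with $\mathfrak c$. Below a subexpression of this sequence is given by its set of positions with entry $0$ (all other entries are $1$), and $[a,b]=\{a,a+1,\ldots,b\}$. (1) For $1\le x\le n-1$ and $x+n+1\le y\le 2n$ put $z=y$, $\underline{\delta}=\emptyset$ (all ones), $\sigma^{(x+1)}=\{x+1,x+n+1\}$; $\sigma^{(i)}=\{x,2x+1-i,2x+2-i,x+n+1\}$ for $1\le i\le x$; $\sigma^{(i)}=\{x,2x-i,2x+1-i,x+n+1\}$ for $x-n<i\le0$; $\sigma^{(x-n)}=\{x,x+n\}$. Then $\sigma^{(1)}=\sigma^{(0)}$,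 and $\mathrm{Cyc}^1_{\mathfrak c}(x,y)$ is the cycle of length $n+2$ passing successively through $\underline{\delta},\sigma^{(x+1)},\sigma^{(x)},\ldots,\sigma^{(1)}=\sigma^{(0)},\sigma^{(-1)},\ldots,\sigma^{(x-n)},\underline{\delta}$. (2) For $1\le x<y\le n$ put $z=2x-y+2n$, $r=2y-x-n$, $\underline{\delta}=\{x+n\}$, $\tilde\sigma=\{x\}$. For $1\le i\le y$ let $\sigma^{(i)}=[i,2y-i]\cup\{x+n,z\}$ if $i\ge x$, $i>r$; $\sigma^{(i)}=[i,2x-2y+2n-1+i]\cup\{z\}$ if $i\ge x$, $i\le r$; $\sigma^{(i)}=\{x\}\cup[2x+1-i,2y-i]\cup\{x+n,z\}$ if $i<x$, $i>r$; $\sigma^{(i)}=\{x\}\cup[2x+1-i,2x-2y+2n-1+i]\cup\{z\}$ if $i<x$, $i\le r$. For $y-n\le i\le0$ let $\sigma^{(i)}=\{x\}\cup[2x-i,2x-2y+2n+i]\cup\{z\}$ if $i\le r$; $\sigma^{(i)}=\{x\}\cup[2x-i,2y-1-i]\cup\{x+n,z\}$ if $i>r$. Then $\sigma^{(1)}=\sigma^{(0)}$, and $\mathrm{Cyc}^2_{\mathfrak c}(x,y)$ is the cycle of length $n+2$ passing successively through $\underline{\delta},\sigma^{(y)},\sigma^{(y-1)},\ldots,\sigma^{(1)}=\sigma^{(0)},\sigma^{(-1)},\ldots,\sigma^{(y-n)},\tilde\sigma,\underline{\delta}$. **The set $\mathbf{Cyc}(\underline{s},w)$.** It consists of all cycles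 contained in $\mathfrak{S}(\underline{s},w)$ of the form $\phi(\mathrm{Cyc}^u_{\mathfrak c}(x,y))$, where $\mathcal D$ is any finite dihedral reflection subgroup of $W$, $n=|\mathcal D|/2$, $\mathfrak c\in\{A,B\}$ is one of the two simple reflections of $\mathcal D$, either $u=1$, $1\le x<n$, $x+n+1\le y\le2n$, $z=y$, or $u=2$, $1\le x<y\le n$, $z=2x-y+2n$, and $(p,\phi):(\mathfrak c,\bar{\mathfrak c},\ldots)_z\to\underline{s}$ is any morphism of positive cosign. *)

theory Defs
  imports "HOL-Analysis.Linear_Algebra" "HOL-Algebra.Generated_Groups"
begin

section \<open>Based root systems and their Coxeter groups\<close>

text \<open>The vector space \<open>V\<close> is the whole type \<open>'v\<close>.\<close>

locale based_root_system =
  fixes form :: "'v::real_vector \<Rightarrow> 'v \<Rightarrow> real"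
    and \<Delta> :: "'v set"
  assumes form_bilinear: "bilinear form"
    and form_sym: "form u v = form v u"
    and finite_\<Delta>: "finite \<Delta>"
    and independent_\<Delta>: "independent \<Delta>"
    and span_\<Delta>: "span \<Delta> = UNIV"
    and form_unit: "\<alpha> \<in> \<Delta> \<Longrightarrow> form \<alpha> \<alpha> = 1"
    and form_distinct: "\<lbrakk>\<alpha> \<in> \<Delta>; \<beta> \<in> \<Delta>; \<alpha> \<noteq> \<beta>\<rbrakk> \<Longrightarrow>
      (\<exists>m::nat. m \<ge> 2 \<and> form \<alpha> \<beta> = - cos (pi / real m)) \<or> form \<alpha> \<beta> \<le> -1"

definition GL :: "('v::real_vector \<Rightarrow> 'v) monoid" where
  "GL = \<lparr>carrier = {f. linear f \<and> bij f}, mult = (\<circ>), one = id\<rparr>"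

definition word_prod :: "('v \<Rightarrow> 'v) list \<Rightarrow> 'v \<Rightarrow> 'v" where
  "word_prod us = foldr (\<circ>) us id"

definition reflection :: "('v::real_vector \<Rightarrow> 'v \<Rightarrow> real) \<Rightarrow> 'v \<Rightarrow> 'v \<Rightarrow> 'v" where
  "reflection form \<alpha> v = v - (2 * form v \<alpha>) *\<^sub>R \<alpha>"

context
  fixes form :: "'v::real_vector \<Rightarrow> 'v \<Rightarrow> real"
    and \<Delta> :: "'v set"
begin

definition simple_reflections :: "('v \<Rightarrow> 'v) set" where
  "simple_reflections = reflection form ` \<Delta>"

definition coxeter_group :: "('v \<Rightarrow> 'v) set" where
  "coxeter_group = generate GL simple_reflections"

definition roots :: "'v set" where
  "roots = {u \<alpha> | u \<alpha>. u \<in> coxeter_group \<and> \<alpha> \<in> \<Delta>}"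

definition positive_roots :: "'v set" where
  "positive_roots = {\<alpha> \<in> roots. \<exists>c. (\<forall>\<beta>\<in>\<Delta>. c \<beta> \<ge> 0) \<and> \<alpha> = (\<Sum>\<beta>\<in>\<Delta>. c \<beta> *\<^sub>R \<beta>)}"

definition reflections :: "('v \<Rightarrow> 'v) set" where
  "reflections = {u \<circ> t \<circ> inv\<^bsub>GL\<^esub> u | u t. u \<in> coxeter_group \<and> t \<in> simple_reflections}"

definition root_of :: "('v \<Rightarrow> 'v) \<Rightarrow> 'v" where
  "root_of t = (THE \<alpha>. \<alpha> \<in> positive_roots \<and> reflection form \<alpha> = t)"

definition len :: "('v \<Rightarrow> 'v) \<Rightarrow> nat" where
  "len u = (LEAST k. \<exists>us. set us \<subseteq> simple_reflections \<and> length us = k \<and> word_prod us = u)"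

end


section \<open>Subexpressions\<close>

text \<open>
  List positions are counted from \<open>0\<close>, so \<open>before s \<gamma> i\<close> is the product of the first \<open>i\<close> factors.
\<close>

type_synonym subexpression = "bool list"

definition Sub :: "('v \<Rightarrow> 'v) list \<Rightarrow> subexpression set" where
  "Sub s = {\<gamma>. length \<gamma> = length s}"

definition target :: "('v \<Rightarrow> 'v) list \<Rightarrow> subexpression \<Rightarrow> 'v \<Rightarrow> 'v" where
  "target s \<gamma> = word_prod (map2 (\<lambda>t e. if e then t else id) s \<gamma>)"

definition before :: "('v \<Rightarrow> 'v) list \<Rightarrow> subexpression \<Rightarrow> nat \<Rightarrow> 'v \<Rightarrow> 'v" where
  "before s \<gamma> i = target (take i s) (take i \<gamma>)"

definition flip :: "nat \<Rightarrow> subexpression \<Rightarrow> subexpression" where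
  "flip i \<gamma> = \<gamma>[i := \<not> \<gamma> ! i]"

definition flip2 :: "nat \<Rightarrow> nat \<Rightarrow> subexpression \<Rightarrow> subexpression" where
  "flip2 i j \<gamma> = flip i (flip j \<gamma>)"

definition hamming :: "subexpression \<Rightarrow> subexpression \<Rightarrow> nat" where
  "hamming \<gamma> \<delta> = card {i. i < length \<gamma> \<and> \<gamma> ! i \<noteq> \<delta> ! i}"

definition vertices :: "('v \<Rightarrow> 'v) list \<Rightarrow> ('v \<Rightarrow> 'v) \<Rightarrow> subexpression set" where
  "vertices s w = {\<gamma> \<in> Sub s. target s \<gamma> = w}"

definition edges :: "('v \<Rightarrow> 'v) list \<Rightarrow> ('v \<Rightarrow> 'v) \<Rightarrow> subexpression set set" where
  "edges s w = {{\<gamma>, \<delta>} | \<gamma> \<delta>. \<gamma> \<in> vertices s w \<and> \<delta> \<in> vertices s w \<and> hamming \<gamma> \<delta> = 2}"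

definition even_subgraph ::
    "('v \<Rightarrow> 'v) list \<Rightarrow> ('v \<Rightarrow> 'v) \<Rightarrow> subexpression set set \<Rightarrow> bool" where
  "even_subgraph s w F \<longleftrightarrow>
     F \<subseteq> edges s w \<and> (\<forall>\<gamma>\<in>vertices s w. even (card {e \<in> F. \<gamma> \<in> e}))"

text \<open>The edges of the closed walk through the listed vertices.\<close>

definition cycle_through :: "subexpression list \<Rightarrow> subexpression set set" where
  "cycle_through vs = {{vs ! k, vs ! (Suc k mod length vs)} | k. k < length vs}"

definition map_edges ::
    "(subexpression \<Rightarrow> subexpression) \<Rightarrow> subexpression set set \<Rightarrow> subexpression set set" where
  "map_edges \<phi> F = (\<lambda>e. \<phi> ` e) ` F"

definition pm_eq :: "'v::real_vector \<Rightarrow> 'v \<Rightarrow> bool" where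
  "pm_eq \<alpha> \<beta> \<longleftrightarrow> \<alpha> = \<beta> \<or> \<alpha> = - \<beta>"


section \<open>Dihedral cycles\<close>

text \<open>
  The sets \<open>\<sigma>\<^sup>(\<^sup>i\<^sup>)\<close> of positions with entry \<open>0\<close>; these positions are counted from \<open>1\<close>.
  Since \<open>\<sigma>\<^sup>(\<^sup>1\<^sup>) = \<sigma>\<^sup>(\<^sup>0\<^sup>)\<close>, the index \<open>0\<close> is skipped in the vertex lists of \<open>Cyc1\<close> and \<open>Cyc2\<close>.
\<close>

definition sigma1 :: "int \<Rightarrow> int \<Rightarrow> int \<Rightarrow> int set" where
  "sigma1 n x i =
    (if i = x + 1 then {x + 1, x + n + 1}
     else if 1 \<le> i then {x, 2*x + 1 - i, 2*x + 2 - i, x + n + 1}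
     else if x - n < i then {x, 2*x - i, 2*x + 1 - i, x + n + 1}
     else {x, x + n})"

definition sigma2 :: "int \<Rightarrow> int \<Rightarrow> int \<Rightarrow> int \<Rightarrow> int set" where
  "sigma2 n x y i =
    (let z = 2*x - y + 2*n; r = 2*y - x - n in
     if 1 \<le> i then
       if x \<le> i then
         if r < i then {i..2*y - i} \<union> {x + n, z}
         else {i..2*x - 2*y + 2*n - 1 + i} \<union> {z}
       else
         if r < i then {x} \<union> {2*x + 1 - i..2*y - i} \<union> {x + n, z}
         else {x} \<union> {2*x + 1 - i..2*x - 2*y + 2*n - 1 + i} \<union> {z}
     else
       if i \<le> r then {x} \<union> {2*x - i..2*x - 2*y + 2*n + i} \<union> {z}
       else {x} \<union> {2*x - i..2*y - 1 - i} \<union> {x + n, z})"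

definition zeros_at :: "int \<Rightarrow> int set \<Rightarrow> subexpression" where
  "zeros_at z P = map (\<lambda>k. k \<notin> P) [1..z]"

definition Cyc1 :: "int \<Rightarrow> int \<Rightarrow> int \<Rightarrow> subexpression set set" where
  "Cyc1 n x y = cycle_through (map (zeros_at y)
     ([{}] @ map (sigma1 n x) (rev [1..x + 1]) @ map (sigma1 n x) (rev [x - n..-1])))"

definition Cyc2 :: "int \<Rightarrow> int \<Rightarrow> int \<Rightarrow> subexpression set set" where
  "Cyc2 n x y = cycle_through (map (zeros_at (2*x - y + 2*n))
     ([{x + n}] @ map (sigma2 n x y) (rev [1..y]) @ map (sigma2 n x y) (rev [y - n..-1]) @ [{x}]))"

text \<open>\<open>E\<close> is one of the cycles, in subexpressions of an alternating expression of length \<open>z\<close>.\<close>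

definition standard_cycle :: "int \<Rightarrow> int \<Rightarrow> subexpression set set \<Rightarrow> bool" where
  "standard_cycle n z E \<longleftrightarrow>
     (\<exists>x y. 1 \<le> x \<and> x < n \<and> x + n + 1 \<le> y \<and> y \<le> 2*n \<and> z = y \<and> E = Cyc1 n x y) \<or>
     (\<exists>x y. 1 \<le> x \<and> x < y \<and> y \<le> n \<and> z = 2*x - y + 2*n \<and> E = Cyc2 n x y)"

definition alternating :: "'a \<Rightarrow> 'a \<Rightarrow> nat \<Rightarrow> 'a list" where
  "alternating c d z = map (\<lambda>k. if even k then c else d) [0..<z]"


section \<open>Order, triangles, squares and morphisms\<close>

context
  fixes form :: "'v::real_vector \<Rightarrow> 'v \<Rightarrow> real"
    and \<Delta> :: "'v set"
begin

text \<open>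
  This is used both for expressions in \<open>S\<close> and for expressions in the canonical generators of a
  dihedral reflection subgroup: the simple roots \<open>\<alpha>, \<beta>\<close> of the latter are by definition
  positive roots of the ambient system, so \<open>root_of\<close> gives the right vectors in both cases.
\<close>

definition arrow :: "('v \<Rightarrow> 'v) list \<Rightarrow> subexpression \<Rightarrow> nat \<Rightarrow> 'v" where
  "arrow s \<gamma> i = before s \<gamma> i (- root_of form \<Delta> (s ! i))"

definition sub_less :: "('v \<Rightarrow> 'v) list \<Rightarrow> subexpression \<Rightarrow> subexpression \<Rightarrow> bool" where
  "sub_less s \<delta> \<gamma> \<longleftrightarrow> \<delta> \<noteq> \<gamma> \<and> target s \<delta> = target s \<gamma> \<and>
     (let i = Max {i. i < length s \<and> \<delta> ! i \<noteq> \<gamma> ! i}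
      in len form \<Delta> (before s \<delta> i) < len form \<Delta> (before s \<gamma> i))"

definition supported_below ::
    "('v \<Rightarrow> 'v) list \<Rightarrow> subexpression \<Rightarrow> subexpression set set \<Rightarrow> bool" where
  "supported_below s \<gamma> F \<longleftrightarrow> (\<forall>e\<in>F. \<forall>\<delta>\<in>e. sub_less s \<delta> \<gamma> \<or> \<delta> = \<gamma>)"

definition Tr1 :: "('v \<Rightarrow> 'v) list \<Rightarrow> ('v \<Rightarrow> 'v) \<Rightarrow> subexpression set set set" where
  "Tr1 s w = {cycle_through [\<gamma>, flip2 i j \<gamma>, flip2 i k \<gamma>] | \<gamma> i j k.
     \<gamma> \<in> vertices s w \<and> i < j \<and> j < k \<and> k < length s \<and>
     pm_eq (arrow s \<gamma> i) (arrow s \<gamma> j) \<and> arrow s \<gamma> j = arrow s \<gamma> k \<and>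
     arrow s \<gamma> k \<in> positive_roots form \<Delta>}"

definition Tr2 :: "('v \<Rightarrow> 'v) list \<Rightarrow> ('v \<Rightarrow> 'v) \<Rightarrow> subexpression set set set" where
  "Tr2 s w = {cycle_through [\<gamma>, flip2 j k \<gamma>, flip2 i k \<gamma>] | \<gamma> i j k.
     \<gamma> \<in> vertices s w \<and> i < j \<and> j < k \<and> k < length s \<and>
     pm_eq (arrow s \<gamma> i) (arrow s \<gamma> k) \<and> pm_eq (arrow s \<gamma> j) (arrow s \<gamma> k) \<and>
     arrow s \<gamma> k \<in> positive_roots form \<Delta>}"

definition Tr3 :: "('v \<Rightarrow> 'v) list \<Rightarrow> ('v \<Rightarrow> 'v) \<Rightarrow> subexpression set set set" where
  "Tr3 s w = {cycle_through [\<gamma>, flip2 i j \<gamma>, flip2 j k \<gamma>] | \<gamma> i j k.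
     \<gamma> \<in> vertices s w \<and> i < j \<and> j < k \<and> k < length s \<and>
     pm_eq (arrow s \<gamma> i) (arrow s \<gamma> j) \<and> arrow s \<gamma> j = arrow s \<gamma> k \<and>
     arrow s \<gamma> k \<in> positive_roots form \<Delta>}"

definition Sq1 :: "('v \<Rightarrow> 'v) list \<Rightarrow> ('v \<Rightarrow> 'v) \<Rightarrow> subexpression set set set" where
  "Sq1 s w = {cycle_through [\<gamma>, flip2 i j \<gamma>, flip2 i j (flip2 k l \<gamma>), flip2 k l \<gamma>] | \<gamma> i j k l.
     \<gamma> \<in> vertices s w \<and> i < j \<and> j < k \<and> k < l \<and> l < length s \<and>
     pm_eq (arrow s \<gamma> i) (arrow s \<gamma> j) \<and> arrow s \<gamma> j \<in> positive_roots form \<Delta> \<and>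
     pm_eq (arrow s \<gamma> k) (arrow s \<gamma> l) \<and> arrow s \<gamma> l \<in> positive_roots form \<Delta>}"

definition Sq2 :: "('v \<Rightarrow> 'v) list \<Rightarrow> ('v \<Rightarrow> 'v) \<Rightarrow> subexpression set set set" where
  "Sq2 s w = {cycle_through [\<gamma>, flip2 j k \<gamma>, flip2 i l (flip2 j k \<gamma>), flip2 i l \<gamma>] | \<gamma> i j k l.
     \<gamma> \<in> vertices s w \<and> i < j \<and> j < k \<and> k < l \<and> l < length s \<and>
     pm_eq (arrow s \<gamma> i) (arrow s \<gamma> l) \<and> arrow s \<gamma> l \<in> positive_roots form \<Delta> \<and>
     pm_eq (arrow s \<gamma> j) (arrow s \<gamma> k) \<and> arrow s \<gamma> k \<in> positive_roots form \<Delta>}"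

definition dihedral_reflection_subgroup :: "('v \<Rightarrow> 'v) set \<Rightarrow> bool" where
  "dihedral_reflection_subgroup D \<longleftrightarrow>
     (\<exists>t\<in>reflections form \<Delta>. \<exists>t'\<in>reflections form \<Delta>. t \<noteq> t' \<and> D = generate GL {t, t'})"

definition inversions :: "('v \<Rightarrow> 'v) \<Rightarrow> ('v \<Rightarrow> 'v) set" where
  "inversions u = {t \<in> reflections form \<Delta>. len form \<Delta> (t \<circ> u) < len form \<Delta> u}"

definition canonical_generators :: "('v \<Rightarrow> 'v) set \<Rightarrow> ('v \<Rightarrow> 'v) set" where
  "canonical_generators D = {t \<in> reflections form \<Delta>. inversions t \<inter> D = {t}}"

definition positive_cosign_morphism ::
    "('v \<Rightarrow> 'v) list \<Rightarrow> ('v \<Rightarrow> 'v) list \<Rightarrow> (nat \<Rightarrow> nat) \<Rightarrow> (subexpression \<Rightarrow> subexpression) \<Rightarrow> bool"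
  where
  "positive_cosign_morphism t s p \<phi> \<longleftrightarrow>
     strict_mono_on {..<length t} p \<and> p ` {..<length t} \<subseteq> {..<length s} \<and>
     \<phi> ` Sub t \<subseteq> Sub s \<and>
     (\<forall>\<delta>\<in>Sub t. \<forall>i<length t.
        arrow s (\<phi> \<delta>) (p i) = arrow t \<delta> i \<and> \<phi> (flip i \<delta>) = flip (p i) (\<phi> \<delta>))"

text \<open>
  The map \<open>\<phi>\<close> of a morphism preserves Hamming distances, hence is injective and takes cycles to
  cycles.
\<close>

definition Cyc :: "('v \<Rightarrow> 'v) list \<Rightarrow> ('v \<Rightarrow> 'v) \<Rightarrow> subexpression set set set" where
  "Cyc s w = {map_edges \<phi> E | \<phi> E p D c d z.
     dihedral_reflection_subgroup D \<and> finite D \<and>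
     canonical_generators D = {c, d} \<and> c \<noteq> d \<and>
     standard_cycle (int (card D div 2)) (int z) E \<and>
     positive_cosign_morphism (alternating c d z) s p \<phi> \<and>
     map_edges \<phi> E \<subseteq> edges s w}"

end

end

theory Submission
  imports Defs
begin

text \<open>
  Write \<open>u\<^sub>i\<close> for the product of the factors of a subexpression \<open>\<gamma>\<close> before position \<open>i\<close>. The arrow at \<open>i\<close>
  is the root \<open>u\<^sub>i (- \<alpha>)\<close>, where \<open>\<alpha>\<close> is the simple root of the letter at \<open>i\<close>. Flipping the entry at
  \<open>i\<close> multiplies all later partial products on the left by the reflection in this arrow. Hence two
  flips preserve the target exactly if their arrows agree up to sign (\<open>target_flip2_iff\<close>), and they
  then lead to a smaller vertex exactly if the later arrow is a positive root (\<open>key_flip2_less_iff\<close>).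
  Such a pair of positions is called lowering.
  
  Let \<open>\<gamma>\<close> be the largest vertex of an even subgraph. The edges at \<open>\<gamma>\<close> are even in number and all come
  from lowering pairs. It therefore suffices to connect any two lowering pairs of \<open>\<gamma>\<close> by a sum of
  admissible cycles that stays below \<open>\<gamma>\<close> and whose only edges at \<open>\<gamma>\<close> are the two given ones; the two
  edges are then called linked. Adding such sums removes \<open>\<gamma>\<close> from the subgraph, and induction on the
  largest vertex finishes the proof (\<open>even_subgraph_in_cycle_sums\<close>).
  
  It remains to link two lowering pairs, with roots \<open>\<alpha>1\<close> and \<open>\<alpha>2\<close> at their later positions
  (\<open>linked_lowering\<close>). Pairs with the same root are linked by triangles. Links compose, so for
  \<open>\<alpha>1 \<noteq> \<alpha>2\<close> any pair with root \<open>\<alpha>1\<close> and any pair with root \<open>\<alpha>2\<close> will do. If some two such pairs are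
  disjoint or nested, flipping the later, respectively the inner one does not change the arrows of
  the other, and a square links them. So all of them may be assumed to interleave. Call a positive
  root inverted at \<open>i\<close> if the inverse of \<open>u\<^sub>i\<close> makes it negative. The interleaving produces positions
  \<open>h < k\<close> such that only \<open>\<alpha>1\<close> is inverted at \<open>h\<close> and both roots are inverted at \<open>k\<close>
  (\<open>interleaved_structure\<close>).
  
  Now the geometry of the plane of \<open>\<alpha>1\<close> and \<open>\<alpha>2\<close> comes in. The inverted positive roots are closed
  under positive combinations, and so are the others. Comparing \<open>h\<close> and \<open>k\<close> shows that every positive
  root of the plane is inverted at one of them. Only finitely many positive roots are inverted at a
  given position, so the plane contains finitely many roots (\<open>finite_plane\<close>). They form a fan: the
  positive ones are unit vectors \<open>\<rho> 1, \<dots>, \<rho> n\<close> at successive angles \<open>\<pi> / n\<close>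
  (\<open>finite_plane_fan\<close>). The reflections in them generate a dihedral group of order \<open>2 * n\<close>, with the
  reflections in \<open>\<rho> 1\<close> and \<open>\<rho> n\<close> as canonical generators (\<open>canonical_generators_dihedral\<close>).
  
  Continue the fan to all integers by \<open>\<rho> (m + n) = - \<rho> m\<close>. The rays \<open>\<rho> m\<close> with \<open>f i < m \<le> f i + n\<close>,
  for some integer \<open>f i\<close>, are mapped to positive roots by the inverse of \<open>u\<^sub>i\<close>. Here \<open>f\<close> is a walk
  that starts at \<open>0\<close>, can only rise at an arrow \<open>- \<rho> (f i + 1)\<close> and can only fall at an arrow
  \<open>\<rho> (f i)\<close> (\<open>walk_step\<close>). An alternating expression in the canonical generators gives the walk that
  rises at every step, and omitting one factor gives a walk that turns around once. Let \<open>\<alpha>1 = \<rho> x\<close>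
  and \<open>\<alpha>2 = \<rho> y\<close> with \<open>x < y\<close>. The interleaving determines the walk of \<open>\<gamma>\<close> at the relevant positions
  up to one alternative (\<open>linked_in_fan\<close>): it contains the steps either of a straight walk, or of a walk
  that rises to \<open>n + x - 1\<close> and then falls to \<open>y\<close>. Matching arrows at a single subexpression
  define a morphism (\<open>transport_morphism\<close>). It transports a chain of cycles of the first family in the
  straight case, and one cycle of the second family in the turning case, to cycles that link two
  pairs with roots \<open>\<alpha>1\<close> and \<open>\<alpha>2\<close>.
  
  The deeper fact about Coxeter groups behind all this is that \<open>u\<close> sends a simple root to a positive
  root unless \<open>u\<close> is shortened by the corresponding reflection on the right
  (\<open>nonneg_if_not_descent\<close>). It yields the dichotomy of positive and negative roots and the
  description, in terms of roots, of the reflections that shorten an element.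
\<close>

section \<open>Isometries and words\<close>

lemma word_prod_Nil [simp]: "word_prod [] = id"
  by (simp add: word_prod_def)

lemma word_prod_Cons [simp]: "word_prod (t # us) = t \<circ> word_prod us"
  by (simp add: word_prod_def)

lemma word_prod_append [simp]: "word_prod (us @ vs) = word_prod us \<circ> word_prod vs"
  by (induction us) (auto simp: comp_assoc)

lemma alternating_0 [simp]: "alternating c d 0 = []"
  by (simp add: alternating_def)

lemma alternating_Suc: "alternating c d (Suc k) = alternating c d k @ [if even k then c else d]"
  by (simp add: alternating_def)

lemma length_alternating [simp]: "length (alternating c d k) = k"
  by (simp add: alternating_def)

lemma nth_alternating [simp]: "i < k \<Longrightarrow> alternating c d k ! i = (if even i then c else d)"
  by (simp add: alternating_def)

lemma set_alternating: "set (alternating c d k) \<subseteq> {c, d}"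
  by (auto simp: alternating_def)

lemma alternating_append:
  "alternating c d (k + l) =
     alternating c d k @ (if even k then alternating c d l else alternating d c l)"
  by (rule nth_equalityI) (auto simp: nth_append)

text \<open>
  The notation \<open>inv\<close> stands for the inverse in a group.
\<close>

abbreviation fun_inv :: "('a \<Rightarrow> 'b) \<Rightarrow> 'b \<Rightarrow> 'a" where
  "fun_inv \<equiv> inv_into UNIV"

lemma linear_fun_inv:
  assumes "linear f" "bij f" shows "linear (fun_inv f)"
proof (rule linearI)
  have f: "f (fun_inv f x) = x" for x
    using assms(2) by (simp add: bij_is_surj surj_f_inv_f)
  have f': "fun_inv f (f x) = x" for x
    using assms(2) by (simp add: bij_is_inj)
  show "fun_inv f (x + y) = fun_inv f x + fun_inv f y" for x y
    using f f'[of "fun_inv f x + fun_inv f y"] by (simp add: linear_add[OF assms(1)])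
  show "fun_inv f (r *\<^sub>R x) = r *\<^sub>R fun_inv f x" for r x
    using f f'[of "r *\<^sub>R fun_inv f x"] by (simp add: linear_cmul[OF assms(1)])
qed

lemma group_GL: "group (GL :: ('v::real_vector \<Rightarrow> 'v) monoid)"
proof (rule groupI)
  fix f :: "'v \<Rightarrow> 'v" assume "f \<in> carrier GL"
  then have f: "linear f" "bij f" by (auto simp: GL_def)
  have "linear (fun_inv f)"
    using f by (rule linear_fun_inv)
  moreover have "fun_inv f \<circ> f = id" using f by (simp add: bij_is_inj)
  ultimately show "\<exists>g\<in>carrier GL. g \<otimes>\<^bsub>GL\<^esub> f = \<one>\<^bsub>GL\<^esub>"
    using f by (intro bexI[of _ "fun_inv f"]) (auto simp: GL_def bij_imp_bij_inv)
qed (auto simp: GL_def comp_assoc bij_comp linear_compose linear_id[unfolded id_def[symmetric]])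

lemma inv_GL: "linear f \<Longrightarrow> bij f \<Longrightarrow> inv\<^bsub>GL\<^esub> f = fun_inv f"
proof -
  assume f: "linear f" "bij f"
  have "linear (fun_inv f)"
    using f by (rule linear_fun_inv)
  then show ?thesis
    using f by (intro group.inv_equality[OF group_GL])
      (auto simp: GL_def bij_is_inj bij_imp_bij_inv)
qed

context based_root_system
begin

abbreviation refl where "refl \<equiv> reflection form"
abbreviation S where "S \<equiv> simple_reflections form \<Delta>"
abbreviation W where "W \<equiv> coxeter_group form \<Delta>"
abbreviation \<Phi> where "\<Phi> \<equiv> roots form \<Delta>"
abbreviation Pos where "Pos \<equiv> positive_roots form \<Delta>"
abbreviation T where "T \<equiv> reflections form \<Delta>"
abbreviation rt where "rt \<equiv> root_of form \<Delta>"
abbreviation ell where "ell \<equiv> len form \<Delta>"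

lemma form_simps [simp]:
  "form (u + v) x = form u x + form v x" "form x (u + v) = form x u + form x v"
  "form (u - v) x = form u x - form v x" "form x (u - v) = form x u - form x v"
  "form (a *\<^sub>R u) x = a * form u x" "form x (a *\<^sub>R u) = a * form x u"
  "form (- u) x = - form u x" "form x (- u) = - form x u"
  "form 0 x = 0" "form x 0 = 0"
  using form_bilinear
  by (simp_all add: bilinear_ladd bilinear_radd bilinear_lsub bilinear_rsub bilinear_lmul
      bilinear_rmul bilinear_lneg bilinear_rneg bilinear_lzero bilinear_rzero)

lemma refl_linear: "linear (refl a)"
  by (rule linearI) (auto simp: reflection_def algebra_simps)

lemma refl_simps [simp]:
  "refl a (u + v) = refl a u + refl a v" "refl a (u - v) = refl a u - refl a v"
  "refl a (r *\<^sub>R u) = r *\<^sub>R refl a u" "refl a (- u) = - refl a u"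
  by (auto simp: reflection_def algebra_simps)

lemma refl_self [simp]: "form a a = 1 \<Longrightarrow> refl a a = - a"
  by (simp add: reflection_def algebra_simps scaleR_2)

lemma refl_invol [simp]: "form a a = 1 \<Longrightarrow> refl a (refl a v) = v"
  by (simp add: reflection_def algebra_simps)

lemma refl_comp_invol [simp]: "form a a = 1 \<Longrightarrow> refl a \<circ> refl a = id"
  by auto

lemma refl_uminus [simp]: "refl (- a) = refl a"
  by (auto simp: reflection_def)

lemma refl_form: "form a a = 1 \<Longrightarrow> form (refl a u) (refl a v) = form u v"
  by (simp add: reflection_def algebra_simps form_sym[of a u] form_sym[of a v])

definition isometry :: "('v \<Rightarrow> 'v) \<Rightarrow> bool" where
  "isometry g \<longleftrightarrow> linear g \<and> bij g \<and> (\<forall>u v. form (g u) (g v) = form u v)"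

lemma isometry_id [simp]: "isometry id"
  by (auto simp: isometry_def linear_id[unfolded id_def[symmetric]])

lemma isometry_comp [intro]: "isometry g \<Longrightarrow> isometry h \<Longrightarrow> isometry (g \<circ> h)"
  by (auto simp: isometry_def bij_comp linear_compose)

lemma isometry_refl [intro]: "form a a = 1 \<Longrightarrow> isometry (refl a)"
  by (auto simp: isometry_def refl_linear refl_form intro: o_bij[of "refl a"])

lemma isometry_inv [intro]: "isometry g \<Longrightarrow> isometry (fun_inv g)"
  unfolding isometry_def
  by (metis bij_imp_bij_inv bij_is_surj linear_fun_inv surj_f_inv_f)

lemma isometry_inv_simps [simp]:
  "isometry g \<Longrightarrow> g (fun_inv g v) = v" "isometry g \<Longrightarrow> fun_inv g (g v) = v"
  by (auto simp: isometry_def bij_is_inj bij_is_surj surj_f_inv_f)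

lemma isometry_simps:
  assumes "isometry g"
  shows "g (u + v) = g u + g v" "g (u - v) = g u - g v" "g (- u) = - g u"
    "g (r *\<^sub>R u) = r *\<^sub>R g u" "form (g u) (g v) = form u v"
  using assms
  by (auto simp: isometry_def linear_add linear_diff linear_neg linear_cmul)

lemma isometry_eq_iff: "isometry g \<Longrightarrow> g u = g v \<longleftrightarrow> u = v"
  by (metis isometry_inv_simps(2))

lemma inv_comp_isometry:
  assumes "isometry g" "isometry h" shows "fun_inv (g \<circ> h) = fun_inv h \<circ> fun_inv g"
  using assms by (auto simp: isometry_def o_inv_distrib)

lemma inv_refl [simp]: "form a a = 1 \<Longrightarrow> fun_inv (refl a) = refl a"
  by (metis inv_unique_comp refl_comp_invol)

lemma refl_conj:
  assumes "isometry g" shows "refl (g a) (g v) = g (refl a v)"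
  using assms by (simp add: reflection_def isometry_simps)

lemma refl_conj_comp: "isometry g \<Longrightarrow> refl (g a) \<circ> g = g \<circ> refl a"
  by (auto simp: refl_conj)

lemma pm_eq_refl [simp]: "pm_eq a a" by (simp add: pm_eq_def)
lemma pm_eq_sym: "pm_eq a b \<longleftrightarrow> pm_eq b a" by (auto simp: pm_eq_def)
lemma pm_eq_uminus [simp]: "pm_eq (- a) b \<longleftrightarrow> pm_eq a b" "pm_eq a (- b) \<longleftrightarrow> pm_eq a b"
  by (auto simp: pm_eq_def)

lemma pm_eq_trans: "pm_eq a b \<Longrightarrow> pm_eq b c \<Longrightarrow> pm_eq a c"
  by (auto simp: pm_eq_def)

lemma refl_eq_iff:
  assumes "form a a = 1" "form b b = 1"
  shows "refl a = refl b \<longleftrightarrow> pm_eq a b"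
proof
  assume "refl a = refl b"
  then have "refl b a = - a" using assms by (metis refl_self)
  then have "(2::real) *\<^sub>R a = 2 *\<^sub>R (form a b *\<^sub>R b)" by (simp add: reflection_def algebra_simps scaleR_2)
  then have ab: "a = form a b *\<^sub>R b"
    by (metis scaleR_cancel_left zero_neq_numeral)
  then have "form a a = form a b * form a b" using assms by (metis form_simps(5) form_sym)
  then have "form a b = 1 \<or> form a b = -1" using assms(1) by (simp add: square_eq_1_iff)
  then show "pm_eq a b" using ab unfolding pm_eq_def by (metis scaleR_minus1_left scaleR_one)
qed (auto simp: pm_eq_def)

section \<open>The Coxeter group as a group of words\<close>

lemma S_iff: "t \<in> S \<longleftrightarrow> (\<exists>\<alpha>\<in>\<Delta>. t = refl \<alpha>)"
  by (auto simp: simple_reflections_def)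

lemma S_isometry: "t \<in> S \<Longrightarrow> isometry t"
  by (auto simp: S_iff form_unit)

lemma S_invol: "t \<in> S \<Longrightarrow> t \<circ> t = id"
  by (auto simp: S_iff form_unit)

lemma isometry_inv_GL: "isometry g \<Longrightarrow> inv\<^bsub>GL\<^esub> g = fun_inv g"
  by (auto simp: isometry_def inv_GL)

text \<open>
  The inverse of an involution is again a generator, so words in the generators form a group.
\<close>

lemma generate_GL_iff:
  assumes "\<And>t. t \<in> X \<Longrightarrow> isometry t \<and> t \<circ> t = id"
  shows "u \<in> generate GL X \<longleftrightarrow> (\<exists>us. set us \<subseteq> X \<and> word_prod us = u)"
proof
  assume "u \<in> generate GL X"
  then show "\<exists>us. set us \<subseteq> X \<and> word_prod us = u"
  proof induction
    case one
    have "set [] \<subseteq> X \<and> word_prod [] = \<one>\<^bsub>GL\<^esub>" by (simp add: GL_def)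
    then show ?case by blast
  next
    case (incl h)
    then have "set [h] \<subseteq> X \<and> word_prod [h] = h" by simp
    then show ?case by blast
  next
    case (inv h)
    then have "fun_inv h = h" using assms inv_unique_comp by blast
    then have "set [h] \<subseteq> X \<and> word_prod [h] = inv\<^bsub>GL\<^esub> h"
      using inv assms isometry_inv_GL by simp
    then show ?case by blast
  next
    case (eng h1 h2)
    then obtain us vs where "set us \<subseteq> X" "word_prod us = h1" "set vs \<subseteq> X" "word_prod vs = h2"
      by blast
    then have "set (us @ vs) \<subseteq> X \<and> word_prod (us @ vs) = h1 \<otimes>\<^bsub>GL\<^esub> h2" by (auto simp: GL_def)
    then show ?case by blast
  qed
next
  assume "\<exists>us. set us \<subseteq> X \<and> word_prod us = u"
  then obtain us where "set us \<subseteq> X" "word_prod us = u" by blast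
  then show "u \<in> generate GL X"
  proof (induction us arbitrary: u)
    case Nil
    then have "u = \<one>\<^bsub>GL\<^esub>" by (auto simp: GL_def)
    then show ?case using generate.one[of GL X] by simp
  next
    case (Cons t us)
    then have "t \<otimes>\<^bsub>GL\<^esub> word_prod us \<in> generate GL X"
      using generate.eng[OF generate.incl[of t X GL]] by auto
    moreover have "u = t \<circ> word_prod us" using Cons.prems by (metis word_prod_Cons)
    then have "u = t \<otimes>\<^bsub>GL\<^esub> word_prod us" by (simp add: GL_def)
    ultimately show ?case by simp
  qed
qed

lemma W_iff: "u \<in> W \<longleftrightarrow> (\<exists>us. set us \<subseteq> S \<and> word_prod us = u)"
  unfolding coxeter_group_def by (rule generate_GL_iff) (auto simp: S_isometry S_invol)

lemma W_id [simp]: "id \<in> W" unfolding W_iff by (rule exI[of _ "[]"]) simp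

lemma W_comp: "u \<in> W \<Longrightarrow> v \<in> W \<Longrightarrow> u \<circ> v \<in> W"
  unfolding W_iff by (metis Un_least set_append word_prod_append)

lemma S_W: "t \<in> S \<Longrightarrow> t \<in> W"
  unfolding W_iff by (rule exI[of _ "[t]"]) simp

lemma simple_W: "\<alpha> \<in> \<Delta> \<Longrightarrow> refl \<alpha> \<in> W"
  by (rule S_W) (auto simp: S_iff)

lemma word_prod_W: "set us \<subseteq> S \<Longrightarrow> word_prod us \<in> W"
  unfolding W_iff by blast

lemma word_prod_isometry: "(\<And>t. t \<in> set us \<Longrightarrow> isometry t) \<Longrightarrow> isometry (word_prod us)"
  by (induction us) auto

lemma W_isometry: "u \<in> W \<Longrightarrow> isometry u"
  unfolding W_iff using word_prod_isometry S_isometry by blast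

lemma word_prod_rev:
  assumes "\<And>t. t \<in> set us \<Longrightarrow> t \<circ> t = id"
  shows "word_prod us \<circ> word_prod (rev us) = id"
  using assms
proof (induction us)
  case (Cons t us)
  have IH: "word_prod us \<circ> word_prod (rev us) = id" by (rule Cons.IH) (rule Cons.prems, simp)
  have "word_prod (t # us) \<circ> word_prod (rev (t # us)) =
      t \<circ> (word_prod us \<circ> word_prod (rev us)) \<circ> t" by (simp only: comp_assoc) (simp add: comp_assoc)
  also have "\<dots> = t \<circ> t" unfolding IH by simp
  also have "\<dots> = id" by (rule Cons.prems) simp
  finally show ?case .
qed simp

lemma inv_eqI: "isometry g \<Longrightarrow> g \<circ> h = id \<Longrightarrow> fun_inv g = h"
  by (metis comp_apply eq_id_iff ext isometry_inv_simps(2))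

lemma W_inv: "u \<in> W \<Longrightarrow> fun_inv u \<in> W"
proof -
  assume u: "u \<in> W"
  then obtain us where us: "set us \<subseteq> S" "word_prod us = u" unfolding W_iff by blast
  have "word_prod us \<circ> word_prod (rev us) = id"
    by (rule word_prod_rev) (use us S_invol in blast)
  then have "fun_inv u = word_prod (rev us)" using us inv_eqI W_isometry[OF u] by blast
  then show ?thesis using us by (simp add: word_prod_W)
qed

lemma ell_le: "set us \<subseteq> S \<Longrightarrow> ell (word_prod us) \<le> length us"
  unfolding len_def by (rule Least_le) blast

lemma ell_reduced:
  assumes "u \<in> W" obtains us where "set us \<subseteq> S" "length us = ell u" "word_prod us = u"
proof -
  have "\<exists>k us. set us \<subseteq> S \<and> length us = k \<and> word_prod us = u" using assms unfolding W_iff by blast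
  then have "\<exists>us. set us \<subseteq> S \<and> length us = ell u \<and> word_prod us = u"
    unfolding len_def by (rule LeastI_ex)
  then show ?thesis using that by blast
qed

lemma ell_comp_word: "v \<in> W \<Longrightarrow> set us \<subseteq> S \<Longrightarrow> ell (v \<circ> word_prod us) \<le> ell v + length us"
  by (metis Un_least ell_le ell_reduced length_append set_append word_prod_append)

lemma ell_comp_S: "v \<in> W \<Longrightarrow> t \<in> S \<Longrightarrow> ell (v \<circ> t) \<le> ell v + 1"
  using ell_comp_word[of v "[t]"] by simp

section \<open>Alternating products in rank two\<close>

lemma isometry_alternating:
  assumes "form c c = 1" "form d d = 1"
  shows "isometry (word_prod (alternating (refl c) (refl d) k))"
proof (rule word_prod_isometry)
  fix t assume "t \<in> set (alternating (refl c) (refl d) k)"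
  then have "t = refl c \<or> t = refl d" using set_alternating by fastforce
  then show "isometry t" using assms by auto
qed

text \<open>
  Since \<open>refl c d = d - 2 * form c d *\<^sub>R c\<close>, appending a letter turns the images of the two roots
  into the next pair of neighbours in the sequence defined by the three-term recurrence.
\<close>

lemma alternating_apply:
  assumes "form c c = 1" "form d d = 1" "x 0 = - d" "x (Suc 0) = c"
    and rec: "\<And>k. x (Suc (Suc k)) = (- 2 * form c d) *\<^sub>R x (Suc k) - x k"
  shows "word_prod (alternating (refl c) (refl d) k) (if even k then c else d) = x (Suc k) \<and>
    word_prod (alternating (refl c) (refl d) k) (if even k then d else c) = - x k"
proof (induction k)
  case 0
  then show ?case using assms by simp
next
  case (Suc k)
  define w where "w = word_prod (alternating (refl c) (refl d) k)"
  have w: "isometry w" unfolding w_def by (rule isometry_alternating[OF assms(1,2)])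
  show ?case
    using Suc assms(1,2) unfolding alternating_Suc word_prod_append w_def[symmetric]
    by (auto simp: rec reflection_def isometry_simps[OF w] form_sym[of d c] algebra_simps scaleR_2)
qed

text \<open>The unit vectors of a Euclidean plane, listed by their angle in multiples of \<open>\<theta>\<close>.\<close>

definition rho :: "real \<Rightarrow> 'v \<Rightarrow> 'v \<Rightarrow> real \<Rightarrow> 'v" where
  "rho \<theta> c d t = (sin (t * \<theta>) / sin \<theta>) *\<^sub>R c + (sin ((t - 1) * \<theta>) / sin \<theta>) *\<^sub>R d"

lemma rho_0: "sin \<theta> \<noteq> 0 \<Longrightarrow> rho \<theta> c d 0 = - d"
  by (simp add: rho_def)

lemma rho_1: "sin \<theta> \<noteq> 0 \<Longrightarrow> rho \<theta> c d 1 = c"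
  by (simp add: rho_def)

lemma sin_three_term: "sin ((t + 2) * \<theta>) = 2 * cos \<theta> * sin ((t + 1) * \<theta>) - sin (t * \<theta>)" for t \<theta> :: real
proof -
  have "sin ((t + 2) * \<theta>) = sin ((t + 1) * \<theta> + \<theta>)" "sin (t * \<theta>) = sin ((t + 1) * \<theta> - \<theta>)"
    by (simp_all add: algebra_simps)
  then show ?thesis by (simp add: sin_add sin_diff)
qed

lemma rho_rec: "rho \<theta> c d (t + 2) = (2 * cos \<theta>) *\<^sub>R rho \<theta> c d (t + 1) - rho \<theta> c d t"
proof -
  have "sin ((t + 2 - 1) * \<theta>) = 2 * cos \<theta> * sin ((t + 1 - 1) * \<theta>) - sin ((t - 1) * \<theta>)"
    using sin_three_term[of "t - 1" \<theta>] by (simp add: algebra_simps)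
  then have 1: "sin ((t + 2 - 1) * \<theta>) / sin \<theta> =
      2 * cos \<theta> * (sin ((t + 1 - 1) * \<theta>) / sin \<theta>) - sin ((t - 1) * \<theta>) / sin \<theta>"
    by (simp add: diff_divide_distrib)
  have 2: "sin ((t + 2) * \<theta>) / sin \<theta> =
      2 * cos \<theta> * (sin ((t + 1) * \<theta>) / sin \<theta>) - sin (t * \<theta>) / sin \<theta>"
    by (simp add: sin_three_term diff_divide_distrib)
  show ?thesis
    unfolding rho_def 1 2
    by (simp only: scaleR_left_diff_distrib scaleR_right_distrib scaleR_scaleR) (simp add: algebra_simps)
qed

lemma rho_antiperiodic: "real n * \<theta> = pi \<Longrightarrow> rho \<theta> c d (t + real n) = - rho \<theta> c d t"
proof -
  assume n: "real n * \<theta> = pi"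
  have "sin ((t + real n) * \<theta>) = - sin (t * \<theta>)" for t
    using n by (simp add: distrib_right)
  from this[of t] this[of "t - 1"] show ?thesis
    unfolding rho_def by (simp add: algebra_simps)
qed

lemma alternating_rho:
  assumes "form c c = 1" "form d d = 1" "form c d = - cos \<theta>" "sin \<theta> \<noteq> 0"
  shows "word_prod (alternating (refl c) (refl d) k) (if even k then c else d) = rho \<theta> c d (real k + 1)"
    "word_prod (alternating (refl c) (refl d) k) (if even k then d else c) = - rho \<theta> c d (real k)"
proof -
  have rec: "rho \<theta> c d (real (Suc (Suc m))) =
      (- 2 * form c d) *\<^sub>R rho \<theta> c d (real (Suc m)) - rho \<theta> c d (real m)" for m
    using rho_rec[of \<theta> c d "real m"] assms(3) by (simp add: add_ac)
  have "real k + 1 = real (Suc k)" by simp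
  then show "word_prod (alternating (refl c) (refl d) k) (if even k then c else d) = rho \<theta> c d (real k + 1)"
    "word_prod (alternating (refl c) (refl d) k) (if even k then d else c) = - rho \<theta> c d (real k)"
    using alternating_apply[of c d "\<lambda>k. rho \<theta> c d (real k)" k, OF assms(1,2) _ _ rec]
      rho_0[OF assms(4), of c d] rho_1[OF assms(4), of c d] by (simp_all add: add.commute[of 1])
qed

text \<open>
  The plane of \<open>c\<close> and \<open>d\<close> is nondegenerate, so \<open>V\<close> splits into it and its orthogonal complement; the
  reflections act trivially on the latter.
\<close>

lemma alternating_eq_id:
  assumes "form c c = 1" "form d d = 1" "form c d = - cos \<theta>" "sin \<theta> \<noteq> 0" and n: "real n * \<theta> = pi"
  shows "word_prod (alternating (refl c) (refl d) (2 * n)) = id"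
proof
  fix v
  define w where "w = word_prod (alternating (refl c) (refl d) (2 * n))"
  have w: "isometry w" unfolding w_def by (rule isometry_alternating[OF assms(1,2)])
  have per: "rho \<theta> c d (t + real (2 * n)) = rho \<theta> c d t" for t
    using rho_antiperiodic[OF n, of c d t] rho_antiperiodic[OF n, of c d "t + real n"]
    by (simp add: algebra_simps)
  have wc: "w c = c" and wd: "w d = d"
    using alternating_rho[OF assms(1-4), of "2 * n"] per[of 1] per[of 0] assms(4)
    by (auto simp: w_def rho_0 rho_1 add.commute)
  define k where "k = cos \<theta>"
  have k: "1 - k\<^sup>2 \<noteq> 0" using assms(4) by (simp add: k_def sin_squared_eq[symmetric])
  \<comment> \<open>The orthogonal projection of \<open>v\<close> to the plane, by the inverse of the Gram matrix.\<close>
  define x where "x = ((form v c + k * form v d) / (1 - k\<^sup>2)) *\<^sub>R c + ((form v d + k * form v c) / (1 - k\<^sup>2)) *\<^sub>R d"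
  have cd: "form c d = - k" "form d c = - k" using assms form_sym by (auto simp: k_def)
  have xc: "form x c = form v c"
  proof -
    have "form x c = (form v c + k * form v d - k * (form v d + k * form v c)) / (1 - k\<^sup>2)"
      unfolding x_def by (simp add: assms(1,2) cd diff_divide_distrib)
    also have "form v c + k * form v d - k * (form v d + k * form v c) = form v c * (1 - k\<^sup>2)"
      by (simp add: algebra_simps power2_eq_square)
    finally show ?thesis using k by simp
  qed
  have xd: "form x d = form v d"
  proof -
    have "form x d = (form v d + k * form v c - k * (form v c + k * form v d)) / (1 - k\<^sup>2)"
      unfolding x_def by (simp add: assms(1,2) cd diff_divide_distrib)
    also have "form v d + k * form v c - k * (form v c + k * form v d) = form v d * (1 - k\<^sup>2)"
      by (simp add: algebra_simps power2_eq_square)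
    finally show ?thesis using k by simp
  qed
  have fix_orth: "word_prod us (v - x) = v - x" if "set us \<subseteq> {refl c, refl d}" for us
    using that
  proof (induction us)
    case (Cons t us)
    then have "t (v - x) = v - x" using xc xd by (auto simp: reflection_def)
    then show ?case using Cons by simp
  qed simp
  have "w x = x" unfolding x_def by (simp add: isometry_simps[OF w] wc wd)
  moreover have "w (v - x) = v - x" unfolding w_def by (rule fix_orth) (rule set_alternating)
  ultimately have "w v = v" using isometry_simps(2)[OF w, of v x] by simp
  then show "word_prod (alternating (refl c) (refl d) (2 * n)) v = id v" by (simp add: w_def)
qed

text \<open>
  These are the values at \<open>k\<close> of the Chebyshev polynomials of the second kind. They replace the
  quotients of sines when the inner product of the two roots is at most \<open>-1\<close>; then there are no
  sign changes.
\<close>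

fun cheb :: "real \<Rightarrow> nat \<Rightarrow> real" where
  "cheb k 0 = 0"
| "cheb k (Suc 0) = 1"
| "cheb k (Suc (Suc n)) = 2 * k * cheb k (Suc n) - cheb k n"

lemma cheb_grows: "k \<ge> 1 \<Longrightarrow> cheb k n \<ge> 0 \<and> cheb k (Suc n) \<ge> cheb k n + 1"
proof (induction n)
  case (Suc n)
  have "1 * cheb k (Suc n) \<le> k * cheb k (Suc n)" by (rule mult_right_mono) (use Suc in auto)
  moreover have "cheb k (Suc (Suc n)) = 2 * (k * cheb k (Suc n)) - cheb k n" by simp
  ultimately show ?case using Suc by linarith
qed simp

lemma alternating_cheb:
  assumes "form c c = 1" "form d d = 1" "form c d = - k"
  shows "word_prod (alternating (refl c) (refl d) n) (if even n then c else d) =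
    cheb k (Suc n) *\<^sub>R c + cheb k n *\<^sub>R d"
proof -
  define x where "x = (\<lambda>m. if m = 0 then - d else cheb k m *\<^sub>R c + cheb k (m - 1) *\<^sub>R d)"
  have "x (Suc (Suc m)) = (- 2 * form c d) *\<^sub>R x (Suc m) - x m" for m
    using assms(3) by (cases m) (auto simp: x_def algebra_simps)
  then show ?thesis using alternating_apply[of c d x n] assms by (auto simp: x_def)
qed

section \<open>Positive and negative roots\<close>

definition coef :: "'v \<Rightarrow> 'v \<Rightarrow> real" where
  "coef v \<delta> = representation \<Delta> v \<delta>"

definition nonneg :: "'v \<Rightarrow> bool" where
  "nonneg v \<longleftrightarrow> (\<forall>\<delta>\<in>\<Delta>. 0 \<le> coef v \<delta>)"

lemma coef_simps [simp]:
  "coef (u + v) \<delta> = coef u \<delta> + coef v \<delta>" "coef (u - v) \<delta> = coef u \<delta> - coef v \<delta>"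
  "coef (- u) \<delta> = - coef u \<delta>" "coef (r *\<^sub>R u) \<delta> = r * coef u \<delta>" "coef 0 \<delta> = 0"
  using independent_\<Delta> span_\<Delta>
  by (simp_all add: coef_def real_vector.representation_add real_vector.representation_diff
      real_vector.representation_neg real_vector.representation_scale real_vector.representation_zero)

lemma coef_simple: "\<alpha> \<in> \<Delta> \<Longrightarrow> coef \<alpha> \<delta> = (if \<delta> = \<alpha> then 1 else 0)"
  using independent_\<Delta> by (simp add: coef_def real_vector.representation_basis)

lemma coef_sum [simp]: "coef (sum f A) \<delta> = (\<Sum>a\<in>A. coef (f a) \<delta>)"
  by (induction A rule: infinite_finite_induct) auto

lemma coef_expand: "v = (\<Sum>\<delta>\<in>\<Delta>. coef v \<delta> *\<^sub>R \<delta>)"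
  unfolding coef_def
  by (rule real_vector.sum_representation_eq[symmetric])
    (use independent_\<Delta> span_\<Delta> finite_\<Delta> in auto)

lemma nonneg_add: "nonneg u \<Longrightarrow> nonneg v \<Longrightarrow> nonneg (u + v)"
  by (simp add: nonneg_def)

lemma nonneg_scale: "nonneg u \<Longrightarrow> r \<ge> 0 \<Longrightarrow> nonneg (r *\<^sub>R u)"
  by (simp add: nonneg_def)

lemma nonneg_simple: "\<alpha> \<in> \<Delta> \<Longrightarrow> nonneg \<alpha>"
  by (simp add: nonneg_def coef_simple)

lemma nonneg_antisym: "nonneg v \<Longrightarrow> nonneg (- v) \<Longrightarrow> v = 0"
  by (subst coef_expand[of v], rule sum.neutral) (auto simp: nonneg_def intro: antisym)

lemma Pos_iff: "\<alpha> \<in> Pos \<longleftrightarrow> \<alpha> \<in> \<Phi> \<and> nonneg \<alpha>"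
proof -
  have "(\<exists>c. (\<forall>\<beta>\<in>\<Delta>. c \<beta> \<ge> 0) \<and> \<alpha> = (\<Sum>\<beta>\<in>\<Delta>. c \<beta> *\<^sub>R \<beta>)) \<longleftrightarrow> nonneg \<alpha>"
  proof
    assume "\<exists>c. (\<forall>\<beta>\<in>\<Delta>. c \<beta> \<ge> 0) \<and> \<alpha> = (\<Sum>\<beta>\<in>\<Delta>. c \<beta> *\<^sub>R \<beta>)"
    then obtain c where c: "\<forall>\<beta>\<in>\<Delta>. c \<beta> \<ge> 0" "\<alpha> = (\<Sum>\<beta>\<in>\<Delta>. c \<beta> *\<^sub>R \<beta>)" by blast
    then have "coef \<alpha> \<delta> = c \<delta>" if "\<delta> \<in> \<Delta>" for \<delta>
      using that finite_\<Delta> by (simp add: coef_simple if_distrib cong: if_cong)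
    then show "nonneg \<alpha>" using c by (simp add: nonneg_def)
  next
    assume "nonneg \<alpha>"
    then show "\<exists>c. (\<forall>\<beta>\<in>\<Delta>. c \<beta> \<ge> 0) \<and> \<alpha> = (\<Sum>\<beta>\<in>\<Delta>. c \<beta> *\<^sub>R \<beta>)"
      using coef_expand[of \<alpha>] by (auto simp: nonneg_def)
  qed
  then show ?thesis by (simp add: positive_roots_def)
qed

lemma \<Phi>_iff: "\<beta> \<in> \<Phi> \<longleftrightarrow> (\<exists>u\<in>W. \<exists>\<alpha>\<in>\<Delta>. \<beta> = u \<alpha>)"
  by (auto simp: roots_def)

lemma simple_\<Phi>: "\<alpha> \<in> \<Delta> \<Longrightarrow> \<alpha> \<in> \<Phi>"
  unfolding \<Phi>_iff by (intro bexI[of _ id] bexI[of _ \<alpha>]) auto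

lemma W_\<Phi>: "u \<in> W \<Longrightarrow> \<beta> \<in> \<Phi> \<Longrightarrow> u \<beta> \<in> \<Phi>"
  unfolding \<Phi>_iff using W_comp by (metis comp_apply)

lemma \<Phi>_unit: "\<beta> \<in> \<Phi> \<Longrightarrow> form \<beta> \<beta> = 1"
  unfolding \<Phi>_iff using W_isometry form_unit by (auto simp: isometry_simps)

lemma \<Phi>_uminus: "\<beta> \<in> \<Phi> \<Longrightarrow> - \<beta> \<in> \<Phi>"
proof -
  assume "\<beta> \<in> \<Phi>"
  then obtain u \<alpha> where u: "u \<in> W" "\<alpha> \<in> \<Delta>" "\<beta> = u \<alpha>" unfolding \<Phi>_iff by blast
  have "(u \<circ> refl \<alpha>) \<alpha> = - \<beta>" using u W_isometry[OF u(1)] by (simp add: form_unit isometry_simps)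
  then show ?thesis using u unfolding \<Phi>_iff by (metis W_comp simple_W)
qed

lemma Pos_unit: "\<beta> \<in> Pos \<Longrightarrow> form \<beta> \<beta> = 1"
  by (simp add: Pos_iff \<Phi>_unit)

lemma not_Pos_both: "\<beta> \<in> Pos \<Longrightarrow> - \<beta> \<in> Pos \<Longrightarrow> False"
  using nonneg_antisym[of \<beta>] Pos_unit[of \<beta>] by (auto simp: Pos_iff)

text \<open>
  A word in two letters is equal, in a group where the letters are involutions, to an alternating
  word that is not longer; here \<open>a\<close> is the letter that would continue the alternating word.
\<close>

definition alternating_before :: "'a \<Rightarrow> 'a \<Rightarrow> nat \<Rightarrow> 'a list" where
  "alternating_before a b k = (if even k then alternating a b k else alternating b a k)"

lemma alternating_before_0 [simp]: "alternating_before a b 0 = []"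
  by (simp add: alternating_before_def)

lemma alternating_before_Suc:
  "alternating_before a b (Suc k) = alternating_before b a k @ [b]"
  by (simp add: alternating_before_def alternating_Suc)

lemma two_letter_word:
  fixes a b :: "'v \<Rightarrow> 'v"
  assumes "a \<circ> a = id" "b \<circ> b = id" "set us \<subseteq> {a, b}"
  shows "\<exists>k\<le>length us. word_prod us = word_prod (alternating_before a b k) \<or>
    word_prod us = word_prod (alternating_before b a k)"
  using assms(3)
proof (induction us rule: rev_induct)
  case (snoc e us)
  have step: "\<exists>m\<le>Suc k. word_prod (alternating_before a b k) \<circ> e = word_prod (alternating_before a b m) \<or>
      word_prod (alternating_before a b k) \<circ> e = word_prod (alternating_before b a m)"
    if "e \<in> {a, b}" "a \<circ> a = id" "b \<circ> b = id" for a b :: "'v \<Rightarrow> 'v" and k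
  proof (cases "e = a")
    case True
    then have "word_prod (alternating_before a b k) \<circ> e = word_prod (alternating_before b a (Suc k))"
      by (simp add: alternating_before_Suc)
    then show ?thesis by blast
  next
    case False
    then have e: "e = b" using that by simp
    show ?thesis
    proof (cases k)
      case 0
      then have "word_prod (alternating_before a b k) \<circ> e = word_prod (alternating_before a b (Suc 0))"
        by (simp add: alternating_before_Suc e)
      then show ?thesis using 0 by blast
    next
      case (Suc l)
      then have "word_prod (alternating_before a b k) \<circ> e = word_prod (alternating_before b a l)"
        by (simp add: alternating_before_Suc e comp_assoc that)
      then show ?thesis using Suc by (metis le_SucI le_refl)
    qed
  qed
  from snoc obtain k where k: "k \<le> length us"
    "word_prod us = word_prod (alternating_before a b k) \<or>
     word_prod us = word_prod (alternating_before b a k)" by auto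
  obtain m where "m \<le> Suc k" "word_prod us \<circ> e = word_prod (alternating_before a b m) \<or>
      word_prod us \<circ> e = word_prod (alternating_before b a m)"
    using k(2) step[of a b k] step[of b a k] snoc.prems assms(1,2) by auto
  moreover have "word_prod (us @ [e]) = word_prod us \<circ> e"
    by (simp only: word_prod_append word_prod_Cons word_prod_Nil comp_id)
  moreover have "m \<le> length (us @ [e])" using \<open>m \<le> Suc k\<close> k(1) by simp
  ultimately show ?case by metis
qed simp

text \<open>
  Splitting off from \<open>u\<close> a longest possible factor in two simple reflections, that of \<open>\<alpha>\<close> and one that
  shortens \<open>u\<close>, leaves a shorter element covered by induction and an alternating product, whose
  effect on \<open>\<alpha>\<close> is explicit.
\<close>

theorem nonneg_if_not_descent:
  assumes "u \<in> W" "\<alpha> \<in> \<Delta>" "ell u \<le> ell (u \<circ> refl \<alpha>)"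
  shows "nonneg (u \<alpha>)"
  using assms
proof (induction "ell u" arbitrary: u \<alpha> rule: less_induct)
  case less
  show ?case
  proof (cases "u = id")
    case True
    then show ?thesis using less.prems by (simp add: nonneg_simple)
  next
    case False
    \<comment> \<open>The last letter \<open>t\<close> of a reduced word is a simple reflection that does shorten \<open>u\<close>.\<close>
    obtain us where us: "set us \<subseteq> S" "length us = ell u" "word_prod us = u"
      using ell_reduced less.prems by blast
    then have "us \<noteq> []" using False by auto
    then obtain us' t where us': "us = us' @ [t]" by (metis rev_exhaust)
    then obtain \<beta> where \<beta>: "\<beta> \<in> \<Delta>" "t = refl \<beta>" using us by (auto simp: S_iff)
    have tt: "t \<circ> t = id" using \<beta> form_unit by simp
    have "u \<circ> t = word_prod us'" using us us' tt by (auto simp: comp_assoc)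
    then have ut: "ell (u \<circ> t) + 1 \<le> ell u" using us us' ell_le[of us'] by auto
    have "u = (u \<circ> t) \<circ> t" using tt by (simp add: comp_assoc)
    then have ut': "ell u \<le> ell (u \<circ> t) + 1"
      using ell_comp_S[of "u \<circ> t" t] less.prems \<beta> W_comp simple_W by (metis S_iff)
    have ab: "\<alpha> \<noteq> \<beta>" using ut less.prems(3) \<beta> by auto
    let ?a = "refl \<alpha>" and ?b = "refl \<beta>"
    have inS: "?a \<in> S" "?b \<in> S" using \<beta> less.prems S_iff by auto
    have inv: "?a \<circ> ?a = id" "?b \<circ> ?b = id" using inS S_invol by auto
    \<comment> \<open>Candidates for the first factor when a word in two letters is split off at the end of \<open>u\<close>.\<close>
    define A where "A = (\<lambda>v. v \<in> W \<and> (\<exists>as. set as \<subseteq> {?a, ?b} \<and> u = v \<circ> word_prod as \<and> ell v + length as = ell u))"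
    have "A (u \<circ> t)" unfolding A_def
      by (intro conjI exI[of _ "[t]"]) (use ut ut' \<beta> tt less.prems W_comp simple_W in \<open>auto simp: comp_assoc\<close>)
    then obtain v where v: "A v" "ell v \<le> ell (u \<circ> t)" and vmin: "\<And>v'. A v' \<Longrightarrow> ell v \<le> ell v'"
      using ex_has_least_nat[of A "u \<circ> t" ell] by blast
    then obtain as where as: "v \<in> W" "set as \<subseteq> {?a, ?b}" "u = v \<circ> word_prod as" "ell v + length as = ell u"
      unfolding A_def by blast
    have vu: "ell v < ell u" using v ut by simp
    \<comment> \<open>If \<open>v\<close> were shortened, a further letter could be split off; so the induction hypothesis applies.\<close>
    have vx: "nonneg (v x)" if x: "x \<in> {\<alpha>, \<beta>}" for x
    proof (rule less.hyps[OF vu as(1)])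
      show "x \<in> \<Delta>" using x less.prems \<beta> by auto
      show "ell v \<le> ell (v \<circ> refl x)"
      proof (rule ccontr)
        assume "\<not> ?thesis"
        then have lt: "ell (v \<circ> refl x) < ell v" by simp
        have xS: "refl x \<in> S" "refl x \<circ> refl x = id" using x inS inv by auto
        have *: "u = (v \<circ> refl x) \<circ> word_prod (refl x # as)"
          using as(3) xS by (metis comp_assoc comp_id word_prod_Cons)
        have vW: "v \<circ> refl x \<in> W" using as xS S_W W_comp by blast
        have "ell u \<le> ell (v \<circ> refl x) + length (refl x # as)"
          using ell_comp_word[OF vW, of "refl x # as"] * as(2) inS xS by auto
        then have "A (v \<circ> refl x)" unfolding A_def using vW * lt as x
          by (intro conjI exI[of _ "refl x # as"]) auto
        then show False using vmin lt by fastforce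
      qed
    qed
    have short: "length as \<le> length bs" if "set bs \<subseteq> {?a, ?b}"
      "u = v \<circ> word_prod bs \<or> u \<circ> ?a = v \<circ> word_prod bs" for bs
    proof -
      have "set bs \<subseteq> S" using that(1) inS by blast
      then show ?thesis using ell_comp_word[OF as(1), of bs] that(2) as(4) less.prems(3) by auto
    qed
    have set_alt: "set (alternating_before x y k) \<subseteq> {x, y}" for x y :: "'v \<Rightarrow> 'v" and k
      using set_alternating[of x y k] set_alternating[of y x k] by (auto simp: alternating_before_def)
    obtain k where k: "k \<le> length as" "word_prod as = word_prod (alternating_before ?a ?b k) \<or>
        word_prod as = word_prod (alternating_before ?b ?a k)"
      using two_letter_word[OF inv as(2)] by blast
    \<comment> \<open>The last letter is not \<open>?a\<close>, since \<open>?a\<close> does not shorten \<open>u\<close>.\<close>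
    have "word_prod as = word_prod (alternating_before ?a ?b k)"
    proof (rule ccontr)
      assume "\<not> ?thesis"
      then have k2: "word_prod as = word_prod (alternating_before ?b ?a k)" "k \<noteq> 0" using k by auto
      then obtain l where l: "k = Suc l" by (cases k) auto
      then have "word_prod as \<circ> ?a = word_prod (alternating_before ?a ?b l)"
        using k2 inv by (simp add: alternating_before_Suc comp_assoc)
      then have "u \<circ> ?a = v \<circ> word_prod (alternating_before ?a ?b l)" using as(3) by (simp add: comp_assoc)
      then have "length as \<le> l" using short[OF set_alt] by (metis (full_types) alternating_before_def length_alternating)
      then show False using k l by simp
    qed
    then have u: "u = v \<circ> word_prod (alternating_before ?a ?b k)" using as(3) by simp
    then have ka: "k = length as" using short[OF set_alt] k(1)
      by (metis (full_types) alternating_before_def length_alternating le_antisym)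
    define c d where "c = (if even k then \<alpha> else \<beta>)" and "d = (if even k then \<beta> else \<alpha>)"
    have cd: "(if even k then c else d) = \<alpha>" "alternating_before ?a ?b k = alternating (refl c) (refl d) k"
      "{c, d} = {\<alpha>, \<beta>}" "c \<noteq> d" "c \<in> \<Delta>" "d \<in> \<Delta>"
      using ab \<beta> less.prems by (auto simp: c_def d_def alternating_before_def)
    have unit: "form c c = 1" "form d d = 1" using cd form_unit by auto
    have u\<alpha>: "u \<alpha> = v (word_prod (alternating (refl c) (refl d) k) (if even k then c else d))"
      using u cd by simp
    have viso: "isometry v" using as W_isometry by blast
    have vcd: "nonneg (v c)" "nonneg (v d)" using vx cd by blast+
    from form_distinct[OF cd(5,6,4)] show ?thesis
    proof
      assume "form c d \<le> - 1"
      then show ?thesis using alternating_cheb[OF unit, of "- form c d" k] u\<alpha> vcd cheb_grows[of "- form c d"]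
        by (auto simp: isometry_simps[OF viso] intro!: nonneg_add nonneg_scale)
    next
      assume "\<exists>m\<ge>2. form c d = - cos (pi / real m)"
      then obtain m where m: "m \<ge> 2" "form c d = - cos (pi / real m)" by blast
      define \<theta> where "\<theta> = pi / real m"
      have th: "0 < \<theta>" "\<theta> < pi" "real m * \<theta> = pi" using m by (auto simp: \<theta>_def field_simps)
      then have s0: "sin \<theta> > 0" by (simp add: sin_gt_zero)
      show ?thesis
      proof (cases "k < m")
        case True
        have "x * \<theta> \<le> pi" if "x \<le> real m" for x
          using that th mult_right_mono[of x "real m" \<theta>] by simp
        then have "0 \<le> sin ((real k + 1) * \<theta>)" "0 \<le> sin (real k * \<theta>)"
          using True th(1) by (auto intro!: sin_ge_zero)
        then show ?thesis using alternating_rho(1)[OF unit, of \<theta> k] m \<theta>_def s0 vcd u\<alpha>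
          by (auto simp: rho_def isometry_simps[OF viso] intro!: nonneg_add nonneg_scale)
      next
        case False
        let ?w = "\<lambda>k. alternating (refl c) (refl d) k"
        have id2: "word_prod (?w (2 * m)) = id"
          by (rule alternating_eq_id[OF unit, of \<theta>]) (use m s0 th \<theta>_def in auto)
        have sw: "set (?w j) \<subseteq> {?a, ?b}" "set (alternating (refl d) (refl c) j) \<subseteq> {?a, ?b}" for j
          using set_alternating[of "refl c" "refl d" j] set_alternating[of "refl d" "refl c" j] cd(3) by auto
        \<comment> \<open>For \<open>k \<ge> m\<close> the relation of length \<open>2 * m\<close> shortens the alternating word of length \<open>k + 1\<close>, so
          that \<open>?a\<close> would shorten \<open>u\<close>.\<close>
        have "\<exists>bs. set bs \<subseteq> {?a, ?b} \<and> word_prod (?w (Suc k)) = word_prod bs \<and> length bs < k"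
        proof (cases "Suc k \<ge> 2 * m")
          case True
          then obtain j where "Suc k = 2 * m + j" by (metis le_iff_add)
          then have "word_prod (?w (Suc k)) = word_prod (?w j)" "j < k"
            using id2 m by (auto simp: alternating_append)
          then show ?thesis using sw by (metis length_alternating)
        next
          case False2: False
          then obtain j where j: "2 * m = Suc k + j" by (metis le_iff_add nat_le_linear)
          define bs where "bs = (if even (Suc k) then ?w j else alternating (refl d) (refl c) j)"
          have sbs: "set bs \<subseteq> {?a, ?b}" using sw by (simp add: bs_def)
          have eq: "word_prod (?w (Suc k)) \<circ> word_prod bs = id"
            using id2 unfolding j alternating_append by (auto simp: bs_def)
          have "word_prod bs \<circ> word_prod (rev bs) = id"
            by (rule word_prod_rev) (use sbs inv in auto)
          then have "word_prod (?w (Suc k)) = word_prod (rev bs)"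
            using eq by (metis comp_assoc comp_id id_comp)
          moreover have "length (rev bs) < k" using j False by (auto simp: bs_def)
          ultimately show ?thesis using sbs by (metis set_rev)
        qed
        then obtain bs where bs: "set bs \<subseteq> {?a, ?b}" "word_prod (?w (Suc k)) = word_prod bs" "length bs < k"
          by blast
        have "u \<circ> ?a = v \<circ> word_prod (?w (Suc k))"
          using u cd(1,2) by (auto simp: alternating_Suc comp_assoc split: if_splits)
        then have "length as \<le> length bs" using short bs by metis
        then show ?thesis using bs ka by simp
      qed
    qed
  qed
qed

text \<open>
  Of \<open>u\<close> and \<open>u \<circ> refl \<alpha>\<close> one is not shortened by \<open>refl \<alpha>\<close>, and their values at \<open>\<alpha>\<close> are opposite.
\<close>

lemma \<Phi>_cases: "\<beta> \<in> \<Phi> \<Longrightarrow> \<beta> \<in> Pos \<or> - \<beta> \<in> Pos"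
proof -
  assume "\<beta> \<in> \<Phi>"
  then obtain u \<alpha> where u: "u \<in> W" "\<alpha> \<in> \<Delta>" "\<beta> = u \<alpha>" unfolding \<Phi>_iff by blast
  have "(u \<circ> refl \<alpha>) \<alpha> = - \<beta>" using u W_isometry[OF u(1)] by (simp add: form_unit isometry_simps)
  moreover have "u \<circ> refl \<alpha> \<circ> refl \<alpha> = u" using u by (simp add: comp_assoc form_unit)
  ultimately show ?thesis
    using nonneg_if_not_descent[of u \<alpha>] nonneg_if_not_descent[of "u \<circ> refl \<alpha>" \<alpha>] u \<open>\<beta> \<in> \<Phi>\<close>
      \<Phi>_uminus W_comp simple_W by (metis Pos_iff nat_le_linear)
qed

lemma descent_iff:
  assumes "u \<in> W" "\<alpha> \<in> \<Delta>"
  shows "ell (u \<circ> refl \<alpha>) < ell u \<longleftrightarrow> - u \<alpha> \<in> Pos"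
proof -
  have r: "u \<alpha> \<in> \<Phi>" using assms W_\<Phi> simple_\<Phi> by blast
  have "(u \<circ> refl \<alpha>) \<alpha> = - u \<alpha>" using assms W_isometry[OF assms(1)] by (simp add: form_unit isometry_simps)
  moreover have "u \<circ> refl \<alpha> \<circ> refl \<alpha> = u" using assms by (simp add: comp_assoc form_unit)
  ultimately show ?thesis
    using nonneg_if_not_descent[of u \<alpha>] nonneg_if_not_descent[of "u \<circ> refl \<alpha>" \<alpha>] assms r
      \<Phi>_uminus W_comp simple_W not_Pos_both by (metis Pos_iff not_less less_imp_le)
qed

text \<open>
  Otherwise \<open>\<beta>\<close> would be a nonnegative multiple of \<open>\<alpha>\<close>, hence equal to it as both have norm \<open>1\<close>.
\<close>

lemma other_positive_coefficient:
  assumes "\<beta> \<in> Pos" "\<alpha> \<in> \<Delta>" "\<beta> \<noteq> \<alpha>"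
  obtains \<delta> where "\<delta> \<in> \<Delta>" "\<delta> \<noteq> \<alpha>" "coef \<beta> \<delta> > 0"
proof -
  have "\<exists>\<delta>\<in>\<Delta>. \<delta> \<noteq> \<alpha> \<and> coef \<beta> \<delta> \<noteq> 0"
  proof (rule ccontr)
    assume none: "\<not> ?thesis"
    have "\<beta> = (\<Sum>\<delta>\<in>\<Delta>. coef \<beta> \<delta> *\<^sub>R \<delta>)" by (rule coef_expand)
    also have "\<dots> = (\<Sum>\<delta>\<in>\<Delta>. if \<delta> = \<alpha> then coef \<beta> \<alpha> *\<^sub>R \<alpha> else 0)"
      by (rule sum.cong) (use none in auto)
    finally have b: "\<beta> = coef \<beta> \<alpha> *\<^sub>R \<alpha>" using assms finite_\<Delta> by simp
    have "form \<beta> \<beta> = coef \<beta> \<alpha> * coef \<beta> \<alpha> * form \<alpha> \<alpha>"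
      using b by (metis form_simps(5,6) mult.assoc)
    then have "coef \<beta> \<alpha> * coef \<beta> \<alpha> = 1"
      using assms Pos_unit form_unit by simp
    moreover have "coef \<beta> \<alpha> \<ge> 0" using assms by (auto simp: Pos_iff nonneg_def)
    ultimately have "coef \<beta> \<alpha> = 1" by (auto simp: square_eq_1_iff)
    then show False using b assms by simp
  qed
  then show ?thesis using that assms by (auto simp: Pos_iff nonneg_def order.strict_iff_order)
qed

text \<open>
  The reflection in \<open>\<alpha>\<close> changes the coefficient of \<open>\<alpha>\<close> only, so a positive coefficient survives, and
  one positive coefficient makes a root positive.
\<close>

lemma simple_refl_Pos:
  assumes "\<beta> \<in> Pos" "\<alpha> \<in> \<Delta>" "\<beta> \<noteq> \<alpha>"
  shows "refl \<alpha> \<beta> \<in> Pos"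
proof -
  obtain \<delta> where d: "\<delta> \<in> \<Delta>" "\<delta> \<noteq> \<alpha>" "coef \<beta> \<delta> > 0" using other_positive_coefficient assms by blast
  have "coef (refl \<alpha> \<beta>) \<delta> > 0" using d assms by (simp add: reflection_def coef_simple)
  moreover have "refl \<alpha> \<beta> \<in> \<Phi>" using assms by (simp add: Pos_iff W_\<Phi> simple_W)
  ultimately show ?thesis using \<Phi>_cases d by (force simp: Pos_iff nonneg_def)
qed

lemma Pos_pm_eq: "\<alpha> \<in> Pos \<Longrightarrow> \<beta> \<in> Pos \<Longrightarrow> pm_eq \<alpha> \<beta> \<longleftrightarrow> \<alpha> = \<beta>"
  using not_Pos_both unfolding pm_eq_def by fastforce

lemma root_of_refl: "\<alpha> \<in> Pos \<Longrightarrow> rt (refl \<alpha>) = \<alpha>"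
  unfolding root_of_def by (rule the_equality) (auto simp: refl_eq_iff Pos_unit Pos_pm_eq)

lemma simple_Pos: "\<alpha> \<in> \<Delta> \<Longrightarrow> \<alpha> \<in> Pos"
  by (simp add: Pos_iff simple_\<Phi> nonneg_simple)

lemma refl_W: "\<beta> \<in> \<Phi> \<Longrightarrow> refl \<beta> \<in> W"
proof -
  assume "\<beta> \<in> \<Phi>"
  then obtain u \<alpha> where u: "u \<in> W" "\<alpha> \<in> \<Delta>" "\<beta> = u \<alpha>" unfolding \<Phi>_iff by blast
  have "refl \<beta> = refl \<beta> \<circ> (u \<circ> fun_inv u)" using u W_isometry by auto
  also have "\<dots> = u \<circ> refl \<alpha> \<circ> fun_inv u" using u refl_conj_comp[OF W_isometry[OF u(1)], of \<alpha>]
    by (simp add: comp_assoc[symmetric])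
  finally show ?thesis using u by (simp add: W_comp simple_W W_inv)
qed

lemma T_iff: "t \<in> T \<longleftrightarrow> (\<exists>\<alpha>\<in>Pos. t = refl \<alpha>)"
proof
  assume "t \<in> T"
  then obtain u \<alpha> where u: "u \<in> W" "\<alpha> \<in> \<Delta>" "t = u \<circ> refl \<alpha> \<circ> inv\<^bsub>GL\<^esub> u"
    unfolding reflections_def by (auto simp: S_iff)
  note iso = W_isometry[OF u(1)]
  have "t = refl (u \<alpha>) \<circ> (u \<circ> fun_inv u)"
    using u refl_conj_comp[OF iso, of \<alpha>] isometry_inv_GL[OF iso] by (simp add: comp_assoc[symmetric])
  then have "t = refl (u \<alpha>)" using iso by auto
  then show "\<exists>\<alpha>\<in>Pos. t = refl \<alpha>" using \<Phi>_cases[of "u \<alpha>"] u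
    by (metis W_\<Phi> refl_uminus simple_\<Phi>)
next
  assume "\<exists>\<alpha>\<in>Pos. t = refl \<alpha>"
  then obtain \<beta> where \<beta>: "\<beta> \<in> \<Phi>" "t = refl \<beta>" by (auto simp: Pos_iff)
  then obtain u \<alpha> where u: "u \<in> W" "\<alpha> \<in> \<Delta>" "\<beta> = u \<alpha>" unfolding \<Phi>_iff by blast
  note iso = W_isometry[OF u(1)]
  have "t = refl \<beta> \<circ> (u \<circ> fun_inv u)" using \<beta> iso by auto
  also have "\<dots> = u \<circ> refl \<alpha> \<circ> inv\<^bsub>GL\<^esub> u" using u refl_conj_comp[OF iso, of \<alpha>]
    by (simp add: comp_assoc[symmetric] isometry_inv_GL[OF iso])
  finally show "t \<in> T" unfolding reflections_def using u S_iff by blast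
qed

text \<open>
  When the letters are applied to \<open>\<beta>\<close> one after the other, the root turns negative at some letter. A
  simple reflection makes no positive root negative but its own, so the root is the simple one there,
  and multiplying by \<open>refl \<beta>\<close> deletes that letter.
\<close>

lemma shorten:
  assumes "set us \<subseteq> S" "\<beta> \<in> Pos" "- fun_inv (word_prod us) \<beta> \<in> Pos"
  shows "\<exists>vs. set vs \<subseteq> S \<and> length vs < length us \<and> refl \<beta> \<circ> word_prod us = word_prod vs"
  using assms
proof (induction us arbitrary: \<beta>)
  case Nil
  then show ?case using not_Pos_both[of \<beta>] by simp
next
  case (Cons t us)
  then obtain \<alpha> where \<alpha>: "\<alpha> \<in> \<Delta>" "t = refl \<alpha>" by (auto simp: S_iff)
  have u: "form \<alpha> \<alpha> = 1" using \<alpha> form_unit by simp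
  show ?case
  proof (cases "\<beta> = \<alpha>")
    case True
    have "refl \<beta> \<circ> word_prod (t # us) = (refl \<beta> \<circ> t) \<circ> word_prod us"
      by (simp add: comp_assoc)
    also have "\<dots> = word_prod us" using \<alpha> u True by simp
    finally have "refl \<beta> \<circ> word_prod (t # us) = word_prod us" .
    moreover have "set us \<subseteq> S" "length us < length (t # us)" using Cons.prems(1) by auto
    ultimately show ?thesis by blast
  next
    case False
    have iso: "isometry (word_prod us)" using Cons.prems W_isometry word_prod_W by auto
    have b: "refl \<alpha> \<beta> \<in> Pos" using simple_refl_Pos False Cons.prems \<alpha> by blast
    have "fun_inv (word_prod (t # us)) \<beta> = fun_inv (word_prod us) (refl \<alpha> \<beta>)"
      using inv_comp_isometry[OF isometry_refl[OF u] iso] \<alpha> u by simp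
    then have "- fun_inv (word_prod us) (refl \<alpha> \<beta>) \<in> Pos" using Cons.prems(3) by argo
    then obtain vs where vs: "set vs \<subseteq> S" "length vs < length us"
      "refl (refl \<alpha> \<beta>) \<circ> word_prod us = word_prod vs"
      using Cons.IH[OF _ b] Cons.prems(1) by (metis insert_subset list.simps(15))
    have "refl \<beta> \<circ> word_prod (t # us) = t \<circ> (refl (refl \<alpha> \<beta>) \<circ> word_prod us)"
      using refl_conj_comp[OF isometry_refl[OF u], of "refl \<alpha> \<beta>"] \<alpha> u
      by (simp add: comp_assoc[symmetric])
    then have "refl \<beta> \<circ> word_prod (t # us) = word_prod (t # vs)" using vs(3) by (metis word_prod_Cons)
    moreover have "set (t # vs) \<subseteq> S" "length (t # vs) < length (t # us)" using vs Cons.prems(1) by auto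
    ultimately show ?thesis by blast
  qed
qed

text \<open>
  If the right side fails, it holds for \<open>refl \<beta> \<circ> u\<close> in place of \<open>u\<close>.
\<close>

lemma reflection_shortens_iff:
  assumes "u \<in> W" "\<beta> \<in> Pos"
  shows "ell (refl \<beta> \<circ> u) < ell u \<longleftrightarrow> - fun_inv u \<beta> \<in> Pos"
proof -
  have *: "ell (refl \<beta> \<circ> u) < ell u" if "u \<in> W" "- fun_inv u \<beta> \<in> Pos" for u
  proof -
    obtain us where us: "set us \<subseteq> S" "length us = ell u" "word_prod us = u"
      using ell_reduced \<open>u \<in> W\<close> by blast
    then show ?thesis using shorten[of us \<beta>] assms(2) that ell_le by (metis le_less_trans)
  qed
  have iso: "isometry u" using assms W_isometry by blast
  have bu: "form \<beta> \<beta> = 1" using assms Pos_unit by blast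
  have W': "refl \<beta> \<circ> u \<in> W" using assms by (simp add: Pos_iff W_comp refl_W)
  have "fun_inv (refl \<beta> \<circ> u) \<beta> = - fun_inv u \<beta>"
    using inv_comp_isometry[OF isometry_refl[OF bu] iso] bu iso
    by (simp add: isometry_simps[OF isometry_inv[OF iso]])
  moreover have "refl \<beta> \<circ> (refl \<beta> \<circ> u) = u" using bu by (simp add: comp_assoc[symmetric])
  moreover have "fun_inv u \<beta> \<in> \<Phi>" using assms by (simp add: Pos_iff W_\<Phi> W_inv)
  ultimately show ?thesis using *[of u] *[of "refl \<beta> \<circ> u"] assms W' \<Phi>_cases[of "fun_inv u \<beta>"]
    by (metis minus_minus not_less_iff_gr_or_eq)
qed

end

section \<open>Flipping entries of a subexpression\<close>

lemma length_flip [simp]: "length (flip i \<gamma>) = length \<gamma>"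
  by (simp add: flip_def)

lemma length_flip2 [simp]: "length (flip2 i j \<gamma>) = length \<gamma>"
  by (simp add: flip2_def)

lemma nth_flip: "k < length \<gamma> \<Longrightarrow> flip i \<gamma> ! k = (if k = i then \<not> \<gamma> ! k else \<gamma> ! k)"
  by (auto simp: flip_def nth_list_update)

lemma nth_flip2: "k < length \<gamma> \<Longrightarrow> i \<noteq> j \<Longrightarrow>
    flip2 i j \<gamma> ! k = (if k = i \<or> k = j then \<not> \<gamma> ! k else \<gamma> ! k)"
  by (auto simp: flip2_def nth_flip)

lemma flip_flip [simp]: "flip i (flip i \<gamma>) = \<gamma>"
  by (rule nth_equalityI) (auto simp: nth_flip)

lemma flip_commute: "flip i (flip j \<gamma>) = flip j (flip i \<gamma>)"
  by (rule nth_equalityI) (auto simp: nth_flip)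

lemma flip2_commute: "flip2 i j \<gamma> = flip2 j i \<gamma>"
  by (simp add: flip2_def flip_commute)

lemma flip2_flip2 [simp]: "flip2 i j (flip2 i j \<gamma>) = \<gamma>"
  by (metis flip2_def flip_commute flip_flip)

lemma hamming_flip2: "i \<noteq> j \<Longrightarrow> i < length \<gamma> \<Longrightarrow> j < length \<gamma> \<Longrightarrow> hamming \<gamma> (flip2 i j \<gamma>) = 2"
proof -
  assume ij: "i \<noteq> j" "i < length \<gamma>" "j < length \<gamma>"
  then have "{k. k < length \<gamma> \<and> \<gamma> ! k \<noteq> flip2 i j \<gamma> ! k} = {i, j}"
    by (auto simp: nth_flip2 split: if_splits)
  then show ?thesis using ij by (simp add: hamming_def)
qed

lemma hamming_2E:
  assumes "length \<delta> = length \<gamma>" "hamming \<gamma> \<delta> = 2"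
  obtains i j where "i < j" "j < length \<gamma>" "\<delta> = flip2 i j \<gamma>"
proof -
  obtain a b where ab: "{k. k < length \<gamma> \<and> \<gamma> ! k \<noteq> \<delta> ! k} = {a, b}" "a \<noteq> b"
    using assms(2) unfolding hamming_def card_2_iff by blast
  have a: "a < length \<gamma>" "b < length \<gamma>" using ab by blast+
  have eq: "\<delta> = flip2 a b \<gamma>"
  proof (rule nth_equalityI)
    fix k assume k: "k < length \<delta>"
    then have "\<gamma> ! k \<noteq> \<delta> ! k \<longleftrightarrow> k = a \<or> k = b" using ab assms(1) by auto
    then show "\<delta> ! k = flip2 a b \<gamma> ! k" using k ab assms(1) by (auto simp: nth_flip2)
  qed (simp add: assms)
  show ?thesis
    using that[of a b] that[of b a] a ab(2) eq flip2_commute[of a b] by (metis linorder_neqE_nat)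
qed

lemma Sub_flip [simp]: "flip i \<gamma> \<in> Sub s \<longleftrightarrow> \<gamma> \<in> Sub s"
  by (simp add: Sub_def)

lemma Sub_flip2 [simp]: "flip2 i j \<gamma> \<in> Sub s \<longleftrightarrow> \<gamma> \<in> Sub s"
  by (simp add: Sub_def)

lemma before_0 [simp]: "before s \<gamma> 0 = id"
  by (simp add: before_def target_def)

lemma before_length: "\<gamma> \<in> Sub s \<Longrightarrow> before s \<gamma> (length s) = target s \<gamma>"
  by (simp add: before_def Sub_def)

lemma before_Suc:
  assumes "\<gamma> \<in> Sub s" "i < length s"
  shows "before s \<gamma> (Suc i) = before s \<gamma> i \<circ> (if \<gamma> ! i then s ! i else id)"
proof -
  have "take (Suc i) s = take i s @ [s ! i]" "take (Suc i) \<gamma> = take i \<gamma> @ [\<gamma> ! i]"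
    using assms by (simp_all add: take_Suc_conv_app_nth Sub_def)
  moreover have "length (take i s) = length (take i \<gamma>)" using assms by (simp add: Sub_def)
  ultimately show ?thesis
    unfolding before_def target_def by (simp only: zip_append map_append word_prod_append) simp
qed

lemma before_cong:
  assumes "\<gamma> \<in> Sub s" "\<delta> \<in> Sub s" "i \<le> length s" "\<And>k. k < i \<Longrightarrow> \<gamma> ! k = \<delta> ! k"
  shows "before s \<gamma> i = before s \<delta> i"
proof -
  have "take i \<gamma> = take i \<delta>"
    by (rule nth_equalityI) (use assms in \<open>auto simp: Sub_def\<close>)
  then show ?thesis by (simp add: before_def)
qed

context based_root_system
begin

abbreviation arr where "arr \<equiv> arrow form \<Delta>"

text \<open>
  The letters may be arbitrary reflections, so that this covers expressions in the simple reflections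
  as well as in the canonical generators of a dihedral subgroup.
\<close>

definition root_expression :: "('v \<Rightarrow> 'v) list \<Rightarrow> bool" where
  "root_expression s \<longleftrightarrow> set s \<subseteq> T"

lemma root_expression_nth:
  assumes "root_expression s" "i < length s"
  shows "rt (s ! i) \<in> Pos" "s ! i = refl (rt (s ! i))"
proof -
  obtain \<alpha> where "\<alpha> \<in> Pos" "s ! i = refl \<alpha>"
    using assms T_iff nth_mem unfolding root_expression_def by blast
  then show "rt (s ! i) \<in> Pos" "s ! i = refl (rt (s ! i))" by (simp_all add: root_of_refl)
qed

lemma root_expression_invol:
  assumes "root_expression s" "i < length s"
  shows "s ! i \<circ> s ! i = id"
  using root_expression_nth[OF assms] Pos_unit by (metis refl_comp_invol)

lemma before_W:
  assumes "root_expression s" "\<gamma> \<in> Sub s" "i \<le> length s"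
  shows "before s \<gamma> i \<in> W"
  using assms(3)
proof (induction i)
  case 0
  show ?case unfolding before_0 by (rule W_id)
next
  case (Suc i)
  have "s ! i \<in> W" using root_expression_nth[OF assms(1), of i] Suc.prems refl_W Pos_iff by fastforce
  then have "(if \<gamma> ! i then s ! i else id) \<in> W" using W_id by (cases "\<gamma> ! i") (simp_all only: if_True if_False)
  moreover have "before s \<gamma> i \<in> W" "i < length s" using Suc by auto
  ultimately show ?case unfolding before_Suc[OF assms(2) \<open>i < length s\<close>] by (metis W_comp)
qed

lemma arr_\<Phi>:
  assumes "root_expression s" "\<gamma> \<in> Sub s" "i < length s"
  shows "arr s \<gamma> i \<in> \<Phi>"
  using before_W[OF assms(1,2), of i] root_expression_nth(1)[OF assms(1,3)] assms(3)
  by (simp add: arrow_def W_\<Phi> \<Phi>_uminus Pos_iff)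

lemma arr_unit:
  "root_expression s \<Longrightarrow> \<gamma> \<in> Sub s \<Longrightarrow> i < length s \<Longrightarrow> form (arr s \<gamma> i) (arr s \<gamma> i) = 1"
  by (rule \<Phi>_unit) (rule arr_\<Phi>)

lemma before_isometry:
  "root_expression s \<Longrightarrow> \<gamma> \<in> Sub s \<Longrightarrow> i \<le> length s \<Longrightarrow> isometry (before s \<gamma> i)"
  by (rule W_isometry) (rule before_W)

lemma refl_arr_comp_before:
  assumes "root_expression s" "\<gamma> \<in> Sub s" "i < length s"
  shows "refl (arr s \<gamma> i) \<circ> before s \<gamma> i = before s \<gamma> i \<circ> s ! i"
proof -
  have "arr s \<gamma> i = - before s \<gamma> i (rt (s ! i))"
    using before_isometry[OF assms(1,2), of i] assms(3) by (simp add: arrow_def isometry_simps)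
  then have "refl (arr s \<gamma> i) \<circ> before s \<gamma> i = before s \<gamma> i \<circ> refl (rt (s ! i))"
    using refl_conj_comp[OF before_isometry[OF assms(1,2), of i]] assms(3) by simp
  then show ?thesis using root_expression_nth(2)[OF assms(1,3)] by simp
qed

text \<open>
  Moved to the left through the partial product, the inserted or deleted letter becomes the reflection
  in the arrow.
\<close>

lemma before_flip:
  assumes "root_expression s" "\<gamma> \<in> Sub s" "i < length s" "j \<le> length s"
  shows "before s (flip i \<gamma>) j = (if i < j then refl (arr s \<gamma> i) \<circ> before s \<gamma> j else before s \<gamma> j)"
proof (cases "i < j")
  case False
  then show ?thesis using assms
    by (auto intro!: before_cong simp: nth_flip Sub_def)
next
  case True
  then have "Suc i \<le> j" by simp
  then have "before s (flip i \<gamma>) j = refl (arr s \<gamma> i) \<circ> before s \<gamma> j"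
    using assms(4)
  proof (induction j rule: dec_induct)
    case base
    have eq: "before s (flip i \<gamma>) i = before s \<gamma> i"
      by (rule before_cong) (use assms in \<open>auto simp: nth_flip Sub_def\<close>)
    have inv: "s ! i \<circ> s ! i = id" using root_expression_invol assms by blast
    have "before s (flip i \<gamma>) (Suc i) = before s \<gamma> i \<circ> (if \<gamma> ! i then id else s ! i)"
      using before_Suc[of "flip i \<gamma>" s i] assms eq by (simp add: nth_flip Sub_def)
    also have "\<dots> = (before s \<gamma> i \<circ> s ! i) \<circ> (if \<gamma> ! i then s ! i else id)"
      using inv by (simp add: comp_assoc)
    also have "\<dots> = refl (arr s \<gamma> i) \<circ> before s \<gamma> (Suc i)"
      unfolding refl_arr_comp_before[OF assms(1-3), symmetric] before_Suc[OF assms(2,3)]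
      by (simp only: comp_assoc)
    finally show ?case .
  next
    case (step j)
    have "before s (flip i \<gamma>) (Suc j) = before s (flip i \<gamma>) j \<circ> (if \<gamma> ! j then s ! j else id)"
      using before_Suc[of "flip i \<gamma>" s j] assms step by (simp add: nth_flip Sub_def)
    then show ?case using step before_Suc[OF assms(2), of j] by (simp add: comp_assoc)
  qed
  then show ?thesis using True by simp
qed

lemma arr_flip:
  assumes "root_expression s" "\<gamma> \<in> Sub s" "i < length s" "j < length s"
  shows "arr s (flip i \<gamma>) j = (if i < j then refl (arr s \<gamma> i) (arr s \<gamma> j) else arr s \<gamma> j)"
  using before_flip[OF assms(1-3), of j] assms(4) by (simp add: arrow_def)

lemma target_flip:
  assumes "root_expression s" "\<gamma> \<in> Sub s" "i < length s"
  shows "target s (flip i \<gamma>) = refl (arr s \<gamma> i) \<circ> target s \<gamma>"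
  using before_flip[OF assms, of "length s"] before_length[OF assms(2)]
    before_length[of "flip i \<gamma>" s] assms by (metis Sub_flip le_refl)

lemma arr_flip2:
  assumes "root_expression s" "\<gamma> \<in> Sub s" "i < j" "j < length s" "k < length s"
    and pm: "pm_eq (arr s \<gamma> i) (arr s \<gamma> j)"
  shows "arr s (flip2 i j \<gamma>) k =
    (if k \<le> i \<or> j < k then arr s \<gamma> k else refl (arr s \<gamma> i) (arr s \<gamma> k))"
proof -
  have i: "i < length s" using assms by simp
  have "refl (arr s \<gamma> i) = refl (arr s \<gamma> j)" using pm by (auto simp: pm_eq_def)
  then show ?thesis
    using arr_flip[OF assms(1) _ i, of "flip j \<gamma>"] arr_flip[OF assms(1,2,4)] assms i
    by (auto simp: flip2_def arr_unit)
qed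

text \<open>
  The target is multiplied by the product of the reflections in the two arrows, which is trivial
  exactly if they coincide.
\<close>

lemma target_flip2_iff:
  assumes "root_expression s" "\<gamma> \<in> Sub s" "i < j" "j < length s"
  shows "target s (flip2 i j \<gamma>) = target s \<gamma> \<longleftrightarrow> pm_eq (arr s \<gamma> i) (arr s \<gamma> j)"
proof -
  let ?a = "arr s \<gamma> i" and ?b = "arr s \<gamma> j"
  have i: "i < length s" using assms by simp
  note u = arr_unit[OF assms(1,2) i] arr_unit[OF assms(1,2,4)]
  have eq: "target s (flip2 i j \<gamma>) = refl ?a \<circ> (refl ?b \<circ> target s \<gamma>)"
    using target_flip[OF assms(1) _ i, of "flip j \<gamma>"] target_flip[OF assms(1,2,4)]
      arr_flip[OF assms(1,2,4) i] assms by (simp add: flip2_def)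
  have iso: "isometry (target s \<gamma>)"
    using before_isometry[OF assms(1,2), of "length s"] before_length[OF assms(2)] by simp
  have "target s (flip2 i j \<gamma>) = target s \<gamma> \<longleftrightarrow> refl ?a = refl ?b"
  proof
    assume t: "target s (flip2 i j \<gamma>) = target s \<gamma>"
    show "refl ?a = refl ?b"
    proof
      fix v
      have "refl ?a (refl ?b v) = v"
        using fun_cong[OF eq, of "fun_inv (target s \<gamma>) v"] iso t by simp
      then show "refl ?a v = refl ?b v" using u by (metis refl_invol)
    qed
  next
    assume "refl ?a = refl ?b"
    then show "target s (flip2 i j \<gamma>) = target s \<gamma>" unfolding eq using u by (auto simp: comp_def)
  qed
  then show ?thesis using refl_eq_iff u by blast
qed

section \<open>The order on subexpressions with a given target\<close>

text \<open>
  Going down in the order means clearing the last differing position at which the arrow is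
  positive, so the order is the numerical order of the binary number formed by these positions.
\<close>

definition key :: "('v \<Rightarrow> 'v) list \<Rightarrow> subexpression \<Rightarrow> nat" where
  "key s \<gamma> = (\<Sum>j<length s. if arr s \<gamma> j \<in> Pos then 2 ^ j else 0)"

lemma binary_less:
  fixes P Q :: "nat \<Rightarrow> bool"
  assumes "j < n" "\<And>m. j < m \<Longrightarrow> m < n \<Longrightarrow> P m = Q m" "\<not> P j" "Q j"
  shows "(\<Sum>m<n. if P m then 2 ^ m else 0 :: nat) < (\<Sum>m<n. if Q m then 2 ^ m else 0)"
proof -
  have split: "(\<Sum>m<n. f m) = (\<Sum>m<j. f m) + f j + (\<Sum>m\<in>{j<..<n}. f m)" for f :: "nat \<Rightarrow> nat"
  proof -
    have "{..<n} = {..<j} \<union> insert j {j<..<n}" using assms(1) by auto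
    moreover have "sum f ({..<j} \<union> insert j {j<..<n}) = (\<Sum>m<j. f m) + sum f (insert j {j<..<n})"
      by (rule sum.union_disjoint) auto
    moreover have "sum f (insert j {j<..<n}) = f j + sum f {j<..<n}"
      by (rule sum.insert) auto
    ultimately show ?thesis by (simp only: add.assoc)
  qed
  have "(\<Sum>m<j. if P m then 2 ^ m else 0 :: nat) \<le> (\<Sum>m<j. 2 ^ m)" by (rule sum_mono) auto
  also have "\<dots> < 2 ^ j" by (induction j) auto
  finally have low: "(\<Sum>m<j. if P m then 2 ^ m else 0 :: nat) < 2 ^ j" .
  have "(\<Sum>m\<in>{j<..<n}. if P m then 2 ^ m else 0 :: nat) = (\<Sum>m\<in>{j<..<n}. if Q m then 2 ^ m else 0)"
    by (rule sum.cong) (use assms(2) in auto)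
  then show ?thesis unfolding split using low assms(3,4) by simp
qed

text \<open>
  The remaining factors and the targets agree, so they cancel.
\<close>

lemma before_eq_after_last_difference:
  assumes "root_expression s" "\<gamma> \<in> Sub s" "\<delta> \<in> Sub s" "target s \<gamma> = target s \<delta>"
    and "\<And>k. j < k \<Longrightarrow> k < length s \<Longrightarrow> \<gamma> ! k = \<delta> ! k" and m: "j < m" "m \<le> length s"
  shows "before s \<gamma> m = before s \<delta> m"
  using m(2,1)
proof (induction m rule: inc_induct)
  case base
  then show ?case using assms(4) before_length[OF assms(2)] before_length[OF assms(3)] by metis
next
  case (step m)
  let ?e = "if \<delta> ! m then s ! m else id"
  have e: "?e \<circ> ?e = id" using root_expression_invol assms(1) step by simp
  have "before s \<gamma> (Suc m) = before s \<delta> (Suc m)" "\<gamma> ! m = \<delta> ! m"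
    using step assms(5)[of m] by simp_all
  then have "before s \<gamma> m \<circ> ?e = before s \<delta> m \<circ> ?e"
    using before_Suc[OF assms(2) step(2)] before_Suc[OF assms(3) step(2)] by metis
  then have "before s \<gamma> m \<circ> (?e \<circ> ?e) = before s \<delta> m \<circ> (?e \<circ> ?e)" by (metis comp_assoc)
  then show ?case unfolding e by simp
qed

definition last_difference :: "('v \<Rightarrow> 'v) list \<Rightarrow> subexpression \<Rightarrow> subexpression \<Rightarrow> nat \<Rightarrow> bool" where
  "last_difference s \<gamma> \<delta> j \<longleftrightarrow> j < length s \<and> \<gamma> ! j \<noteq> \<delta> ! j \<and> (\<forall>k. j < k \<longrightarrow> k < length s \<longrightarrow> \<gamma> ! k = \<delta> ! k)"

lemma last_difference_exists:
  assumes "\<gamma> \<in> Sub s" "\<delta> \<in> Sub s" "\<gamma> \<noteq> \<delta>"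
  shows "last_difference s \<gamma> \<delta> (Max {i. i < length s \<and> \<delta> ! i \<noteq> \<gamma> ! i})"
proof -
  let ?D = "{i. i < length s \<and> \<delta> ! i \<noteq> \<gamma> ! i}"
  have fin: "finite ?D" by simp
  have ne: "?D \<noteq> {}" using assms by (auto simp: Sub_def intro: nth_equalityI)
  have "Max ?D \<in> ?D" using fin ne by (rule Max_in)
  moreover have "k \<le> Max ?D" if "k \<in> ?D" for k using fin that by simp
  ultimately show ?thesis unfolding last_difference_def by fastforce
qed

lemma arr_last_difference:
  assumes "root_expression s" "\<gamma> \<in> Sub s" "\<delta> \<in> Sub s" "target s \<gamma> = target s \<delta>"
    and d: "last_difference s \<gamma> \<delta> j"
  shows "before s \<delta> j = before s \<gamma> j \<circ> s ! j"
    and "arr s \<delta> j = - arr s \<gamma> j"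
    and "\<And>m. j < m \<Longrightarrow> m < length s \<Longrightarrow> arr s \<delta> m = arr s \<gamma> m"
proof -
  have j: "j < length s" using d by (simp add: last_difference_def)
  have eq: "before s \<gamma> m = before s \<delta> m" if "j < m" "m \<le> length s" for m
    using before_eq_after_last_difference[OF assms(1-4) _ that] d
    by (simp add: last_difference_def)
  show "\<And>m. j < m \<Longrightarrow> m < length s \<Longrightarrow> arr s \<delta> m = arr s \<gamma> m"
    using eq by (simp add: arrow_def)
  have inv: "s ! j \<circ> s ! j = id" using root_expression_invol assms(1) j by blast
  have "before s \<gamma> j \<circ> (if \<gamma> ! j then s ! j else id) = before s \<delta> j \<circ> (if \<delta> ! j then s ! j else id)"
    using eq[of "Suc j"] j before_Suc[OF assms(2) j] before_Suc[OF assms(3) j] by simp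
  moreover have "\<gamma> ! j \<noteq> \<delta> ! j" using d by (simp add: last_difference_def)
  ultimately have or: "before s \<gamma> j \<circ> s ! j = before s \<delta> j \<or> before s \<gamma> j = before s \<delta> j \<circ> s ! j"
    by (cases "\<gamma> ! j"; cases "\<delta> ! j") (simp_all only: if_True if_False comp_id, blast+)
  have "before s \<delta> j \<circ> s ! j \<circ> s ! j = before s \<delta> j" unfolding comp_assoc inv by simp
  then have *: "before s \<delta> j = before s \<gamma> j \<circ> s ! j" using or by auto
  then show "before s \<delta> j = before s \<gamma> j \<circ> s ! j" .
  have "(s ! j) (- rt (s ! j)) = rt (s ! j)"
    using root_expression_nth[OF assms(1) j] Pos_unit by (metis refl_self refl_simps(4) minus_minus)
  then show "arr s \<delta> j = - arr s \<gamma> j"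
    using before_isometry[OF assms(1,2), of j] j
    by (simp add: arrow_def * isometry_simps)
qed

text \<open>
  The arrows of \<open>\<gamma>\<close> and \<open>\<delta>\<close> are opposite at the last difference and equal after it, so \<open>j\<close> is the
  leading binary digit at which the keys differ.
\<close>

lemma key_less_iff:
  assumes "root_expression s" "\<gamma> \<in> Sub s" "\<delta> \<in> Sub s" "target s \<gamma> = target s \<delta>"
    and d: "last_difference s \<gamma> \<delta> j"
  shows "key s \<delta> < key s \<gamma> \<longleftrightarrow> arr s \<gamma> j \<in> Pos" "key s \<gamma> < key s \<delta> \<longleftrightarrow> arr s \<gamma> j \<notin> Pos"
proof -
  note a = arr_last_difference[OF assms]
  have j: "j < length s" using d by (simp add: last_difference_def)
  have "arr s \<gamma> j \<in> Pos \<longleftrightarrow> arr s \<delta> j \<notin> Pos"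
    using a(2) \<Phi>_cases[OF arr_\<Phi>[OF assms(1,2) j]] not_Pos_both by auto
  then have "arr s \<gamma> j \<in> Pos \<and> key s \<delta> < key s \<gamma> \<or> arr s \<gamma> j \<notin> Pos \<and> key s \<gamma> < key s \<delta>"
    unfolding key_def
    using binary_less[OF j, of "\<lambda>m. arr s \<delta> m \<in> Pos" "\<lambda>m. arr s \<gamma> m \<in> Pos"]
      binary_less[OF j, of "\<lambda>m. arr s \<gamma> m \<in> Pos" "\<lambda>m. arr s \<delta> m \<in> Pos"] a(3) by auto
  then show "key s \<delta> < key s \<gamma> \<longleftrightarrow> arr s \<gamma> j \<in> Pos" "key s \<gamma> < key s \<delta> \<longleftrightarrow> arr s \<gamma> j \<notin> Pos"
    by auto
qed

lemma key_inject:
  assumes "root_expression s" "\<gamma> \<in> Sub s" "\<delta> \<in> Sub s" "target s \<gamma> = target s \<delta>" "key s \<gamma> = key s \<delta>"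
  shows "\<gamma> = \<delta>"
proof (rule ccontr)
  assume "\<gamma> \<noteq> \<delta>"
  from key_less_iff[OF assms(1-4) last_difference_exists[OF assms(2,3) this]] assms(5)
  show False by simp
qed

lemma S_T: "S \<subseteq> T"
  using T_iff S_iff simple_Pos by blast

text \<open>
  At the last difference the two partial products differ by the letter, and by the description of
  descents the arrow of \<open>\<gamma>\<close> is positive exactly if the letter shortens the partial product of \<open>\<gamma>\<close>.
\<close>

lemma sub_less_iff_key:
  assumes "set s \<subseteq> S" "\<gamma> \<in> Sub s" "\<delta> \<in> Sub s" "target s \<gamma> = target s \<delta>"
  shows "sub_less form \<Delta> s \<delta> \<gamma> \<longleftrightarrow> key s \<delta> < key s \<gamma>"
proof (cases "\<gamma> = \<delta>")
  case True
  then show ?thesis by (simp add: sub_less_def)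
next
  case False
  have re: "root_expression s" using assms(1) S_T by (auto simp: root_expression_def)
  define j where "j = Max {i. i < length s \<and> \<delta> ! i \<noteq> \<gamma> ! i}"
  have d: "last_difference s \<gamma> \<delta> j"
    unfolding j_def by (rule last_difference_exists[OF assms(2,3) False])
  then have jl: "j < length s" by (simp add: last_difference_def)
  then obtain \<alpha> where \<alpha>: "\<alpha> \<in> \<Delta>" "s ! j = refl \<alpha>" using assms(1) S_iff nth_mem by blast
  have "arr s \<gamma> j = - before s \<gamma> j \<alpha>"
    using \<alpha> root_of_refl[OF simple_Pos[OF \<alpha>(1)]] before_isometry[OF re assms(2), of j] jl
    by (simp add: arrow_def isometry_simps)
  then have "len form \<Delta> (before s \<delta> j) < len form \<Delta> (before s \<gamma> j) \<longleftrightarrow> arr s \<gamma> j \<in> Pos"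
    using arr_last_difference(1)[OF re assms(2-4) d] \<alpha> descent_iff[OF before_W[OF re assms(2)] \<alpha>(1)] jl
    by simp
  then show ?thesis
    using key_less_iff(1)[OF re assms(2-4) d] False assms(4)
    by (auto simp: sub_less_def Let_def j_def)
qed

text \<open>A pair of positions whose flipping leads to a smaller vertex.\<close>

definition lowering :: "('v \<Rightarrow> 'v) list \<Rightarrow> subexpression \<Rightarrow> nat \<Rightarrow> nat \<Rightarrow> bool" where
  "lowering s \<gamma> i j \<longleftrightarrow> i < j \<and> j < length s \<and> pm_eq (arr s \<gamma> i) (arr s \<gamma> j) \<and> arr s \<gamma> j \<in> Pos"

lemma last_difference_flip2:
  "\<gamma> \<in> Sub s \<Longrightarrow> i < j \<Longrightarrow> j < length s \<Longrightarrow> last_difference s \<gamma> (flip2 i j \<gamma>) j"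
  by (auto simp: last_difference_def nth_flip2 Sub_def)

lemma flip2_ne: "i < j \<Longrightarrow> j < length \<gamma> \<Longrightarrow> flip2 i j \<gamma> \<noteq> \<gamma>"
  by (metis nth_flip2 nat_neq_iff)

lemma key_flip2_less_iff:
  assumes "root_expression s" "\<gamma> \<in> Sub s" "i < j" "j < length s" "pm_eq (arr s \<gamma> i) (arr s \<gamma> j)"
  shows "key s (flip2 i j \<gamma>) < key s \<gamma> \<longleftrightarrow> arr s \<gamma> j \<in> Pos"
  using key_less_iff(1)[OF assms(1,2) _ _ last_difference_flip2[OF assms(2-4)]] assms
    target_flip2_iff[OF assms(1-4)] by simp

lemma lowering_vertex:
  assumes "root_expression s" "\<gamma> \<in> vertices s w" "lowering s \<gamma> i j"
  shows "flip2 i j \<gamma> \<in> vertices s w" "key s (flip2 i j \<gamma>) < key s \<gamma>"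
  using assms target_flip2_iff[OF assms(1), of \<gamma> i j] key_flip2_less_iff[OF assms(1), of \<gamma> i j]
  by (auto simp: vertices_def lowering_def)

end

section \<open>Stars of cycles\<close>

definition star :: "'a \<Rightarrow> 'a set set \<Rightarrow> 'a set set" where
  "star v F = {e \<in> F. v \<in> e}"

lemma star_sym_diff: "star v (sym_diff A B) = sym_diff (star v A) (star v B)"
  by (auto simp: star_def)

lemma star_cycle_through:
  assumes "distinct xs" "3 \<le> length xs" "j < length xs"
  shows "star (xs ! j) (cycle_through xs) =
    {{xs ! j, xs ! (Suc j mod length xs)}, {xs ! j, xs ! ((j + length xs - 1) mod length xs)}}" (is "?L = {?a, ?b}")
    and "{xs ! j, xs ! (Suc j mod length xs)} \<noteq> {xs ! j, xs ! ((j + length xs - 1) mod length xs)}"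
proof -
  let ?n = "length xs"
  have n: "?n > 0" using assms(3) by linarith
  have idx: "xs ! a = xs ! b \<longleftrightarrow> a = b" if "a < ?n" "b < ?n" for a b
    using assms(1) that by (simp add: nth_eq_iff_index_eq)
  have suc: "Suc k mod ?n = (if Suc k = ?n then 0 else Suc k)" if "k < ?n" for k
    using that by auto
  have pre: "(k + ?n - 1) mod ?n = (if k = 0 then ?n - 1 else k - 1)" if "k < ?n" for k
  proof (cases k)
    case (Suc m)
    then have "k + ?n - 1 = m + ?n" by simp
    then show ?thesis using Suc that by simp
  qed (use n in simp)
  show "?L = {?a, ?b}"
  proof (intro equalityI subsetI)
    fix e assume "e \<in> ?L"
    then obtain k where k: "k < ?n" "e = {xs ! k, xs ! (Suc k mod ?n)}" "xs ! j \<in> e"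
      by (auto simp: star_def cycle_through_def)
    then have "j = k \<or> j = Suc k mod ?n" using idx[of j k] idx[of j "Suc k mod ?n"] assms n by auto
    then show "e \<in> {?a, ?b}"
    proof
      assume j: "j = Suc k mod ?n"
      then have "(j + ?n - 1) mod ?n = k" using k(1) suc[OF k(1)] pre[OF assms(3)] by (auto split: if_splits)
      then show ?thesis using k(2) j by (metis insertCI insert_commute)
    qed (use k in auto)
  next
    fix e assume e: "e \<in> {?a, ?b}"
    have "?b \<in> cycle_through xs"
    proof -
      let ?k = "(j + ?n - 1) mod ?n"
      have "?k < ?n" using n by simp
      moreover have "Suc ?k mod ?n = j" using pre[OF assms(3)] assms(3) n by (auto split: if_splits)
      ultimately show ?thesis unfolding cycle_through_def by (smt (verit) insert_commute mem_Collect_eq)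
    qed
    then show "e \<in> ?L" using e assms(3) by (auto simp: star_def cycle_through_def)
  qed
  have "Suc j mod ?n \<noteq> (j + ?n - 1) mod ?n" using suc[OF assms(3)] pre[OF assms(3)] assms by (auto split: if_splits)
  then have "xs ! (Suc j mod ?n) \<noteq> xs ! ((j + ?n - 1) mod ?n)" using idx n by simp
  then show "?a \<noteq> ?b" by (auto simp: doubleton_eq_iff)
qed

lemma even_star_cycle_through:
  assumes "distinct xs" "3 \<le> length xs"
  shows "even (card (star v (cycle_through xs)))"
proof (cases "v \<in> set xs")
  case True
  then obtain j where "j < length xs" "v = xs ! j" by (metis in_set_conv_nth)
  then show ?thesis using star_cycle_through[OF assms] by simp
next
  case False
  have "xs \<noteq> []" using assms by auto
  then have "star v (cycle_through xs) = {}" using False by (auto simp: star_def cycle_through_def)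
  then show ?thesis by simp
qed

lemma finite_cycle_through: "finite (cycle_through xs)"
  by (simp add: cycle_through_def)

lemma finite_star: "finite A \<Longrightarrow> finite (star v A)"
  by (simp add: star_def)

lemma even_card_sym_diff:
  assumes "finite A" "finite B"
  shows "even (card (sym_diff A B)) \<longleftrightarrow> even (card A + card B)"
proof -
  have "card A = card (A - B) + card (A \<inter> B)" "card B = card (B - A) + card (A \<inter> B)"
    using assms by (metis Int_commute card_Int_Diff add.commute)+
  moreover have "card (sym_diff A B) = card (A - B) + card (B - A)"
    by (rule card_Un_disjoint) (use assms in auto)
  ultimately show ?thesis by presburger
qed

lemma hamming_sym: "length a = length b \<Longrightarrow> hamming a b = hamming b a"
  unfolding hamming_def by (metis (full_types))

lemma hamming_self [simp]: "hamming a a = 0"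
  by (simp add: hamming_def)

definition adjacent :: "subexpression \<Rightarrow> subexpression \<Rightarrow> bool" where
  "adjacent a b \<longleftrightarrow> hamming a b = 2"

lemma cycle_through_subset_edges:
  assumes "set xs \<subseteq> vertices s w" "successively adjacent (xs @ [hd xs])"
  shows "cycle_through xs \<subseteq> edges s w"
proof
  fix e assume "e \<in> cycle_through xs"
  then obtain k where k: "k < length xs" "e = {xs ! k, xs ! (Suc k mod length xs)}"
    by (auto simp: cycle_through_def)
  have "adjacent ((xs @ [hd xs]) ! k) ((xs @ [hd xs]) ! Suc k)"
    using assms(2) k(1) unfolding successively_conv_nth by simp
  moreover have "(xs @ [hd xs]) ! k = xs ! k" using k by (simp add: nth_append)
  moreover have "(xs @ [hd xs]) ! Suc k = xs ! (Suc k mod length xs)"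
  proof (cases "Suc k = length xs")
    case True
    then have "xs \<noteq> []" by auto
    then show ?thesis using True by (simp add: nth_append hd_conv_nth)
  next
    case False
    then show ?thesis using k by (simp add: nth_append)
  qed
  moreover have "Suc k mod length xs < length xs" by (rule mod_less_divisor) (use k(1) in linarith)
  ultimately show "e \<in> edges s w"
    using assms(1) k unfolding edges_def adjacent_def by (smt (verit) mem_Collect_eq nth_mem subsetD)
qed

lemma finite_vertices: "finite (vertices s w)"
proof -
  have "vertices s w \<subseteq> {\<gamma>. set \<gamma> \<subseteq> UNIV \<and> length \<gamma> = length s}"
    by (auto simp: vertices_def Sub_def)
  then show ?thesis using finite_lists_length_eq[of "UNIV :: bool set"] by (meson finite finite_subset)
qed

lemma edges_subset: "e \<in> edges s w \<Longrightarrow> e \<subseteq> vertices s w \<and> e \<noteq> {}"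
  by (auto simp: edges_def)

lemma finite_edges: "finite (edges s w)"
proof -
  have "edges s w \<subseteq> Pow (vertices s w)" using edges_subset by blast
  then show ?thesis using finite_vertices finite_subset by blast
qed

context based_root_system
begin

section \<open>Generating even subgraphs vertex by vertex\<close>

text \<open>
  The list \<open>xs\<close> records that no vertex is passed twice, which makes all degrees even. Bounding keys
  expresses support below a given vertex.
\<close>

definition elementary ::
    "('v \<Rightarrow> 'v) list \<Rightarrow> ('v \<Rightarrow> 'v) \<Rightarrow> nat \<Rightarrow> subexpression set set \<Rightarrow> bool" where
  "elementary s w N C \<longleftrightarrow>
     C \<in> Cyc form \<Delta> s w \<union> Tr1 form \<Delta> s w \<union> Tr2 form \<Delta> s w \<union> Tr3 form \<Delta> s w
       \<union> Sq1 form \<Delta> s w \<union> Sq2 form \<Delta> s w \<and>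
     C \<subseteq> edges s w \<and> (\<forall>e\<in>C. \<forall>\<delta>\<in>e. key s \<delta> \<le> N) \<and>
     (\<exists>xs. distinct xs \<and> 3 \<le> length xs \<and> C = cycle_through xs)"

inductive_set cycle_sums :: "('v \<Rightarrow> 'v) list \<Rightarrow> ('v \<Rightarrow> 'v) \<Rightarrow> nat \<Rightarrow> subexpression set set set"
  for s w N where
  empty: "{} \<in> cycle_sums s w N"
| add: "elementary s w N C \<Longrightarrow> A \<in> cycle_sums s w N \<Longrightarrow> sym_diff C A \<in> cycle_sums s w N"

lemma cycle_sums_elementary: "elementary s w N C \<Longrightarrow> C \<in> cycle_sums s w N"
  using cycle_sums.add[OF _ cycle_sums.empty] by fastforce

lemma cycle_sums_sym_diff:
  assumes "A \<in> cycle_sums s w N" "B \<in> cycle_sums s w N"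
  shows "sym_diff A B \<in> cycle_sums s w N"
  using assms
proof (induction A rule: cycle_sums.induct)
  case (add C A)
  have "sym_diff (sym_diff C A) B = sym_diff C (sym_diff A B)" by blast
  then show ?case using add cycle_sums.add[of s w N C "sym_diff A B"] by simp
qed simp

lemma cycle_sums_mono:
  assumes "A \<in> cycle_sums s w N" "N \<le> M"
  shows "A \<in> cycle_sums s w M"
  using assms(1)
proof (induction A rule: cycle_sums.induct)
  case (add C A)
  have "elementary s w M C"
    using add(1) assms(2) unfolding elementary_def by (blast intro: order_trans)
  then show ?case using add cycle_sums.add by simp
qed (simp add: cycle_sums.empty)

lemma cycle_sums_edges:
  assumes "A \<in> cycle_sums s w N"
  shows "A \<subseteq> edges s w" "\<forall>e\<in>A. \<forall>\<delta>\<in>e. key s \<delta> \<le> N" "even (card (star v A))"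
proof -
  have "A \<subseteq> edges s w \<and> (\<forall>e\<in>A. \<forall>\<delta>\<in>e. key s \<delta> \<le> N) \<and> even (card (star v A))"
    using assms
  proof (induction A rule: cycle_sums.induct)
    case empty
    then show ?case by (simp add: star_def)
  next
    case (add C A)
    have C: "C \<subseteq> edges s w" "\<forall>e\<in>C. \<forall>\<delta>\<in>e. key s \<delta> \<le> N" "even (card (star v C))" "finite C"
      using add(1) even_star_cycle_through finite_cycle_through by (auto simp: elementary_def)
    have "finite A" using add finite_edges finite_subset by blast
    then have "even (card (star v (sym_diff C A)))"
      unfolding star_sym_diff using C add by (subst even_card_sym_diff) (auto simp: finite_star)
    then show ?case using C add by auto
  qed
  then show "A \<subseteq> edges s w" "\<forall>e\<in>A. \<forall>\<delta>\<in>e. key s \<delta> \<le> N" "even (card (star v A))" by auto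
qed

lemma cycle_sums_list:
  assumes "A \<in> cycle_sums s w N"
  shows "\<exists>Cs. (\<forall>C\<in>set Cs. elementary s w N C) \<and> A = foldr sym_diff Cs {}"
  using assms
proof (induction A rule: cycle_sums.induct)
  case empty
  show ?case by (rule exI[of _ "[]"]) simp
next
  case (add C A)
  then obtain Cs where "\<forall>C\<in>set Cs. elementary s w N C" "A = foldr sym_diff Cs {}" by blast
  then show ?case using add by (intro exI[of _ "C # Cs"]) simp
qed

text \<open>
  Two edges at \<open>\<gamma>\<close> are linked if a sum of admissible cycles below \<open>\<gamma>\<close> has exactly these two edges
  at \<open>\<gamma>\<close>. This is an equivalence relation, and it is all that is needed to remove \<open>\<gamma>\<close> from
  an even subgraph in which it is the largest vertex.
\<close>

definition linked ::
    "('v \<Rightarrow> 'v) list \<Rightarrow> ('v \<Rightarrow> 'v) \<Rightarrow> subexpression \<Rightarrow> subexpression set \<Rightarrow> subexpression set \<Rightarrow> bool" where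
  "linked s w \<gamma> e e' \<longleftrightarrow> (\<exists>A\<in>cycle_sums s w (key s \<gamma>). (\<forall>x. x \<in> star \<gamma> A \<longleftrightarrow> (x = e) \<noteq> (x = e')))"

lemma linkedI:
  "A \<in> cycle_sums s w (key s \<gamma>) \<Longrightarrow> (\<And>x. x \<in> star \<gamma> A \<longleftrightarrow> (x = e) \<noteq> (x = e')) \<Longrightarrow> linked s w \<gamma> e e'"
  unfolding linked_def by (rule bexI[of _ A]) simp_all

lemma linkedE:
  assumes "linked s w \<gamma> e e'"
  obtains A where "A \<in> cycle_sums s w (key s \<gamma>)" "\<And>x. x \<in> star \<gamma> A \<longleftrightarrow> (x = e) \<noteq> (x = e')"
  using assms unfolding linked_def by (elim bexE) simp

lemma linked_refl: "linked s w \<gamma> e e"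
  by (rule linkedI[OF cycle_sums.empty]) (simp add: star_def)

lemma linked_sym: "linked s w \<gamma> e e' \<Longrightarrow> linked s w \<gamma> e' e"
  by (elim linkedE, rule linkedI) auto

lemma linked_trans:
  assumes "linked s w \<gamma> e e'" "linked s w \<gamma> e' e''" shows "linked s w \<gamma> e e''"
proof -
  obtain A where A: "A \<in> cycle_sums s w (key s \<gamma>)" "\<And>x. x \<in> star \<gamma> A \<longleftrightarrow> (x = e) \<noteq> (x = e')"
    using linkedE[OF assms(1)] by metis
  obtain B where B: "B \<in> cycle_sums s w (key s \<gamma>)" "\<And>x. x \<in> star \<gamma> B \<longleftrightarrow> (x = e') \<noteq> (x = e'')"
    using linkedE[OF assms(2)] by metis
  show ?thesis
  proof (rule linkedI[OF cycle_sums_sym_diff[OF A(1) B(1)]])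
    show "x \<in> star \<gamma> (sym_diff A B) \<longleftrightarrow> (x = e) \<noteq> (x = e'')" for x
      unfolding star_sym_diff Un_iff Diff_iff A(2) B(2) by argo
  qed
qed

text \<open>
  A cycle without repeated vertices has exactly two edges at \<open>\<gamma>\<close>.
\<close>

lemma linked_cycle:
  assumes "distinct (\<gamma> # xs)" "2 \<le> length xs" "set (\<gamma> # xs) \<subseteq> vertices s w"
    and "successively adjacent (\<gamma> # xs @ [\<gamma>])" "\<And>\<delta>. \<delta> \<in> set xs \<Longrightarrow> key s \<delta> \<le> key s \<gamma>"
    and "cycle_through (\<gamma> # xs) \<in> Cyc form \<Delta> s w \<union> Tr1 form \<Delta> s w \<union> Tr2 form \<Delta> s w \<union> Tr3 form \<Delta> s w
       \<union> Sq1 form \<Delta> s w \<union> Sq2 form \<Delta> s w"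
  shows "linked s w \<gamma> {\<gamma>, hd xs} {\<gamma>, last xs}"
proof -
  let ?C = "cycle_through (\<gamma> # xs)"
  have sub: "?C \<subseteq> edges s w" by (rule cycle_through_subset_edges) (use assms in auto)
  have "e \<subseteq> set (\<gamma> # xs)" if "e \<in> ?C" for e
  proof -
    obtain k where k: "k < length (\<gamma> # xs)" "e = {(\<gamma> # xs) ! k, (\<gamma> # xs) ! (Suc k mod length (\<gamma> # xs))}"
      using \<open>e \<in> ?C\<close> by (auto simp: cycle_through_def)
    moreover have "Suc k mod length (\<gamma> # xs) < length (\<gamma> # xs)" by simp
    ultimately show ?thesis using nth_mem by (metis bot_least insert_subset)
  qed
  then have keys: "\<forall>e\<in>?C. \<forall>\<delta>\<in>e. key s \<delta> \<le> key s \<gamma>" using assms(5) by fastforce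
  have el: "elementary s w (key s \<gamma>) ?C"
    unfolding elementary_def using sub keys assms(1,2,6)
    by (intro conjI exI[of _ "\<gamma> # xs"]) auto
  have n: "xs \<noteq> []" using assms(2) by auto
  have st: "star \<gamma> ?C = {{\<gamma>, hd xs}, {\<gamma>, last xs}}" "{\<gamma>, hd xs} \<noteq> {\<gamma>, last xs}"
    using star_cycle_through[of "\<gamma> # xs" 0] assms(1,2) n
    by (auto simp: hd_conv_nth last_conv_nth nth_Cons')
  then show ?thesis by (intro linkedI[OF cycle_sums_elementary[OF el]]) auto
qed

lemma edge_at_vertex:
  assumes "e \<in> edges s w" "\<gamma> \<in> e"
  obtains i j where "i < j" "j < length s" "e = {\<gamma>, flip2 i j \<gamma>}"
    "\<gamma> \<in> vertices s w" "flip2 i j \<gamma> \<in> vertices s w"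
proof -
  obtain a b where ab: "e = {a, b}" "a \<in> vertices s w" "b \<in> vertices s w" "hamming a b = 2"
    using assms(1) by (auto simp: edges_def)
  have "length a = length b" using ab by (simp add: vertices_def Sub_def)
  then have "\<exists>\<delta>. e = {\<gamma>, \<delta>} \<and> \<gamma> \<in> vertices s w \<and> \<delta> \<in> vertices s w \<and> hamming \<gamma> \<delta> = 2"
    using ab assms(2) hamming_sym by (metis insertE insert_commute singletonD)
  then obtain \<delta> where d: "e = {\<gamma>, \<delta>}" "\<gamma> \<in> vertices s w" "\<delta> \<in> vertices s w" "hamming \<gamma> \<delta> = 2" by blast
  obtain i j where "i < j" "j < length \<gamma>" "\<delta> = flip2 i j \<gamma>"
    using hamming_2E[of \<delta> \<gamma>] d by (auto simp: vertices_def Sub_def)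
  then show ?thesis using that d by (auto simp: vertices_def Sub_def)
qed

text \<open>
  Keys distinguish the vertices, so at most one of them has key \<open>N\<close>. Its edges in \<open>F\<close> lead to smaller
  vertices, and they are removed two at a time by adding a sum that links them; this keeps \<open>F\<close> even
  and bounded by \<open>N\<close>.
\<close>

theorem even_subgraph_in_cycle_sums:
  assumes re: "root_expression s"
    and linked: "\<And>\<gamma> i j k l. \<gamma> \<in> vertices s w \<Longrightarrow> lowering s \<gamma> i j \<Longrightarrow> lowering s \<gamma> k l \<Longrightarrow>
      linked s w \<gamma> {\<gamma>, flip2 i j \<gamma>} {\<gamma>, flip2 k l \<gamma>}"
    and "F \<subseteq> edges s w" "\<And>v. v \<in> vertices s w \<Longrightarrow> even (card (star v F))"
    and "\<forall>e\<in>F. \<forall>\<delta>\<in>e. key s \<delta> \<le> N"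
  shows "F \<in> cycle_sums s w N"
  using assms(3-5)
proof (induction N arbitrary: F rule: less_induct)
  case (less N)
  have fin: "finite F" if "F \<subseteq> edges s w" for F using that finite_edges finite_subset by blast
  have no_top: "F \<in> cycle_sums s w N"
    if F: "F \<subseteq> edges s w" "\<And>v. v \<in> vertices s w \<Longrightarrow> even (card (star v F))"
      "\<forall>e\<in>F. \<forall>\<delta>\<in>e. key s \<delta> < N" for F
  proof (cases N)
    case 0
    then have "F = {}" using F edges_subset by (metis all_not_in_conv not_less0 subsetD)
    then show ?thesis by (simp add: cycle_sums.empty)
  next
    case (Suc M)
    then have "F \<in> cycle_sums s w M" using less.IH[of M F] F by (auto simp: less_Suc_eq_le)
    then show ?thesis using Suc by (auto intro: cycle_sums_mono)
  qed
  show ?case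
  proof (cases "\<exists>\<gamma>\<in>vertices s w. key s \<gamma> = N")
    case False
    have "\<forall>e\<in>F. \<forall>\<delta>\<in>e. key s \<delta> < N"
      using less.prems(1,3) edges_subset False by (metis le_neq_implies_less subsetD)
    then show ?thesis by (intro no_top less.prems(1,2))
  next
    case True
    then obtain \<gamma> where \<gamma>: "\<gamma> \<in> vertices s w" "key s \<gamma> = N" by blast
    show ?thesis using less.prems
    proof (induction "card (star \<gamma> F)" arbitrary: F rule: less_induct)
      case (less F)
      have finF: "finite (star \<gamma> F)" by (intro finite_star fin less.prems(1))
      show ?case
      proof (cases "star \<gamma> F = {}")
        case True
        have "key s \<delta> < N" if "e \<in> F" "\<delta> \<in> e" for e \<delta>
        proof -
          have "e \<subseteq> vertices s w" using that(1) less.prems(1) edges_subset[of e s w] by auto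
          then have d: "\<delta> \<in> vertices s w" "\<delta> \<noteq> \<gamma>" using that True by (auto simp: star_def)
          have "key s \<delta> \<noteq> key s \<gamma>"
            using key_inject[OF re, of \<delta> \<gamma>] d \<gamma> by (auto simp: vertices_def)
          then show ?thesis using less.prems(3) that \<gamma>(2) by fastforce
        qed
        then have "\<forall>e\<in>F. \<forall>\<delta>\<in>e. key s \<delta> < N" by simp
        then show ?thesis by (intro no_top less.prems(1,2))
      next
        case False
        have "card (star \<gamma> F) \<noteq> 1" using less.prems(2)[OF \<gamma>(1)] by auto
        then obtain e e' where ee: "e \<in> star \<gamma> F" "e' \<in> star \<gamma> F" "e \<noteq> e'"
          using False finF by (metis One_nat_def all_not_in_conv card_1_singleton_iff is_singletonI' is_singleton_def)
        have low: "\<exists>i j. e = {\<gamma>, flip2 i j \<gamma>} \<and> lowering s \<gamma> i j" if "e \<in> star \<gamma> F" for e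
        proof -
          have e: "e \<in> edges s w" "\<gamma> \<in> e" using that less.prems(1) by (auto simp: star_def)
          obtain i j where ij: "i < j" "j < length s" "e = {\<gamma>, flip2 i j \<gamma>}"
            "\<gamma> \<in> vertices s w" "flip2 i j \<gamma> \<in> vertices s w" using edge_at_vertex[OF e] by blast
          have g: "\<gamma> \<in> Sub s" "target s \<gamma> = w" "target s (flip2 i j \<gamma>) = w" using ij by (auto simp: vertices_def)
          then have pm: "pm_eq (arr s \<gamma> i) (arr s \<gamma> j)" using target_flip2_iff[OF re g(1) ij(1,2)] by simp
          have "flip2 i j \<gamma> \<noteq> \<gamma>" using ij g flip2_ne by (simp add: Sub_def)
          then have "key s (flip2 i j \<gamma>) \<noteq> key s \<gamma>" using key_inject[OF re, of "flip2 i j \<gamma>" \<gamma>] g by auto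
          moreover have "key s (flip2 i j \<gamma>) \<le> N" using less.prems(3) that ij by (auto simp: star_def)
          ultimately have "key s (flip2 i j \<gamma>) < key s \<gamma>" using \<gamma> by simp
          then have "arr s \<gamma> j \<in> Pos" using key_flip2_less_iff[OF re g(1) ij(1,2) pm] by simp
          then show ?thesis using ij pm by (auto simp: lowering_def)
        qed
        have "linked s w \<gamma> e e'" using low[OF ee(1)] low[OF ee(2)] linked[OF \<gamma>(1)] by blast
        then obtain A where A: "A \<in> cycle_sums s w N" "\<And>x. x \<in> star \<gamma> A \<longleftrightarrow> (x = e) \<noteq> (x = e')"
          using linkedE[OF \<open>linked s w \<gamma> e e'\<close>] unfolding \<gamma>(2) by metis
        note A' = cycle_sums_edges[OF A(1)]
        let ?F = "sym_diff F A"
        have "star \<gamma> ?F = star \<gamma> F - {e, e'}"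
        proof (rule Set.set_eqI)
          fix x
          have "x \<in> star \<gamma> ?F \<longleftrightarrow> (x \<in> star \<gamma> F) \<noteq> (x \<in> star \<gamma> A)"
            unfolding star_sym_diff Un_iff Diff_iff by argo
          then show "x \<in> star \<gamma> ?F \<longleftrightarrow> x \<in> star \<gamma> F - {e, e'}"
            using A(2)[of x] ee by auto
        qed
        also have "\<dots> \<subset> star \<gamma> F" using ee(1) by auto
        finally have "card (star \<gamma> ?F) < card (star \<gamma> F)" by (rule psubset_card_mono[OF finF])
        moreover have "?F \<subseteq> edges s w" using less.prems(1) A'(1) by auto
        moreover have "even (card (star v ?F))" if "v \<in> vertices s w" for v
        proof -
          have f: "finite (star v F)" "finite (star v A)"
            by (intro finite_star fin less.prems(1) A'(1))+
          show ?thesis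
            unfolding star_sym_diff even_card_sym_diff[OF f] using less.prems(2)[OF that] A'(3)[of v] by simp
        qed
        moreover have "\<forall>e\<in>?F. \<forall>\<delta>\<in>e. key s \<delta> \<le> N" using less.prems(3) A'(2) by auto
        ultimately have "?F \<in> cycle_sums s w N" by (intro less.hyps)
        then have "sym_diff ?F A \<in> cycle_sums s w N" by (rule cycle_sums_sym_diff) (rule A(1))
        moreover have "sym_diff ?F A = F" by auto
        ultimately show ?thesis by simp
      qed
    qed
  qed
qed

section \<open>Links through triangles and squares\<close>

lemma flip2_flip2_first: "i \<noteq> j \<Longrightarrow> i \<noteq> k \<Longrightarrow> j \<noteq> k \<Longrightarrow> flip2 j k (flip2 i j \<gamma>) = flip2 i k \<gamma>"
  by (rule nth_equalityI) (auto simp: nth_flip2)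

lemma adjacent_flip2: "i < j \<Longrightarrow> j < length \<gamma> \<Longrightarrow> adjacent \<gamma> (flip2 i j \<gamma>)"
  by (simp add: adjacent_def hamming_flip2)

lemma adjacent_flip2': "i < j \<Longrightarrow> j < length \<gamma> \<Longrightarrow> adjacent (flip2 i j \<gamma>) \<gamma>"
  using adjacent_flip2[of i j "flip2 i j \<gamma>"] by simp

lemma adjacent_ne: "adjacent a b \<Longrightarrow> a \<noteq> b"
  by (auto simp: adjacent_def)

lemma vertices_length: "\<gamma> \<in> vertices s w \<Longrightarrow> length \<gamma> = length s"
  by (simp add: vertices_def Sub_def)

lemma linked_Tr1:
  assumes re: "root_expression s" and g: "\<gamma> \<in> vertices s w"
    and low: "lowering s \<gamma> i j" "lowering s \<gamma> i k" "j < k" and eq: "arr s \<gamma> j = arr s \<gamma> k"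
  shows "linked s w \<gamma> {\<gamma>, flip2 i j \<gamma>} {\<gamma>, flip2 i k \<gamma>}"
proof -
  have ij: "i < j" "j < k" "k < length \<gamma>" using low vertices_length[OF g] by (auto simp: lowering_def)
  note v = lowering_vertex[OF re g low(1)] lowering_vertex[OF re g low(2)]
  have adj: "adjacent (flip2 i j \<gamma>) (flip2 i k \<gamma>)"
    using adjacent_flip2[of j k "flip2 i j \<gamma>"] ij by (simp add: flip2_flip2_first)
  have "linked s w \<gamma> {\<gamma>, hd [flip2 i j \<gamma>, flip2 i k \<gamma>]} {\<gamma>, last [flip2 i j \<gamma>, flip2 i k \<gamma>]}"
  proof (rule linked_cycle)
    show "successively adjacent (\<gamma> # [flip2 i j \<gamma>, flip2 i k \<gamma>] @ [\<gamma>])"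
      using adj adjacent_flip2[of i j \<gamma>] adjacent_flip2'[of i k \<gamma>] ij by simp
    show "distinct (\<gamma> # [flip2 i j \<gamma>, flip2 i k \<gamma>])"
      using adjacent_ne[OF adj] v by auto
    have "cycle_through [\<gamma>, flip2 i j \<gamma>, flip2 i k \<gamma>] \<in> Tr1 form \<Delta> s w"
      unfolding Tr1_def
      by (rule CollectI, rule exI[of _ \<gamma>], rule exI[of _ i], rule exI[of _ j], rule exI[of _ k])
        (use g low eq in \<open>simp add: lowering_def\<close>)
    then show "cycle_through (\<gamma> # [flip2 i j \<gamma>, flip2 i k \<gamma>]) \<in> Cyc form \<Delta> s w \<union> Tr1 form \<Delta> s w \<union> Tr2 form \<Delta> s w \<union> Tr3 form \<Delta> s w
       \<union> Sq1 form \<Delta> s w \<union> Sq2 form \<Delta> s w" by simp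
  qed (use g v in auto)
  then show ?thesis by simp
qed

lemma linked_Tr2:
  assumes re: "root_expression s" and g: "\<gamma> \<in> vertices s w"
    and low: "lowering s \<gamma> j k" "lowering s \<gamma> i k" "i < j"
  shows "linked s w \<gamma> {\<gamma>, flip2 j k \<gamma>} {\<gamma>, flip2 i k \<gamma>}"
proof -
  have ij: "i < j" "j < k" "k < length \<gamma>" using low vertices_length[OF g] by (auto simp: lowering_def)
  note v = lowering_vertex[OF re g low(1)] lowering_vertex[OF re g low(2)]
  have "flip2 i j (flip2 j k \<gamma>) = flip2 i k \<gamma>"
    using ij flip2_flip2_first[of k j i \<gamma>] by (simp add: flip2_commute)
  then have adj: "adjacent (flip2 j k \<gamma>) (flip2 i k \<gamma>)"
    using adjacent_flip2[of i j "flip2 j k \<gamma>"] ij by simp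
  have "linked s w \<gamma> {\<gamma>, hd [flip2 j k \<gamma>, flip2 i k \<gamma>]} {\<gamma>, last [flip2 j k \<gamma>, flip2 i k \<gamma>]}"
  proof (rule linked_cycle)
    show "successively adjacent (\<gamma> # [flip2 j k \<gamma>, flip2 i k \<gamma>] @ [\<gamma>])"
      using adj adjacent_flip2[of j k \<gamma>] adjacent_flip2'[of i k \<gamma>] ij by simp
    show "distinct (\<gamma> # [flip2 j k \<gamma>, flip2 i k \<gamma>])"
      using adjacent_ne[OF adj] v by auto
    have "cycle_through [\<gamma>, flip2 j k \<gamma>, flip2 i k \<gamma>] \<in> Tr2 form \<Delta> s w"
      unfolding Tr2_def
      by (rule CollectI, rule exI[of _ \<gamma>], rule exI[of _ i], rule exI[of _ j], rule exI[of _ k])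
        (use g low in \<open>simp add: lowering_def\<close>)
    then show "cycle_through (\<gamma> # [flip2 j k \<gamma>, flip2 i k \<gamma>]) \<in> Cyc form \<Delta> s w \<union> Tr1 form \<Delta> s w \<union> Tr2 form \<Delta> s w \<union> Tr3 form \<Delta> s w
       \<union> Sq1 form \<Delta> s w \<union> Sq2 form \<Delta> s w" by simp
  qed (use g v in auto)
  then show ?thesis by simp
qed

text \<open>
  If \<open>j < l\<close>, then \<open>(i, l)\<close> is lowering too. It has its first position in common with \<open>(i, j)\<close> and its
  last one with \<open>(k, l)\<close>, so that one triangle of each of the first two types links it to both.
\<close>

lemma linked_same_root:
  assumes re: "root_expression s" and g: "\<gamma> \<in> vertices s w"
    and low: "lowering s \<gamma> i j" "lowering s \<gamma> k l" and eq: "arr s \<gamma> j = arr s \<gamma> l"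
  shows "linked s w \<gamma> {\<gamma>, flip2 i j \<gamma>} {\<gamma>, flip2 k l \<gamma>}"
proof -
  have same_end: "linked s w \<gamma> {\<gamma>, flip2 i j \<gamma>} {\<gamma>, flip2 k j \<gamma>}"
    if "lowering s \<gamma> i j" "lowering s \<gamma> k j" for i j k
    using linked_Tr2[OF re g that] linked_Tr2[OF re g that(2,1)] linked_refl linked_sym
    by (metis linorder_neqE_nat)
  have main: "linked s w \<gamma> {\<gamma>, flip2 i j \<gamma>} {\<gamma>, flip2 k l \<gamma>}"
    if low: "lowering s \<gamma> i j" "lowering s \<gamma> k l" and eq: "arr s \<gamma> j = arr s \<gamma> l" and "j < l" for i j k l
  proof -
    have il: "lowering s \<gamma> i l" using low eq \<open>j < l\<close> by (auto simp: lowering_def)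
    then show ?thesis
      using linked_Tr1[OF re g low(1) il \<open>j < l\<close> eq] same_end[OF il low(2)] linked_trans by blast
  qed
  consider "j < l" | "j = l" | "l < j" by linarith
  then show ?thesis
    using main[OF low eq] main[OF low(2,1) eq[symmetric]] same_end low linked_sym by cases auto
qed

lemma lowering_flip2:
  assumes "root_expression s" "\<gamma> \<in> vertices s w" "lowering s \<gamma> k l" "lowering s \<gamma> i j"
    and "i \<le> k \<or> l < i" "j \<le> k \<or> l < j"
  shows "lowering s (flip2 k l \<gamma>) i j"
proof -
  have kl: "\<gamma> \<in> Sub s" "k < l" "l < length s" "pm_eq (arr s \<gamma> k) (arr s \<gamma> l)"
    using assms by (auto simp: lowering_def vertices_def)
  have "i < length s" "j < length s" using assms by (auto simp: lowering_def)
  then have "arr s (flip2 k l \<gamma>) i = arr s \<gamma> i" "arr s (flip2 k l \<gamma>) j = arr s \<gamma> j"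
    using arr_flip2[OF assms(1) kl(1-3) _ kl(4)] assms(5,6) by auto
  then show ?thesis using assms(4) by (simp add: lowering_def)
qed

lemma flip2_flip2_commute: "flip2 i j (flip2 k l \<gamma>) = flip2 k l (flip2 i j \<gamma>)"
  unfolding flip2_def by (metis flip_commute)

lemma linked_square:
  assumes re: "root_expression s" and g: "\<gamma> \<in> vertices s w"
    and low: "lowering s \<gamma> i j" "lowering s \<gamma> k l" and disj: "{i, j} \<inter> {k, l} = {}"
    and low2: "lowering s (flip2 k l \<gamma>) i j"
    and sq: "cycle_through [\<gamma>, flip2 i j \<gamma>, flip2 i j (flip2 k l \<gamma>), flip2 k l \<gamma>] \<in> Sq1 form \<Delta> s w \<union> Sq2 form \<Delta> s w \<or>
      cycle_through [\<gamma>, flip2 k l \<gamma>, flip2 i j (flip2 k l \<gamma>), flip2 i j \<gamma>] \<in> Sq1 form \<Delta> s w \<union> Sq2 form \<Delta> s w"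
  shows "linked s w \<gamma> {\<gamma>, flip2 i j \<gamma>} {\<gamma>, flip2 k l \<gamma>}"
proof -
  have len: "i < j" "j < length \<gamma>" "k < l" "l < length \<gamma>"
    unfolding vertices_length[OF g] using low by (simp_all add: lowering_def)
  note v = lowering_vertex[OF re g low(1)] lowering_vertex[OF re g low(2)]
  note v2 = lowering_vertex[OF re v(3) low2]
  let ?a = "flip2 i j \<gamma>" and ?b = "flip2 k l \<gamma>" and ?c = "flip2 i j (flip2 k l \<gamma>)"
  have c: "?c = flip2 k l ?a" by (rule flip2_flip2_commute)
  have "adjacent ?a (flip2 k l ?a)" "adjacent (flip2 k l ?a) ?a"
    using len by (auto intro: adjacent_flip2 adjacent_flip2')
  then have adj1: "adjacent ?a ?c" "adjacent ?c ?a" unfolding c .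
  have adj2: "adjacent \<gamma> ?a" "adjacent ?a \<gamma>" "adjacent \<gamma> ?b" "adjacent ?b \<gamma>"
    "adjacent ?b ?c" "adjacent ?c ?b"
    using len by (auto intro: adjacent_flip2 adjacent_flip2')
  note adj = adj1 adj2
  have "?a ! j \<noteq> ?b ! j" using len disj by (auto simp: nth_flip2)
  then have ab: "?a \<noteq> ?b" by auto
  have dist: "distinct [\<gamma>, ?a, ?c, ?b]" using ab adj[THEN adjacent_ne] v v2 by auto
  have dist2: "distinct [\<gamma>, ?b, ?c, ?a]" using ab adj[THEN adjacent_ne] v v2 by auto
  have mem: "x \<in> vertices s w" "key s x \<le> key s \<gamma>" if "x \<in> {?a, ?b, ?c}" for x
    using that v v2 by auto
  from sq show ?thesis
  proof
    assume C: "cycle_through [\<gamma>, ?a, ?c, ?b] \<in> Sq1 form \<Delta> s w \<union> Sq2 form \<Delta> s w"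
    have "linked s w \<gamma> {\<gamma>, hd [?a, ?c, ?b]} {\<gamma>, last [?a, ?c, ?b]}"
    proof (rule linked_cycle)
      show "distinct (\<gamma> # [?a, ?c, ?b])" by (rule dist)
      show "successively adjacent (\<gamma> # [?a, ?c, ?b] @ [\<gamma>])" using adj by simp
      show "set (\<gamma> # [?a, ?c, ?b]) \<subseteq> vertices s w" using g mem(1) by simp
      show "key s \<delta> \<le> key s \<gamma>" if "\<delta> \<in> set [?a, ?c, ?b]" for \<delta> using that by (intro mem(2)) auto
    qed (use C in auto)
    then show ?thesis by simp
  next
    assume C: "cycle_through [\<gamma>, ?b, ?c, ?a] \<in> Sq1 form \<Delta> s w \<union> Sq2 form \<Delta> s w"
    have "linked s w \<gamma> {\<gamma>, hd [?b, ?c, ?a]} {\<gamma>, last [?b, ?c, ?a]}"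
    proof (rule linked_cycle)
      show "distinct (\<gamma> # [?b, ?c, ?a])" by (rule dist2)
      show "successively adjacent (\<gamma> # [?b, ?c, ?a] @ [\<gamma>])" using adj by simp
      show "set (\<gamma> # [?b, ?c, ?a]) \<subseteq> vertices s w" using g mem(1) by simp
      show "key s \<delta> \<le> key s \<gamma>" if "\<delta> \<in> set [?b, ?c, ?a]" for \<delta> using that by (intro mem(2)) auto
    qed (use C in auto)
    then show ?thesis using linked_sym by simp
  qed
qed

text \<open>
  Flipping the later pair leaves the arrows at the earlier one unchanged.
\<close>

lemma linked_disjoint:
  assumes re: "root_expression s" and g: "\<gamma> \<in> vertices s w"
    and low: "lowering s \<gamma> i j" "lowering s \<gamma> k l" and jk: "j < k"
  shows "linked s w \<gamma> {\<gamma>, flip2 i j \<gamma>} {\<gamma>, flip2 k l \<gamma>}"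
proof (rule linked_square[OF re g low])
  have len: "i < j" "k < l" "l < length s" using low by (auto simp: lowering_def)
  show "{i, j} \<inter> {k, l} = {}" using len jk by auto
  show "lowering s (flip2 k l \<gamma>) i j"
    by (rule lowering_flip2[OF re g low(2,1)]) (use len jk in auto)
  have "cycle_through [\<gamma>, flip2 i j \<gamma>, flip2 i j (flip2 k l \<gamma>), flip2 k l \<gamma>] \<in> Sq1 form \<Delta> s w"
    unfolding Sq1_def
    by (rule CollectI, rule exI[of _ \<gamma>], rule exI[of _ i], rule exI[of _ j], rule exI[of _ k], rule exI[of _ l])
      (use g low jk in \<open>simp add: lowering_def\<close>)
  then show "cycle_through [\<gamma>, flip2 i j \<gamma>, flip2 i j (flip2 k l \<gamma>), flip2 k l \<gamma>] \<in> Sq1 form \<Delta> s w \<union> Sq2 form \<Delta> s w \<or>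
      cycle_through [\<gamma>, flip2 k l \<gamma>, flip2 i j (flip2 k l \<gamma>), flip2 i j \<gamma>] \<in> Sq1 form \<Delta> s w \<union> Sq2 form \<Delta> s w" by simp
qed

text \<open>
  The two reflections of the inner pair cancel at the outer positions, so flipping the inner pair
  leaves the outer arrows unchanged.
\<close>

lemma linked_nested:
  assumes re: "root_expression s" and g: "\<gamma> \<in> vertices s w"
    and low: "lowering s \<gamma> i l" "lowering s \<gamma> j k" and ij: "i < j" "k < l"
  shows "linked s w \<gamma> {\<gamma>, flip2 i l \<gamma>} {\<gamma>, flip2 j k \<gamma>}"
proof (rule linked_square[OF re g low])
  have len: "j < k" "l < length s" using low by (auto simp: lowering_def)
  show "{i, l} \<inter> {j, k} = {}" using len ij by auto
  show "lowering s (flip2 j k \<gamma>) i l"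
    by (rule lowering_flip2[OF re g low(2,1)]) (use len ij in auto)
  have "cycle_through [\<gamma>, flip2 j k \<gamma>, flip2 i l (flip2 j k \<gamma>), flip2 i l \<gamma>] \<in> Sq2 form \<Delta> s w"
    unfolding Sq2_def
    by (rule CollectI, rule exI[of _ \<gamma>], rule exI[of _ i], rule exI[of _ j], rule exI[of _ k], rule exI[of _ l])
      (use g low ij in \<open>simp add: lowering_def\<close>)
  then show "cycle_through [\<gamma>, flip2 i l \<gamma>, flip2 i l (flip2 j k \<gamma>), flip2 j k \<gamma>] \<in> Sq1 form \<Delta> s w \<union> Sq2 form \<Delta> s w \<or>
      cycle_through [\<gamma>, flip2 j k \<gamma>, flip2 i l (flip2 j k \<gamma>), flip2 i l \<gamma>] \<in> Sq1 form \<Delta> s w \<union> Sq2 form \<Delta> s w" by simp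
qed

section \<open>Morphisms from matching arrows\<close>

text \<open>
  Flipping a position reflects all later arrows in the arrow of that position. Hence a morphism is
  determined by one pair of subexpressions with the same arrows at the selected positions.
\<close>

definition transport ::
    "nat \<Rightarrow> nat \<Rightarrow> (nat \<Rightarrow> nat) \<Rightarrow> subexpression \<Rightarrow> subexpression \<Rightarrow> subexpression \<Rightarrow> subexpression" where
  "transport m n p \<delta>0 \<gamma> \<delta> =
     map (\<lambda>k. if \<exists>i<m. p i = k \<and> \<delta> ! i \<noteq> \<delta>0 ! i then \<not> \<gamma> ! k else \<gamma> ! k) [0..<n]"

context
  fixes s t :: "('v \<Rightarrow> 'v) list" and p :: "nat \<Rightarrow> nat" and \<gamma> \<delta>0 :: subexpression
    and \<phi> :: "subexpression \<Rightarrow> subexpression"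
  defines "\<phi> \<equiv> transport (length t) (length s) p \<delta>0 \<gamma>"
  assumes re_s: "root_expression s" and re_t: "root_expression t"
    and \<gamma>: "\<gamma> \<in> Sub s" and \<delta>0: "\<delta>0 \<in> Sub t"
    and mono: "strict_mono_on {..<length t} p" and range: "\<And>i. i < length t \<Longrightarrow> p i < length s"
    and matching: "\<And>i. i < length t \<Longrightarrow> arr s \<gamma> (p i) = arr t \<delta>0 i"
begin

lemma p_less_iff: "i < length t \<Longrightarrow> j < length t \<Longrightarrow> p i < p j \<longleftrightarrow> i < j"
  using mono by (metis lessThan_iff not_less_iff_gr_or_eq strict_mono_onD)

lemma p_eq_iff: "i < length t \<Longrightarrow> j < length t \<Longrightarrow> p i = p j \<longleftrightarrow> i = j"
  using p_less_iff by (metis less_irrefl linorder_neqE_nat)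

lemma length_\<phi> [simp]: "length (\<phi> \<delta>) = length s"
  by (simp add: \<phi>_def transport_def)

lemma nth_\<phi>: "k < length s \<Longrightarrow>
    \<phi> \<delta> ! k = (if \<exists>i<length t. p i = k \<and> \<delta> ! i \<noteq> \<delta>0 ! i then \<not> \<gamma> ! k else \<gamma> ! k)"
  by (auto simp: \<phi>_def transport_def)

lemma \<phi>_Sub: "\<phi> \<delta> \<in> Sub s"
  by (simp add: Sub_def)

lemma \<phi>_base: "\<phi> \<delta>0 = \<gamma>"
  by (rule nth_equalityI) (use \<gamma> in \<open>auto simp: nth_\<phi> Sub_def\<close>)

lemma \<phi>_flip:
  assumes "\<delta> \<in> Sub t" "i < length t"
  shows "\<phi> (flip i \<delta>) = flip (p i) (\<phi> \<delta>)"
proof (rule nth_equalityI)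
  fix k assume "k < length (\<phi> (flip i \<delta>))"
  then have k: "k < length s" by simp
  have ex: "(\<exists>j<length t. p j = k \<and> P j) \<longleftrightarrow> P i" if "k = p i" for P
    using that p_eq_iff assms(2) by auto
  show "\<phi> (flip i \<delta>) ! k = flip (p i) (\<phi> \<delta>) ! k"
  proof (cases "k = p i")
    case True
    have e: "(\<exists>j<length t. p j = k \<and> \<epsilon> ! j \<noteq> \<delta>0 ! j) \<longleftrightarrow> \<epsilon> ! i \<noteq> \<delta>0 ! i" for \<epsilon>
      by (rule ex[OF True])
    have "flip i \<delta> ! i \<longleftrightarrow> \<not> \<delta> ! i" using assms by (simp add: nth_flip Sub_def)
    moreover have "flip (p i) (\<phi> \<delta>) ! k \<longleftrightarrow> \<not> \<phi> \<delta> ! k" using True k by (simp add: nth_flip)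
    ultimately show ?thesis unfolding nth_\<phi>[OF k] e by auto
  next
    case False
    have "flip i \<delta> ! j = \<delta> ! j" if "j < length t" "p j = k" for j
      using that False assms by (auto simp: nth_flip Sub_def)
    then have "(\<exists>j<length t. p j = k \<and> flip i \<delta> ! j \<noteq> \<delta>0 ! j) \<longleftrightarrow> (\<exists>j<length t. p j = k \<and> \<delta> ! j \<noteq> \<delta>0 ! j)"
      by auto
    then show ?thesis using k False by (simp add: nth_\<phi> nth_flip)
  qed
qed simp

lemma arr_\<phi>:
  assumes "\<delta> \<in> Sub t" "i < length t"
  shows "arr s (\<phi> \<delta>) (p i) = arr t \<delta> i"
  using assms
proof (induction "card {k. k < length t \<and> \<delta> ! k \<noteq> \<delta>0 ! k}" arbitrary: \<delta> i rule: less_induct)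
  case less
  let ?D = "\<lambda>\<delta>. {k. k < length t \<and> \<delta> ! k \<noteq> \<delta>0 ! k}"
  show ?case
  proof (cases "\<delta> = \<delta>0")
    case True
    then show ?thesis using matching less.prems \<phi>_base by simp
  next
    case False
    then have "\<exists>k<length t. \<delta> ! k \<noteq> \<delta>0 ! k"
      using less.prems(1) \<delta>0 nth_equalityI[of \<delta> \<delta>0] by (auto simp: Sub_def)
    then obtain k where k: "k < length t" "\<delta> ! k \<noteq> \<delta>0 ! k" by blast
    let ?\<delta> = "flip k \<delta>"
    have sub: "?\<delta> \<in> Sub t" using less.prems by simp
    have "?D ?\<delta> = ?D \<delta> - {k}" using k less.prems by (auto simp: nth_flip Sub_def split: if_splits)
    then have "card (?D ?\<delta>) < card (?D \<delta>)" using k by (intro psubset_card_mono) auto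
    note IH = less.hyps[OF this sub]
    have "\<phi> \<delta> = flip (p k) (\<phi> ?\<delta>)" using \<phi>_flip[OF sub k(1)] by simp
    then have "arr s (\<phi> \<delta>) (p i) =
        (if p k < p i then refl (arr s (\<phi> ?\<delta>) (p k)) (arr s (\<phi> ?\<delta>) (p i)) else arr s (\<phi> ?\<delta>) (p i))"
      using arr_flip[OF re_s \<phi>_Sub range[OF k(1)] range[OF less.prems(2)]] by simp
    also have "\<dots> = (if k < i then refl (arr t ?\<delta> k) (arr t ?\<delta> i) else arr t ?\<delta> i)"
      using IH k less.prems p_less_iff by simp
    also have "\<dots> = arr t (flip k ?\<delta>) i" using arr_flip[OF re_t sub k(1) less.prems(2)] by simp
    finally show ?thesis by simp
  qed
qed

lemma \<phi>_inject: "\<delta> \<in> Sub t \<Longrightarrow> \<epsilon> \<in> Sub t \<Longrightarrow> \<phi> \<delta> = \<phi> \<epsilon> \<Longrightarrow> \<delta> = \<epsilon>"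
proof (rule nth_equalityI)
  fix i assume a: "\<delta> \<in> Sub t" "\<epsilon> \<in> Sub t" "\<phi> \<delta> = \<phi> \<epsilon>" "i < length \<delta>"
  then have i: "i < length t" by (simp add: Sub_def)
  have "\<phi> \<delta> ! p i = (if \<delta> ! i \<noteq> \<delta>0 ! i then \<not> \<gamma> ! p i else \<gamma> ! p i)" for \<delta>
    using i range p_eq_iff by (auto simp: nth_\<phi>)
  then show "\<delta> ! i = \<epsilon> ! i" using a(3) by (metis (full_types))
qed (simp add: Sub_def)

lemma transport_morphism: "positive_cosign_morphism form \<Delta> t s p \<phi>"
  unfolding positive_cosign_morphism_def
  using mono range \<phi>_Sub arr_\<phi> \<phi>_flip by auto

end

end

section \<open>Transporting dihedral cycles\<close>

lemma cycle_through_image: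
  "cycle_through xs = (\<lambda>k. {xs ! k, xs ! (Suc k mod length xs)}) ` {..<length xs}"
  by (auto simp: cycle_through_def)

lemma map_edges_cycle_through: "map_edges f (cycle_through xs) = cycle_through (map f xs)"
  unfolding map_edges_def cycle_through_image image_image length_map
proof (rule image_cong)
  fix k assume k: "k \<in> {..<length xs}"
  then have "0 < length xs" by (cases xs) auto
  then have "Suc k mod length xs < length xs" by (rule mod_less_divisor)
  then show "f ` {xs ! k, xs ! (Suc k mod length xs)} = {map f xs ! k, map f xs ! (Suc k mod length xs)}"
    using k by simp
qed simp

lemma successively_invariant:
  assumes "successively P (x # xs)" "R x" "\<And>a b. R a \<Longrightarrow> P a b \<Longrightarrow> R b"
  shows "y \<in> set (x # xs) \<Longrightarrow> R y"
  using assms(1,2)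
proof (induction xs arbitrary: x)
  case (Cons z xs)
  then have "R z" "successively P (z # xs)" using assms(3)[of x z] by auto
  then show ?case using Cons by auto
qed simp

context based_root_system
begin

text \<open>
  A morphism takes such steps to edges, because it preserves arrows at the selected positions.
\<close>

definition small_step :: "('v \<Rightarrow> 'v) list \<Rightarrow> subexpression \<Rightarrow> subexpression \<Rightarrow> bool" where
  "small_step t \<delta> \<epsilon> \<longleftrightarrow> \<delta> \<in> Sub t \<and>
     (\<exists>i j. i < j \<and> j < length t \<and> \<epsilon> = flip2 i j \<delta> \<and> pm_eq (arr t \<delta> i) (arr t \<delta> j))"

lemma small_stepI:
  "\<delta> \<in> Sub t \<Longrightarrow> i < j \<Longrightarrow> j < length t \<Longrightarrow> pm_eq (arr t \<delta> i) (arr t \<delta> j) \<Longrightarrow> small_step t \<delta> (flip2 i j \<delta>)"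
  unfolding small_step_def by blast

lemma small_step_sym:
  assumes re: "root_expression t" and "small_step t \<delta> \<epsilon>"
  shows "small_step t \<epsilon> \<delta>"
proof -
  obtain i j where ij: "\<delta> \<in> Sub t" "i < j" "j < length t" "\<epsilon> = flip2 i j \<delta>" "pm_eq (arr t \<delta> i) (arr t \<delta> j)"
    using assms(2) unfolding small_step_def by blast
  have a: "arr t \<epsilon> i = arr t \<delta> i" "arr t \<epsilon> j = refl (arr t \<delta> i) (arr t \<delta> j)"
    using arr_flip2[OF re ij(1-3) _ ij(5)] ij by auto
  have "pm_eq (arr t \<delta> i) (refl (arr t \<delta> i) (arr t \<delta> j))"
    using ij(5) arr_unit[OF re ij(1), of i] ij(2,3) by (auto simp: pm_eq_def)
  then have "small_step t \<epsilon> (flip2 i j \<epsilon>)" using ij a by (intro small_stepI) auto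
  then show ?thesis using ij(4) by simp
qed

text \<open>
  The image of a dihedral cycle under the morphism given by matching arrows is a cycle through \<open>\<gamma>\<close>.
  It stays below \<open>\<gamma>\<close> if every other vertex of the dihedral cycle has its last difference from \<open>\<delta>0\<close>
  at a position with positive arrow, since the morphism preserves last differences.
\<close>

lemma linked_image_cycle:
  assumes re_s: "root_expression s" and g: "\<gamma> \<in> vertices s w"
    and D: "dihedral_reflection_subgroup form \<Delta> D" "finite D" "canonical_generators form \<Delta> D = {c, d}" "c \<noteq> d"
    and t: "t = alternating c d z" and \<delta>0: "\<delta>0 \<in> Sub t"
    and std: "standard_cycle (int (card D div 2)) (int z) (cycle_through (\<delta>0 # xs))"
    and dist: "distinct (\<delta>0 # xs)" and len: "2 \<le> length xs"
    and steps: "successively (small_step t) (\<delta>0 # xs @ [\<delta>0])"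
    and low: "\<And>\<epsilon>. \<epsilon> \<in> set xs \<Longrightarrow> \<exists>j. last_difference t \<delta>0 \<epsilon> j \<and> arr t \<delta>0 j \<in> Pos"
    and ends: "hd xs = flip2 a b \<delta>0" "last xs = flip2 a' b' \<delta>0" "a < z" "b < z" "a' < z" "b' < z"
    and mono: "strict_mono_on {..<z} p" and range: "\<And>i. i < z \<Longrightarrow> p i < length s"
    and matching: "\<And>i. i < z \<Longrightarrow> arr s \<gamma> (p i) = arr t \<delta>0 i"
  shows "linked s w \<gamma> {\<gamma>, flip2 (p a) (p b) \<gamma>} {\<gamma>, flip2 (p a') (p b') \<gamma>}"
proof -
  have lt: "length t = z" by (simp add: t)
  have "{c, d} \<subseteq> T" using D(3) unfolding canonical_generators_def by blast
  then have re_t: "root_expression t"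
    unfolding root_expression_def t using set_alternating[of c d z] by blast
  have gS: "\<gamma> \<in> Sub s" using g by (simp add: vertices_def)
  define \<phi> where "\<phi> = transport (length t) (length s) p \<delta>0 \<gamma>"
  have mono': "strict_mono_on {..<length t} p" using mono lt by simp
  have range': "\<And>i. i < length t \<Longrightarrow> p i < length s" using range lt by simp
  have matching': "\<And>i. i < length t \<Longrightarrow> arr s \<gamma> (p i) = arr t \<delta>0 i" using matching lt by simp
  note hyps = re_s re_t gS \<delta>0 mono' range' matching'
  note base = \<phi>_base[OF hyps, folded \<phi>_def] and fl = \<phi>_flip[OF hyps, folded \<phi>_def]
    and ar = arr_\<phi>[OF hyps, folded \<phi>_def] and inj = \<phi>_inject[OF hyps, folded \<phi>_def]
    and mor = transport_morphism[OF hyps, folded \<phi>_def] and sub = \<phi>_Sub[OF hyps, folded \<phi>_def]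
  have fl2: "\<phi> (flip2 i j \<delta>) = flip2 (p i) (p j) (\<phi> \<delta>)" if "\<delta> \<in> Sub t" "i < length t" "j < length t" for i j \<delta>
    unfolding flip2_def using fl that by simp
  have pless: "p i < p j" if "i < j" "j < length t" for i j
    using p_less_iff[OF hyps] that by simp
  have step: "adjacent (\<phi> \<delta>) (\<phi> \<epsilon>) \<and> \<phi> \<epsilon> \<in> vertices s w \<and> \<epsilon> \<in> Sub t"
    if st: "small_step t \<delta> \<epsilon>" and v: "\<phi> \<delta> \<in> vertices s w" for \<delta> \<epsilon>
  proof -
    obtain i j where ij: "\<delta> \<in> Sub t" "i < j" "j < length t" "\<epsilon> = flip2 i j \<delta>" "pm_eq (arr t \<delta> i) (arr t \<delta> j)"
      using st unfolding small_step_def by blast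
    have e: "\<phi> \<epsilon> = flip2 (p i) (p j) (\<phi> \<delta>)" using fl2 ij by simp
    have pij: "p i < p j" "p j < length s" using pless range' ij by auto
    have "pm_eq (arr s (\<phi> \<delta>) (p i)) (arr s (\<phi> \<delta>) (p j))" using ar ij by simp
    then have "target s (\<phi> \<epsilon>) = target s (\<phi> \<delta>)"
      unfolding e using target_flip2_iff[OF re_s sub pij] by simp
    then have "\<phi> \<epsilon> \<in> vertices s w" using v sub[of \<epsilon>] by (simp add: vertices_def)
    moreover have "adjacent (\<phi> \<delta>) (\<phi> \<epsilon>)"
      unfolding e by (rule adjacent_flip2) (use pij sub[of \<delta>] in \<open>auto simp: Sub_def\<close>)
    moreover have "\<epsilon> \<in> Sub t" using ij by simp
    ultimately show ?thesis by blast
  qed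
  have verts: "\<epsilon> \<in> Sub t \<and> \<phi> \<epsilon> \<in> vertices s w" if "\<epsilon> \<in> set (\<delta>0 # xs @ [\<delta>0])" for \<epsilon>
    by (rule successively_invariant[OF steps _ _ that])
      (use \<delta>0 base g step in auto)
  have adj: "successively adjacent (map \<phi> (\<delta>0 # xs @ [\<delta>0]))"
    unfolding successively_map
    by (rule successively_mono[OF steps]) (use step verts in auto)
  have inj': "inj_on \<phi> (set (\<delta>0 # xs))" using inj verts by (auto intro!: inj_onI)
  have C: "map_edges \<phi> (cycle_through (\<delta>0 # xs)) = cycle_through (\<gamma> # map \<phi> xs)"
    using map_edges_cycle_through[of \<phi> "\<delta>0 # xs"] base by simp
  have len0: "xs \<noteq> []" using len by auto
  have "linked s w \<gamma> {\<gamma>, hd (map \<phi> xs)} {\<gamma>, last (map \<phi> xs)}"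
  proof (rule linked_cycle)
    show dist': "distinct (\<gamma> # map \<phi> xs)"
      using dist inj' distinct_map[of \<phi> "\<delta>0 # xs"] base by simp
    show "2 \<le> length (map \<phi> xs)" using len by simp
    show vs: "set (\<gamma> # map \<phi> xs) \<subseteq> vertices s w" using verts g by auto
    show adj': "successively adjacent (\<gamma> # map \<phi> xs @ [\<gamma>])" using adj base by simp
    have "map_edges \<phi> (cycle_through (\<delta>0 # xs)) \<subseteq> edges s w"
      unfolding C by (rule cycle_through_subset_edges[OF vs]) (use adj' in simp)
    then have "map_edges \<phi> (cycle_through (\<delta>0 # xs)) \<in> Cyc form \<Delta> s w"
      unfolding Cyc_def using D std mor t by blast
    then show "cycle_through (\<gamma> # map \<phi> xs) \<in> Cyc form \<Delta> s w \<union> Tr1 form \<Delta> s w \<union> Tr2 form \<Delta> s w \<union> Tr3 form \<Delta> s w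
       \<union> Sq1 form \<Delta> s w \<union> Sq2 form \<Delta> s w" unfolding C by simp
    show "key s \<delta> \<le> key s \<gamma>" if d: "\<delta> \<in> set (map \<phi> xs)" for \<delta>
    proof -
      obtain \<epsilon> where e: "\<epsilon> \<in> set xs" "\<delta> = \<phi> \<epsilon>" using d by auto
      then obtain j where j: "last_difference t \<delta>0 \<epsilon> j" "arr t \<delta>0 j \<in> Pos" using low by blast
      then have jl: "j < length t" by (simp add: last_difference_def)
      have nth: "\<phi> \<epsilon> ! k = (if \<exists>i<length t. p i = k \<and> \<epsilon> ! i \<noteq> \<delta>0 ! i then \<not> \<gamma> ! k else \<gamma> ! k)"
        if "k < length s" for k
        unfolding \<phi>_def by (rule nth_\<phi>[OF hyps that])
      have "last_difference s \<gamma> (\<phi> \<epsilon>) (p j)"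
        unfolding last_difference_def
      proof (intro conjI allI impI)
        show "p j < length s" using range' jl by simp
        show "\<gamma> ! p j \<noteq> \<phi> \<epsilon> ! p j"
          unfolding nth[OF range'[OF jl]] using j(1) jl by (auto simp: last_difference_def)
        fix k assume k: "p j < k" "k < length s"
        have "\<not> (\<exists>i<length t. p i = k \<and> \<epsilon> ! i \<noteq> \<delta>0 ! i)"
        proof
          assume "\<exists>i<length t. p i = k \<and> \<epsilon> ! i \<noteq> \<delta>0 ! i"
          then obtain i where i: "i < length t" "p i = k" "\<epsilon> ! i \<noteq> \<delta>0 ! i" by blast
          then have "j < i" using p_less_iff[OF hyps jl i(1)] k by simp
          then show False using j(1) i by (auto simp: last_difference_def)
        qed
        then show "\<gamma> ! k = \<phi> \<epsilon> ! k" unfolding nth[OF k(2)] by auto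
      qed
      moreover have "arr s \<gamma> (p j) \<in> Pos" using matching' jl j by simp
      moreover have "target s \<gamma> = target s (\<phi> \<epsilon>)" using vs g e by (auto simp: vertices_def)
      ultimately show ?thesis using key_less_iff(1)[OF re_s gS sub] e by (metis less_imp_le)
    qed
  qed
  moreover have "hd (map \<phi> xs) = flip2 (p a) (p b) \<gamma>" "last (map \<phi> xs) = flip2 (p a') (p b') \<gamma>"
    using len0 ends fl2[OF \<delta>0] lt base by (simp_all add: hd_map last_map)
  ultimately show ?thesis by simp
qed

section \<open>Subexpressions of alternating expressions\<close>

lemma length_zeros_at [simp]: "length (zeros_at (int z) P) = z"
  by (simp add: zeros_at_def)

lemma nth_zeros_at: "i < z \<Longrightarrow> zeros_at (int z) P ! i \<longleftrightarrow> int i + 1 \<notin> P"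
  by (simp add: zeros_at_def add.commute)

lemma zeros_at_flip2:
  assumes "i \<noteq> j" "\<And>k. 1 \<le> k \<Longrightarrow> k \<le> int z \<Longrightarrow> k \<in> Q \<longleftrightarrow> (k \<in> P) \<noteq> (k = int i + 1 \<or> k = int j + 1)"
  shows "zeros_at (int z) Q = flip2 i j (zeros_at (int z) P)"
proof (rule nth_equalityI)
  fix k assume "k < length (zeros_at (int z) Q)"
  then have k: "k < z" by simp
  then show "zeros_at (int z) Q ! k = flip2 i j (zeros_at (int z) P) ! k"
    using assms(1) assms(2)[of "int k + 1"] by (auto simp: nth_flip2 nth_zeros_at)
qed simp

lemma zeros_at_ne:
  assumes "1 \<le> k" "k \<le> int z" "(k \<in> P) \<noteq> (k \<in> Q)"
  shows "zeros_at (int z) P \<noteq> zeros_at (int z) Q"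
proof -
  have "nat (k - 1) < z" "int (nat (k - 1)) + 1 = k" using assms by auto
  then show ?thesis using nth_zeros_at[of "nat (k - 1)" z] assms(3) by metis
qed

lemma last_difference_zeros_at:
  assumes "1 \<le> j" "j \<le> int (length t)" "(j \<in> P) \<noteq> (j \<in> Q)"
    "\<And>k. j < k \<Longrightarrow> k \<le> int (length t) \<Longrightarrow> k \<in> P \<longleftrightarrow> k \<in> Q"
  shows "last_difference t (zeros_at (int (length t)) P) (zeros_at (int (length t)) Q) (nat (j - 1))"
  unfolding last_difference_def
proof (intro conjI allI impI)
  have j: "nat (j - 1) < length t" "int (nat (j - 1)) + 1 = j" using assms by auto
  show "nat (j - 1) < length t" by (rule j)
  show "zeros_at (int (length t)) P ! nat (j - 1) \<noteq> zeros_at (int (length t)) Q ! nat (j - 1)"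
    using j assms(3) by (simp add: nth_zeros_at)
  fix k assume "nat (j - 1) < k" "k < length t"
  then show "zeros_at (int (length t)) P ! k = zeros_at (int (length t)) Q ! k"
    using assms(4)[of "int k + 1"] by (simp add: nth_zeros_at)
qed

text \<open>
  Between two positions of equal parity at which only zeros lie strictly in between, the partial
  product changes at most by the common letter, so the two arrows agree up to sign.
\<close>

lemma pm_eq_arr_across_zeros:
  assumes re: "root_expression (alternating c d z)" and \<delta>: "\<delta> \<in> Sub (alternating c d z)"
    and ab: "a < b" "b < z" "even (b - a)" and zeros: "\<And>k. a < k \<Longrightarrow> k < b \<Longrightarrow> \<not> \<delta> ! k"
  shows "pm_eq (arr (alternating c d z) \<delta> a) (arr (alternating c d z) \<delta> b)"
proof -
  let ?t = "alternating c d z"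
  have const: "before ?t \<delta> m = before ?t \<delta> (Suc a)" if "Suc a \<le> m" "m \<le> b" for m
    using that
  proof (induction m rule: dec_induct)
    case (step m)
    then have "before ?t \<delta> (Suc m) = before ?t \<delta> m"
      using before_Suc[OF \<delta>, of m] zeros[of m] ab by simp
    then show ?case using step by simp
  qed simp
  have letter: "?t ! b = ?t ! a" using ab by simp
  have al: "a < length ?t" using ab by simp
  have ref: "(?t ! a) (- rt (?t ! a)) = rt (?t ! a)"
    using root_expression_nth[OF re al] Pos_unit by (metis refl_self refl_simps(4) minus_minus)
  have "before ?t \<delta> b = before ?t \<delta> a \<circ> (if \<delta> ! a then ?t ! a else id)"
    using const[of b] before_Suc[OF \<delta> al] ab by simp
  then have "arr ?t \<delta> b = (if \<delta> ! a then - arr ?t \<delta> a else arr ?t \<delta> a)"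
    using before_isometry[OF re \<delta>, of a] al
    by (simp add: arrow_def letter ref isometry_simps del: nth_alternating)
  then show ?thesis by simp
qed

lemma small_step_zeros:
  assumes t: "t = alternating c d z" and re: "root_expression t"
    and AB: "1 \<le> A" "A < B" "B \<le> int z" "even (B - A)" "{A<..<B} \<subseteq> P"
    and Q: "\<And>k. 1 \<le> k \<Longrightarrow> k \<le> int z \<Longrightarrow> k \<in> Q \<longleftrightarrow> (k \<in> P) \<noteq> (k = A \<or> k = B)"
  shows "small_step t (zeros_at (int z) P) (zeros_at (int z) Q)"
proof -
  define a b where "a = nat (A - 1)" and "b = nat (B - 1)"
  have ab: "int a + 1 = A" "int b + 1 = B" "a < b" "b < z" using AB by (auto simp: a_def b_def)
  have "int (b - a) = B - A" using ab by simp
  then have ev: "even (b - a)" using AB(4) by (metis even_of_nat)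
  have S: "zeros_at (int z) P \<in> Sub t" by (simp add: Sub_def t)
  have "pm_eq (arr t (zeros_at (int z) P) a) (arr t (zeros_at (int z) P) b)"
    unfolding t
  proof (rule pm_eq_arr_across_zeros[OF re[unfolded t] S[unfolded t] ab(3,4) ev])
    fix k assume "a < k" "k < b"
    then have "int k + 1 \<in> P" using AB(5) ab by auto
    then show "\<not> zeros_at (int z) P ! k" using nth_zeros_at[of k z P] \<open>k < b\<close> ab by simp
  qed
  then have "small_step t (zeros_at (int z) P) (flip2 a b (zeros_at (int z) P))"
    using S ab t by (intro small_stepI) auto
  moreover have "zeros_at (int z) Q = flip2 a b (zeros_at (int z) P)"
    by (rule zeros_at_flip2) (use ab Q in auto)
  ultimately show ?thesis by simp
qed

lemma successively_map_rev_upto: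
  assumes "\<And>i. a < i \<Longrightarrow> i \<le> b \<Longrightarrow> P (f i) (f (i - 1))"
  shows "successively P (map f (rev [a..b]))"
  using assms
proof (induction "nat (b - a + 1)" arbitrary: b)
  case 0
  then show ?case by simp
next
  case (Suc m)
  then have ab: "a \<le> b" by simp
  have IH: "successively P (map f (rev [a..b - 1]))" using Suc by (intro Suc.hyps) auto
  have eq: "rev [a..b] = b # rev [a..b - 1]" using ab by (simp add: upto_rec2)
  show ?case
  proof (cases "a = b")
    case False
    then have "rev [a..b - 1] = (b - 1) # rev [a..b - 2]" using ab upto_rec2[of a "b - 1"] by simp
    then show ?thesis using IH Suc.prems[of b] ab False unfolding eq by simp
  qed simp
qed

lemma distinct_map_rev_upto:
  assumes "\<And>i j. a \<le> j \<Longrightarrow> j < i \<Longrightarrow> i \<le> b \<Longrightarrow> f i \<noteq> f j"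
  shows "distinct (map f (rev [a..b]))"
proof -
  have "inj_on f {a..b}"
    using assms by (intro inj_onI) (metis atLeastAtMost_iff linorder_neqE)
  then show ?thesis by (simp add: distinct_map)
qed

text \<open>
  The lists of the dihedral cycles omit the index \<open>0\<close>, at which the value for index \<open>1\<close> is
  repeated. Shifting the positive indices down by one gives uniform lists.
\<close>

lemma map_skip_zero:
  assumes "a \<le> 0" "1 \<le> b"
  shows "map f (rev [1..b]) @ map f (rev [a..-1]) =
    map (\<lambda>i. f (if 0 \<le> i then i + 1 else i)) (rev [a..b - 1])"
proof -
  let ?g = "\<lambda>i. f (if 0 \<le> i then i + 1 else i)"
  have "[a..b - 1] = [a..-1] @ [0..b - 1]" using assms upto_split1[of a 0 "b - 1"] by simp
  moreover have "map ?g [0..b - 1] = map f [1..b]"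
    by (rule nth_equalityI) (use assms in \<open>auto simp: add.commute\<close>)
  moreover have "map ?g [a..-1] = map f [a..-1]" by (rule map_cong) auto
  ultimately show ?thesis by (simp add: rev_map[symmetric])
qed

subsection \<open>The first family\<close>

text \<open>
  The zero sets \<open>\<sigma>\<^sup>(\<^sup>i\<^sup>)\<close> of the first family, with the positive indices shifted down by one.
\<close>

definition tau1 :: "int \<Rightarrow> int \<Rightarrow> int \<Rightarrow> int set" where
  "tau1 n x i = (if i = x then {x + 1, x + n + 1} else if i = x - n then {x, x + n}
     else {x, 2 * x - i, 2 * x - i + 1, x + n + 1})"

lemma mem_tau1:
  "k \<in> tau1 n x i \<longleftrightarrow> (if i = x then k = x + 1 \<or> k = x + n + 1 else if i = x - n then k = x \<or> k = x + n
     else k = x \<or> k = 2 * x - i \<or> k = 2 * x - i + 1 \<or> k = x + n + 1)"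
  by (auto simp: tau1_def)

lemma tau1_step:
  assumes "x - n < i" "i \<le> x" "1 \<le> x" "x < n"
  shows "k \<in> tau1 n x (i - 1) \<longleftrightarrow> (k \<in> tau1 n x i) \<noteq> (k = 2 * x - i \<or> k = 2 * x - i + 2)"
proof -
  consider "i = x" | "i \<noteq> x" "i - 1 = x - n" | "i \<noteq> x" "i - 1 \<noteq> x - n" by blast
  then show ?thesis
  proof cases
    case 1
    have "i - 1 \<noteq> x" "i - 1 \<noteq> x - n" using 1 assms by auto
    then show ?thesis unfolding mem_tau1 using 1 assms by auto
  next
    case 2
    have "i - 1 \<noteq> x" "i \<noteq> x - n" using 2 assms by auto
    then show ?thesis unfolding mem_tau1 using 2 assms by (smt (verit))
  next
    case 3
    have "i - 1 \<noteq> x" "i \<noteq> x - n" using 3 assms by auto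
    then show ?thesis unfolding mem_tau1 using 3 assms by (smt (verit))
  qed
qed

lemma Cyc1_eq:
  assumes "1 \<le> x" "x < n"
  shows "Cyc1 n x y = cycle_through (zeros_at y {} # map (\<lambda>i. zeros_at y (tau1 n x i)) (rev [x - n..x]))"
proof -
  have "map (sigma1 n x) (rev [1..x + 1]) @ map (sigma1 n x) (rev [x - n..-1]) =
      map (\<lambda>i. sigma1 n x (if 0 \<le> i then i + 1 else i)) (rev [x - n..x])"
    using map_skip_zero[of "x - n" "x + 1" "sigma1 n x"] assms by simp
  also have "\<dots> = map (tau1 n x) (rev [x - n..x])"
    by (rule map_cong) (use assms in \<open>auto simp: sigma1_def tau1_def\<close>)
  finally show ?thesis unfolding Cyc1_def by (simp add: comp_def)
qed

text \<open>
  Here \<open>z\<close> is the least possible length \<open>x + n + 1\<close>. The two neighbours of the start \<open>\<delta>0\<close> in the cycle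
  are its flips at \<open>{x + 1, x + n + 1}\<close> and at \<open>{x, x + n}\<close>, in positions counted from \<open>1\<close>. All other
  vertices have their last difference from \<open>\<delta>0\<close> at \<open>x + n + 1\<close> or at \<open>x + n\<close>.
\<close>

lemma linked_Cyc1:
  assumes re_s: "root_expression s" and g: "\<gamma> \<in> vertices s w"
    and D: "dihedral_reflection_subgroup form \<Delta> D" "finite D" "canonical_generators form \<Delta> D = {c, d}" "c \<noteq> d"
    and n: "card D div 2 = n" and x: "1 \<le> x" "x < n" and z: "z = x + n + 1"
    and t: "t = alternating c d z" and \<delta>0: "\<delta>0 = zeros_at (int z) {}"
    and pm: "pm_eq (arr t \<delta>0 (x - 1)) (arr t \<delta>0 (x + n - 1))" "pm_eq (arr t \<delta>0 x) (arr t \<delta>0 (x + n))"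
    and pos: "arr t \<delta>0 (x + n - 1) \<in> Pos" "arr t \<delta>0 (x + n) \<in> Pos"
    and mono: "strict_mono_on {..<z} p" and range: "\<And>i. i < z \<Longrightarrow> p i < length s"
    and matching: "\<And>i. i < z \<Longrightarrow> arr s \<gamma> (p i) = arr t \<delta>0 i"
  shows "linked s w \<gamma> {\<gamma>, flip2 (p x) (p (x + n)) \<gamma>} {\<gamma>, flip2 (p (x - 1)) (p (x + n - 1)) \<gamma>}"
proof -
  define xs where "xs = map (\<lambda>i. zeros_at (int z) (tau1 (int n) (int x) i)) (rev [int x - int n..int x])"
  let ?X = "int x" and ?N = "int n"
  have lt: "length t = z" by (simp add: t)
  have "{c, d} \<subseteq> T" using D(3) unfolding canonical_generators_def by blast
  then have re_t: "root_expression t"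
    unfolding root_expression_def t using set_alternating[of c d z] by blast
  have S: "\<delta>0 \<in> Sub t" by (simp add: \<delta>0 Sub_def lt)
  have rev1: "rev [?X - ?N..?X] = ?X # rev [?X - ?N..?X - 1]" using x by (simp add: upto_rec2)
  have hd: "hd xs = zeros_at (int z) {?X + 1, ?X + ?N + 1}" by (simp add: xs_def rev1 tau1_def)
  have last: "last xs = zeros_at (int z) {?X, ?X + ?N}"
    using x by (simp add: xs_def last_map last_rev upto_rec1[of "?X - ?N"] tau1_def)
  have hdf: "hd xs = flip2 x (x + n) \<delta>0"
    unfolding hd \<delta>0 by (rule zeros_at_flip2) (use x in auto)
  have lastf: "last xs = flip2 (x - 1) (x + n - 1) \<delta>0"
    unfolding last \<delta>0 by (rule zeros_at_flip2) (use x in auto)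
  show ?thesis
  proof (rule linked_image_cycle[OF re_s g D t S _ _ _ _ _ hdf lastf _ _ _ _ mono range matching])
    have "cycle_through (\<delta>0 # xs) = Cyc1 ?N ?X (int z)"
      using Cyc1_eq[of ?X ?N "int z"] x by (simp add: \<delta>0 xs_def)
    then show "standard_cycle (int (card D div 2)) (int z) (cycle_through (\<delta>0 # xs))"
      unfolding standard_cycle_def n using x z by (intro disjI1 exI[of _ ?X] exI[of _ "int z"]) simp
    have "distinct xs" unfolding xs_def
    proof (rule distinct_map_rev_upto)
      fix i j assume ij: "?X - ?N \<le> j" "j < i" "i \<le> ?X"
      define k where "k = (if i = ?X then ?X else 2 * ?X - i)"
      show "zeros_at (int z) (tau1 ?N ?X i) \<noteq> zeros_at (int z) (tau1 ?N ?X j)"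
        by (rule zeros_at_ne[of k]) (use ij x z in \<open>auto simp: tau1_def k_def\<close>)
    qed
    moreover have "\<delta>0 \<notin> set xs"
    proof
      assume "\<delta>0 \<in> set xs"
      then obtain i where i: "?X - ?N \<le> i" "i \<le> ?X" "\<delta>0 = zeros_at (int z) (tau1 ?N ?X i)" by (auto simp: xs_def)
      define k where "k = (if i = ?X then ?X + 1 else ?X)"
      have "zeros_at (int z) {} \<noteq> zeros_at (int z) (tau1 ?N ?X i)"
        by (rule zeros_at_ne[of k]) (use i x z in \<open>auto simp: tau1_def k_def\<close>)
      then show False using i by (simp add: \<delta>0)
    qed
    ultimately show "distinct (\<delta>0 # xs)" by simp
    show "2 \<le> length xs" using x by (simp add: xs_def)
    have mid: "successively (small_step t) xs" unfolding xs_def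
    proof (rule successively_map_rev_upto)
      fix i assume i: "?X - ?N < i" "i \<le> ?X"
      show "small_step t (zeros_at (int z) (tau1 ?N ?X i)) (zeros_at (int z) (tau1 ?N ?X (i - 1)))"
      proof (rule small_step_zeros[OF t re_t, of "2 * ?X - i" "2 * ?X - i + 2"])
        show "1 \<le> 2 * ?X - i" "2 * ?X - i < 2 * ?X - i + 2" "2 * ?X - i + 2 \<le> int z" using i x z by auto
        show "even (2 * ?X - i + 2 - (2 * ?X - i))" by simp
        show "{2 * ?X - i<..<2 * ?X - i + 2} \<subseteq> tau1 ?N ?X i" using i by (auto simp: mem_tau1)
        fix k
        show "k \<in> tau1 ?N ?X (i - 1) \<longleftrightarrow> (k \<in> tau1 ?N ?X i) \<noteq> (k = 2 * ?X - i \<or> k = 2 * ?X - i + 2)"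
          by (rule tau1_step) (use i x in auto)
      qed
    qed
    have first: "small_step t \<delta>0 (hd xs)" unfolding hdf
      by (rule small_stepI) (use S x z pm lt in auto)
    have "small_step t \<delta>0 (last xs)" unfolding lastf
      by (rule small_stepI) (use S x z pm lt in auto)
    then have fin: "small_step t (last xs) \<delta>0" by (rule small_step_sym[OF re_t])
    have "xs \<noteq> []" using x by (simp add: xs_def)
    then show "successively (small_step t) (\<delta>0 # xs @ [\<delta>0])"
      using mid first fin by (auto simp: successively_Cons successively_append_iff)
    show "\<exists>j. last_difference t \<delta>0 \<epsilon> j \<and> arr t \<delta>0 j \<in> Pos" if e: "\<epsilon> \<in> set xs" for \<epsilon>
    proof -
      obtain i where i: "?X - ?N \<le> i" "i \<le> ?X" "\<epsilon> = zeros_at (int z) (tau1 ?N ?X i)"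
        using e by (auto simp: xs_def)
      define j where "j = (if i = ?X - ?N then ?X + ?N else ?X + ?N + 1)"
      have "last_difference t (zeros_at (int (length t)) {}) (zeros_at (int (length t)) (tau1 ?N ?X i)) (nat (j - 1))"
        by (rule last_difference_zeros_at) (use i x z lt in \<open>auto simp: tau1_def j_def\<close>)
      moreover have "nat (j - 1) = (if i = ?X - ?N then x + n - 1 else x + n)"
        using x by (auto simp: j_def nat_eq_iff)
      ultimately show ?thesis using pos i lt \<delta>0 by (metis (full_types))
    qed
  qed (use x z in auto)
qed

subsection \<open>The second family\<close>

text \<open>
  The zero sets \<open>\<sigma>\<^sup>(\<^sup>i\<^sup>)\<close> of the second family, with the positive indices shifted down by one. In all
  cases they consist of an interval with right end \<open>e\<close> and of a few isolated positions.
\<close>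

definition tau2 :: "int \<Rightarrow> int \<Rightarrow> int \<Rightarrow> int \<Rightarrow> int set" where
  "tau2 n x y i =
     (let z = 2 * x - y + 2 * n; r = 2 * y - x - n;
          e = (if i < r then 2 * x - 2 * y + 2 * n + i else 2 * y - 1 - i)
      in (if x \<le> i + 1 then {i + 1..e} else {x} \<union> {2 * x - i..e}) \<union>
         (if i < r then {z} else {x + n, z}))"

lemma mem_tau2:
  "k \<in> tau2 n x y i \<longleftrightarrow>
     (if x \<le> i + 1 then i + 1 \<le> k else k = x \<or> 2 * x - i \<le> k) \<and>
     (x \<le> i + 1 \<or> k \<noteq> x \<longrightarrow> k \<le> (if i < 2 * y - x - n then 2 * x - 2 * y + 2 * n + i else 2 * y - 1 - i)) \<or>
     k = 2 * x - y + 2 * n \<or> 2 * y - x - n \<le> i \<and> k = x + n"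
  by (auto simp: tau2_def Let_def)

lemma tau2_step:
  assumes "1 \<le> x" "x < y" "y \<le> n" "y - n < i" "i \<le> y - 1"
  shows "k \<in> tau2 n x y (i - 1) \<longleftrightarrow> (k \<in> tau2 n x y i) \<noteq>
    (k = (if x \<le> i then i else 2 * x - i) \<or>
     k = (if 2 * y - x - n \<le> i then 2 * y - i else 2 * x - 2 * y + 2 * n + i))"
proof -
  have low: "x \<le> i \<or> x = i + 1 \<or> i + 1 < x" by linarith
  consider "2 * y - x - n \<le> i - 1" | "2 * y - x - n = i" | "i < 2 * y - x - n" by linarith
  then show ?thesis
  proof cases
    case 1
    with low show ?thesis unfolding mem_tau2 using assms by (elim disjE) (smt (verit))+
  next
    case 2
    with low show ?thesis unfolding mem_tau2 using assms by (elim disjE) (smt (verit))+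
  next
    case 3
    with low show ?thesis unfolding mem_tau2 using assms by (elim disjE) (smt (verit))+
  qed
qed

lemma mem_sigma2_shift:
  assumes "1 \<le> x" "x < y" "y \<le> n" "y - n \<le> i" "i < y"
  shows "sigma2 n x y (if 0 \<le> i then i + 1 else i) = tau2 n x y i"
proof -
  have "k \<in> sigma2 n x y (if 0 \<le> i then i + 1 else i) \<longleftrightarrow> k \<in> tau2 n x y i" for k
    unfolding mem_tau2 sigma2_def Let_def using assms by (auto split: if_splits)
  then show ?thesis by blast
qed

lemma Cyc2_eq:
  assumes "1 \<le> x" "x < y" "y \<le> n"
  shows "Cyc2 n x y = cycle_through (map (zeros_at (2 * x - y + 2 * n))
     ({x + n} # map (tau2 n x y) (rev [y - n..y - 1]) @ [{x}]))"
proof -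
  have "map (sigma2 n x y) (rev [1..y]) @ map (sigma2 n x y) (rev [y - n..-1]) =
      map (\<lambda>i. sigma2 n x y (if 0 \<le> i then i + 1 else i)) (rev [y - n..y - 1])"
    using map_skip_zero[of "y - n" y "sigma2 n x y"] assms by simp
  also have "\<dots> = map (tau2 n x y) (rev [y - n..y - 1])"
    by (rule map_cong) (use assms mem_sigma2_shift in auto)
  finally have "map (sigma2 n x y) (rev [1..y]) @ map (sigma2 n x y) (rev [y - n..-1]) @ [{x}] =
      map (tau2 n x y) (rev [y - n..y - 1]) @ [{x}]" by (metis append.assoc)
  then show ?thesis unfolding Cyc2_def by (simp only: append_Cons append_Nil)
qed

text \<open>
  The third condition on arrows concerns the edge between the vertex with zero set \<open>{x}\<close> and the
  neighbouring \<open>\<sigma>\<^sup>(\<^sup>y\<^sup>-\<^sup>n\<^sup>)\<close>, expressed by the arrows at \<open>\<delta>0\<close>. The steps between the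
  \<open>\<sigma>\<^sup>(\<^sup>i\<^sup>)\<close> follow from the runs of zeros.
\<close>

lemma linked_Cyc2:
  assumes re_s: "root_expression s" and g: "\<gamma> \<in> vertices s w"
    and D: "dihedral_reflection_subgroup form \<Delta> D" "finite D" "canonical_generators form \<Delta> D = {c, d}" "c \<noteq> d"
    and n: "card D div 2 = n" and x: "1 \<le> x" "x < y" "y \<le> n" and z: "z = 2 * x + 2 * n - y"
    and t: "t = alternating c d z" and \<delta>0: "\<delta>0 = zeros_at (int z) {int (x + n)}"
    and pm: "pm_eq (arr t \<delta>0 (x - 1)) (arr t \<delta>0 (x + n - 1))" "pm_eq (arr t \<delta>0 (y - 1)) (arr t \<delta>0 (z - 1))"
      "pm_eq (refl (arr t \<delta>0 (x - 1)) (arr t \<delta>0 (2 * x + n - y - 1))) (arr t \<delta>0 (z - 1))"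
    and pos: "arr t \<delta>0 (x + n - 1) \<in> Pos" "arr t \<delta>0 (z - 1) \<in> Pos"
    and mono: "strict_mono_on {..<z} p" and range: "\<And>i. i < z \<Longrightarrow> p i < length s"
    and matching: "\<And>i. i < z \<Longrightarrow> arr s \<gamma> (p i) = arr t \<delta>0 i"
  shows "linked s w \<gamma> {\<gamma>, flip2 (p (y - 1)) (p (z - 1)) \<gamma>} {\<gamma>, flip2 (p (x - 1)) (p (x + n - 1)) \<gamma>}"
proof -
  let ?X = "int x" and ?Y = "int y" and ?N = "int n" and ?Z = "int z"
  have Z: "?Z = 2 * ?X - ?Y + 2 * ?N" using z x by simp
  define f where "f = (\<lambda>i. zeros_at ?Z (tau2 ?N ?X ?Y i))"
  define ys where "ys = map f (rev [?Y - ?N..?Y - 1])"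
  define xs where "xs = ys @ [zeros_at ?Z {?X}]"
  have lt: "length t = z" by (simp add: t)
  have "{c, d} \<subseteq> T" using D(3) unfolding canonical_generators_def by blast
  then have re_t: "root_expression t"
    unfolding root_expression_def t using set_alternating[of c d z] by blast
  have S: "\<delta>0 \<in> Sub t" by (simp add: \<delta>0 Sub_def lt)
  have rev1: "rev [?Y - ?N..?Y - 1] = (?Y - 1) # rev [?Y - ?N..?Y - 2]" using x by (simp add: upto_rec2)
  have ys_ne: "ys \<noteq> []" by (simp add: ys_def rev1)
  have hdys: "hd ys = f (?Y - 1)" by (simp add: ys_def rev1)
  have lastys: "last ys = f (?Y - ?N)"
    using x by (simp add: ys_def last_map last_rev upto_rec1[of "?Y - ?N"])
  have hdxs: "hd xs = zeros_at ?Z (tau2 ?N ?X ?Y (?Y - 1))"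
    using ys_ne hdys by (simp add: xs_def f_def)
  have hdf: "hd xs = flip2 (y - 1) (z - 1) \<delta>0"
    unfolding hdxs \<delta>0
  proof (rule zeros_at_flip2)
    fix k assume "1 \<le> k" "k \<le> int z"
    then show "k \<in> tau2 ?N ?X ?Y (?Y - 1) \<longleftrightarrow> (k \<in> {int (x + n)}) \<noteq> (k = int (y - 1) + 1 \<or> k = int (z - 1) + 1)"
      unfolding mem_tau2 using x Z by auto
  qed (use x z in auto)
  have lastf: "last xs = flip2 (x - 1) (x + n - 1) \<delta>0"
    unfolding xs_def \<delta>0 by (simp, rule zeros_at_flip2) (use x in auto)
  have first: "small_step t \<delta>0 (hd xs)" unfolding hdf
    by (rule small_stepI) (use S x z pm lt in auto)
  have last0: "small_step t \<delta>0 (last xs)" unfolding lastf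
    by (rule small_stepI) (use S x z pm lt in auto)
  have joint: "small_step t (last xs) (f (?Y - ?N))"
  proof -
    let ?a = "2 * x + n - y - 1"
    have ax: "x - 1 < x + n - 1" "x + n - 1 < length t" using x z lt by auto
    note ar = arr_flip2[OF re_t S ax _ pm(1)]
    have "arr t (last xs) ?a = refl (arr t \<delta>0 (x - 1)) (arr t \<delta>0 ?a)"
      unfolding lastf using ar[of ?a] x z lt by auto
    moreover have "arr t (last xs) (z - 1) = arr t \<delta>0 (z - 1)"
      unfolding lastf using ar[of "z - 1"] x z lt by auto
    ultimately have "small_step t (last xs) (flip2 ?a (z - 1) (last xs))"
      using pm(3) S x z lt by (intro small_stepI) (auto simp: lastf)
    moreover have "last xs = zeros_at ?Z {?X}" by (simp add: xs_def)
    moreover have "f (?Y - ?N) = flip2 ?a (z - 1) (zeros_at ?Z {?X})"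
      unfolding f_def
    proof (rule zeros_at_flip2)
      fix k assume "1 \<le> k" "k \<le> int z"
      moreover have "int ?a + 1 = 2 * ?X - ?Y + ?N" using x by simp
      ultimately show "k \<in> tau2 ?N ?X ?Y (?Y - ?N) \<longleftrightarrow> (k \<in> {?X}) \<noteq> (k = int ?a + 1 \<or> k = int (z - 1) + 1)"
        unfolding mem_tau2 using x Z by auto
    qed (use x z in auto)
    ultimately show ?thesis by simp
  qed
  show ?thesis
  proof (rule linked_image_cycle[OF re_s g D t S _ _ _ _ _ hdf lastf _ _ _ _ mono range matching])
    have "cycle_through (\<delta>0 # xs) = Cyc2 ?N ?X ?Y"
      using Cyc2_eq[of ?X ?Y ?N] x unfolding \<delta>0 xs_def ys_def f_def Z[symmetric] by (simp add: comp_def)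
    then show "standard_cycle (int (card D div 2)) ?Z (cycle_through (\<delta>0 # xs))"
      unfolding standard_cycle_def n using x Z by (intro disjI2 exI[of _ ?X] exI[of _ ?Y]) simp
    have "distinct ys" unfolding ys_def
    proof (rule distinct_map_rev_upto)
      fix i j assume ij: "?Y - ?N \<le> j" "j < i" "i \<le> ?Y - 1"
      define k where "k = (if ?X \<le> j + 1 then j + 1 else if ?X < i + 1 then ?X else 2 * ?X - i)"
      show "f i \<noteq> f j" unfolding f_def
        by (rule zeros_at_ne[of k]) (use ij x Z in \<open>auto simp: mem_tau2 k_def\<close>)
    qed
    moreover have ne1: "zeros_at ?Z {?X} \<noteq> f i" if "?Y - ?N \<le> i" "i \<le> ?Y - 1" for i
      unfolding f_def by (rule zeros_at_ne[of ?Z]) (use that x Z in \<open>auto simp: mem_tau2\<close>)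
    moreover have ne2: "\<delta>0 \<noteq> f i" if "?Y - ?N \<le> i" "i \<le> ?Y - 1" for i
      unfolding f_def \<delta>0 by (rule zeros_at_ne[of ?Z]) (use that x Z in \<open>auto simp: mem_tau2\<close>)
    moreover have "\<delta>0 \<noteq> zeros_at ?Z {?X}"
      unfolding \<delta>0 by (rule zeros_at_ne[of ?X]) (use x Z in auto)
    moreover have "zeros_at ?Z {?X} \<notin> set ys" "\<delta>0 \<notin> set ys"
      unfolding ys_def set_map using ne1 ne2 by (fastforce simp del: One_nat_def)+
    ultimately show "distinct (\<delta>0 # xs)" by (simp add: xs_def)
    show "2 \<le> length xs" using ys_ne by (cases ys) (auto simp: xs_def)
    have mid: "successively (small_step t) ys" unfolding ys_def
    proof (rule successively_map_rev_upto)
      fix i assume i: "?Y - ?N < i" "i \<le> ?Y - 1"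
      define A where "A = (if ?X \<le> i then i else 2 * ?X - i)"
      define B where "B = (if 2 * ?Y - ?X - ?N \<le> i then 2 * ?Y - i else 2 * ?X - 2 * ?Y + 2 * ?N + i)"
      show "small_step t (f i) (f (i - 1))"
        unfolding f_def
      proof (rule small_step_zeros[OF t re_t, of A B])
        show "1 \<le> A" "A < B" "B \<le> ?Z" using i x Z by (auto simp: A_def B_def)
        show "even (B - A)" by (auto simp: A_def B_def)
        show "{A<..<B} \<subseteq> tau2 ?N ?X ?Y i"
          using i x Z by (auto simp: A_def B_def mem_tau2)
        fix k assume k: "1 \<le> k" "k \<le> ?Z"
        show "k \<in> tau2 ?N ?X ?Y (i - 1) \<longleftrightarrow> (k \<in> tau2 ?N ?X ?Y i) \<noteq> (k = A \<or> k = B)"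
          unfolding A_def B_def by (rule tau2_step) (use i x in auto)
      qed
    qed
    have j': "small_step t (last ys) (last xs)"
      unfolding lastys by (rule small_step_sym[OF re_t joint])
    have fin: "small_step t (last xs) \<delta>0" by (rule small_step_sym[OF re_t last0])
    show "successively (small_step t) (\<delta>0 # xs @ [\<delta>0])"
      using mid first fin j' ys_ne by (auto simp: successively_Cons successively_append_iff xs_def)
    show "\<exists>j. last_difference t \<delta>0 \<epsilon> j \<and> arr t \<delta>0 j \<in> Pos" if e: "\<epsilon> \<in> set xs" for \<epsilon>
    proof (cases "\<epsilon> = zeros_at ?Z {?X}")
      case True
      have "last_difference t (zeros_at (int (length t)) {int (x + n)}) (zeros_at (int (length t)) {?X}) (nat (?X + ?N - 1))"
        by (rule last_difference_zeros_at) (use x Z lt in auto)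
      moreover have "nat (?X + ?N - 1) = x + n - 1" using x by auto
      ultimately show ?thesis using pos True lt \<delta>0 by metis
    next
      case False
      then obtain i where i: "?Y - ?N \<le> i" "i \<le> ?Y - 1" "\<epsilon> = f i"
        using e by (auto simp: xs_def ys_def)
      have "last_difference t (zeros_at (int (length t)) {int (x + n)}) (zeros_at (int (length t)) (tau2 ?N ?X ?Y i)) (nat (?Z - 1))"
        by (rule last_difference_zeros_at) (use i x Z lt in \<open>auto simp: mem_tau2\<close>)
      moreover have "nat (?Z - 1) = z - 1" using x by auto
      ultimately show ?thesis using pos i lt \<delta>0 by (metis f_def)
    qed
  qed (use x z in auto)
qed

section \<open>Finite planes of roots\<close>

definition in_plane :: "'v \<Rightarrow> 'v \<Rightarrow> 'v \<Rightarrow> bool" where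
  "in_plane a b v \<longleftrightarrow> (\<exists>p q. v = p *\<^sub>R a + q *\<^sub>R b)"

definition in_cone :: "'v \<Rightarrow> 'v \<Rightarrow> 'v \<Rightarrow> bool" where
  "in_cone a b v \<longleftrightarrow> (\<exists>p q. 0 \<le> p \<and> 0 \<le> q \<and> v = p *\<^sub>R a + q *\<^sub>R b)"

lemma in_planeI: "v = p *\<^sub>R a + q *\<^sub>R b \<Longrightarrow> in_plane a b v"
  unfolding in_plane_def by blast

lemma in_coneI: "0 \<le> p \<Longrightarrow> 0 \<le> q \<Longrightarrow> v = p *\<^sub>R a + q *\<^sub>R b \<Longrightarrow> in_cone a b v"
  unfolding in_cone_def by blast

lemma in_cone_in_plane: "in_cone a b v \<Longrightarrow> in_plane a b v"
  unfolding in_cone_def in_plane_def by blast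

lemma in_plane_uminus [simp]: "in_plane a b (- v) \<longleftrightarrow> in_plane a b v"
proof -
  have "in_plane a b (- v)" if "in_plane a b v" for v
  proof -
    obtain p q where "v = p *\<^sub>R a + q *\<^sub>R b" using \<open>in_plane a b v\<close> unfolding in_plane_def by blast
    then show ?thesis by (intro in_planeI[of _ "- p" _ "- q"]) simp
  qed
  from this[of v] this[of "- v"] show ?thesis by auto
qed

lemma in_plane_base [simp]: "in_plane a b a" "in_plane a b b"
  by (rule in_planeI[of _ 1 _ 0], simp) (rule in_planeI[of _ 0 _ 1], simp)

lemma in_cone_base [simp]: "in_cone a b a" "in_cone a b b"
  by (rule in_coneI[of 1 0], simp_all) (rule in_coneI[of 0 1], simp_all)

lemma in_cone_commute: "in_cone a b v \<longleftrightarrow> in_cone b a v"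
  unfolding in_cone_def by (metis add.commute)

lemma in_plane_commute: "in_plane a b v \<longleftrightarrow> in_plane b a v"
  unfolding in_plane_def by (metis add.commute)

lemma in_cone_trans:
  assumes "in_cone a b c" "in_cone c b v" shows "in_cone a b v"
proof -
  obtain p q p' q' where pq: "0 \<le> p" "0 \<le> q" "c = p *\<^sub>R a + q *\<^sub>R b"
    and pq': "0 \<le> p'" "0 \<le> q'" "v = p' *\<^sub>R c + q' *\<^sub>R b"
    using assms unfolding in_cone_def by blast
  have "v = (p' * p) *\<^sub>R a + (p' * q + q') *\<^sub>R b"
    unfolding pq'(3) pq(3) by (simp add: algebra_simps)
  then show ?thesis using pq pq' by (intro in_coneI[of "p' * p" "p' * q + q'"]) auto
qed

lemma Pos_independent:
  assumes "c \<in> Pos" "d \<in> Pos" "c \<noteq> d" "p *\<^sub>R c + q *\<^sub>R d = 0"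
  shows "p = 0" "q = 0"
proof -
  have *: "q = 0" if cd: "c \<in> Pos" "d \<in> Pos" "c \<noteq> d" and e: "p *\<^sub>R c + q *\<^sub>R d = 0" for c d p q
  proof (rule ccontr)
    assume q: "q \<noteq> 0"
    have "d = (1 / q) *\<^sub>R (q *\<^sub>R d)" using q by simp
    also have "q *\<^sub>R d = - (p *\<^sub>R c)" using e by (metis add_eq_0_iff)
    finally have "d = (- p / q) *\<^sub>R c" by simp
    then obtain r where d: "d = r *\<^sub>R c" by blast
    have "form d d = form (r *\<^sub>R c) (r *\<^sub>R c)" by (rule arg_cong2[OF d d])
    then have "r * r = 1" using Pos_unit cd by simp
    then have "r = 1 \<or> r = -1" by (simp only: square_eq_1_iff)
    then have "d = c \<or> d = - c" using d by (metis scaleR_minus1_left scaleR_one)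
    then show False using cd not_Pos_both by auto
  qed
  show "q = 0" by (rule *[OF assms])
  show "p = 0" by (rule *[of d c q p]) (use assms in \<open>auto simp: add.commute\<close>)
qed

lemma Pos_coefficients_unique:
  assumes "c \<in> Pos" "d \<in> Pos" "c \<noteq> d" "p *\<^sub>R c + q *\<^sub>R d = p' *\<^sub>R c + q' *\<^sub>R d"
  shows "p = p'" "q = q'"
proof -
  have "(p - p') *\<^sub>R c + (q - q') *\<^sub>R d = 0" using assms(4) by (simp add: algebra_simps)
  then show "p = p'" "q = q'" using Pos_independent[OF assms(1-3), of "p - p'" "q - q'"] by auto
qed

lemma plane_change_basis:
  assumes "a \<in> Pos" "b \<in> Pos" "a \<noteq> b" "c \<in> Pos" "d \<in> Pos" "c \<noteq> d"
    and "in_plane a b c" "in_plane a b d" "in_plane a b v"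
  shows "in_plane c d v"
proof -
  obtain p1 q1 where c: "c = p1 *\<^sub>R a + q1 *\<^sub>R b" using assms(7) unfolding in_plane_def by blast
  obtain p2 q2 where d: "d = p2 *\<^sub>R a + q2 *\<^sub>R b" using assms(8) unfolding in_plane_def by blast
  obtain p q where v: "v = p *\<^sub>R a + q *\<^sub>R b" using assms(9) unfolding in_plane_def by blast
  define D where "D = p1 * q2 - p2 * q1"
  have A: "q2 *\<^sub>R c + (- q1) *\<^sub>R d = D *\<^sub>R a" unfolding c d D_def by (simp add: algebra_simps)
  have B: "(- p2) *\<^sub>R c + p1 *\<^sub>R d = D *\<^sub>R b" unfolding c d D_def by (simp add: algebra_simps)
  have D: "D \<noteq> 0"
  proof
    assume "D = 0"
    then have "q1 = 0" "p1 = 0"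
      using A B Pos_independent(2)[OF assms(4-6), of q2 "- q1"] Pos_independent(2)[OF assms(4-6), of "- p2" p1]
      by auto
    then have "c = 0" using c by simp
    then show False using Pos_unit[OF assms(4)] by simp
  qed
  have "a = (1 / D) *\<^sub>R (D *\<^sub>R a)" "b = (1 / D) *\<^sub>R (D *\<^sub>R b)" using D by simp_all
  then have "a = (1 / D) *\<^sub>R (q2 *\<^sub>R c + (- q1) *\<^sub>R d)" "b = (1 / D) *\<^sub>R ((- p2) *\<^sub>R c + p1 *\<^sub>R d)"
    unfolding A B .
  then have "v = p *\<^sub>R (1 / D) *\<^sub>R (q2 *\<^sub>R c + (- q1) *\<^sub>R d) + q *\<^sub>R (1 / D) *\<^sub>R ((- p2) *\<^sub>R c + p1 *\<^sub>R d)"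
    using v by simp
  also have "\<dots> = (p * (1 / D) * q2 - q * (1 / D) * p2) *\<^sub>R c + (q * (1 / D) * p1 - p * (1 / D) * q1) *\<^sub>R d"
    by (simp add: scaleR_add_right scaleR_diff_left scaleR_add_left scaleR_diff_right mult.assoc)
  finally show ?thesis by (rule in_planeI)
qed

text \<open>
  The signs of the coefficients of \<open>v\<close> decide between the three cases; they cannot both be
  nonpositive, as \<open>v\<close> would be negative.
\<close>

lemma three_in_plane:
  assumes "a \<in> Pos" "b \<in> Pos" "v \<in> Pos" "in_plane a b v"
  shows "in_cone a b v \<or> in_cone v b a \<or> in_cone a v b"
proof -
  obtain p q where v: "v = p *\<^sub>R a + q *\<^sub>R b" using assms(4) unfolding in_plane_def by blast
  consider "0 \<le> p" "0 \<le> q" | "0 < p" "q < 0" | "p < 0" "0 < q" | "p \<le> 0" "q \<le> 0" by linarith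
  then show ?thesis
  proof cases
    case 1
    then show ?thesis using v in_coneI by blast
  next
    case 2
    have "(1 / p) *\<^sub>R v = a + (q / p) *\<^sub>R b" using 2 by (simp add: v scaleR_add_right)
    then have "a = (1 / p) *\<^sub>R v + (- q / p) *\<^sub>R b" by (simp add: algebra_simps)
    moreover have "0 \<le> 1 / p" "0 \<le> - q / p" using 2 by (auto simp: divide_le_0_iff)
    ultimately show ?thesis using in_coneI by metis
  next
    case 3
    have "(1 / q) *\<^sub>R v = (p / q) *\<^sub>R a + b" using 3 by (simp add: v scaleR_add_right)
    then have "b = (- p / q) *\<^sub>R a + (1 / q) *\<^sub>R v" by (simp add: algebra_simps)
    moreover have "0 \<le> 1 / q" "0 \<le> - p / q" using 3 by (auto simp: divide_le_0_iff)
    ultimately show ?thesis using in_coneI by metis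
  next
    case 4
    have "- v = (- p) *\<^sub>R a + (- q) *\<^sub>R b" by (simp add: v)
    moreover have "nonneg ((- p) *\<^sub>R a + (- q) *\<^sub>R b)"
      by (intro nonneg_add nonneg_scale) (use 4 assms in \<open>auto simp: Pos_iff\<close>)
    ultimately have "nonneg (- v)" by metis
    then have "v = 0" using assms(3) nonneg_antisym by (simp add: Pos_iff)
    then show ?thesis using Pos_unit[OF assms(3)] by simp
  qed
qed

text \<open>
  A cone that contains as many of the roots as possible contains them all: a root outside could
  replace one of the two that span it, and would enlarge the cone.
\<close>

lemma extreme_roots:
  assumes ab: "a \<in> Pos" "b \<in> Pos" "a \<noteq> b" and fin: "finite {v \<in> Pos. in_plane a b v}"
  obtains c d where "c \<in> Pos" "d \<in> Pos" "c \<noteq> d" "in_plane a b c" "in_plane a b d"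
    "\<And>v. v \<in> Pos \<Longrightarrow> in_plane a b v \<Longrightarrow> in_cone c d v"
proof -
  define R where "R = {v \<in> Pos. in_plane a b v}"
  define m where "m = (\<lambda>(c, d). card {v \<in> R. in_cone c d v})"
  define X where "X = {(c, d). c \<in> R \<and> d \<in> R \<and> c \<noteq> d}"
  have finR: "finite R" using fin by (simp add: R_def)
  have "X \<subseteq> R \<times> R" by (auto simp: X_def)
  then have finX: "finite X" using finR finite_subset by blast
  have "(a, b) \<in> X" using ab by (simp add: X_def R_def)
  then have "m ` X \<noteq> {}" by blast
  then have "Max (m ` X) \<in> m ` X" using finX by (intro Max_in) auto
  then obtain cd where cd0: "cd \<in> X" "m cd = Max (m ` X)" by force
  have cd: "cd \<in> X" "m cd' \<le> m cd" if "cd' \<in> X" for cd'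
    using cd0 finX that by auto
  obtain c d where cd_eq: "cd = (c, d)" by (cases cd)
  have c: "c \<in> R" "d \<in> R" "c \<noteq> d" using cd0 cd_eq by (auto simp: X_def)
  have grow: False
    if "c' \<in> R" "d' \<in> R" "c' \<noteq> d'" "\<And>u. in_cone c d u \<Longrightarrow> in_cone c' d' u"
      "v \<in> R" "in_cone c' d' v" "\<not> in_cone c d v" for c' d' v
  proof -
    have "{v \<in> R. in_cone c d v} \<subset> {v \<in> R. in_cone c' d' v}" using that by blast
    then have "m (c, d) < m (c', d')" unfolding m_def using finR by (simp add: psubset_card_mono)
    moreover have "m (c', d') \<le> m (c, d)" using cd(2)[of "(c', d')"] that cd_eq by (simp add: X_def)
    ultimately show False by simp
  qed
  have "in_cone c d v" if v: "v \<in> R" for v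
  proof (rule ccontr)
    assume nv: "\<not> in_cone c d v"
    have "in_plane c d v"
      by (rule plane_change_basis[OF ab]) (use c v in \<open>auto simp: R_def\<close>)
    then have "in_cone v d c \<or> in_cone c v d"
      using three_in_plane[of c d v] c v nv by (auto simp: R_def)
    then show False
    proof
      assume h: "in_cone v d c"
      show False
        by (rule grow[of v d v]) (use c v nv in_cone_trans[OF h] in auto)
    next
      assume h: "in_cone c v d"
      have "in_cone c v u" if "in_cone c d u" for u
        using in_cone_trans[of v c d u] h that by (simp add: in_cone_commute)
      then show False
        by (intro grow[of c v v]) (use c v nv in auto)
    qed
  qed
  then show ?thesis using that[of c d] c by (auto simp: R_def)
qed

text \<open>
  A fan consists of all positive roots in a plane: \<open>n\<close> unit vectors at successive angles
  \<open>pi / n\<close>, starting with \<open>c\<close> and ending with \<open>d\<close>.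
\<close>

definition fan :: "real \<Rightarrow> nat \<Rightarrow> 'v \<Rightarrow> 'v \<Rightarrow> bool" where
  "fan \<theta> n c d \<longleftrightarrow> c \<in> Pos \<and> d \<in> Pos \<and> c \<noteq> d \<and> 2 \<le> n \<and> real n * \<theta> = pi \<and> form c d = - cos \<theta> \<and>
     (\<forall>v\<in>Pos. in_plane c d v \<longrightarrow> (\<exists>m\<in>{1..int n}. v = rho \<theta> c d (real_of_int m)))"

text \<open>
  With angles measured from \<open>- d\<close> in multiples of \<open>\<theta>\<close>, reflecting in the vector at \<open>a\<close> takes the
  angle \<open>b\<close> to \<open>2 * a - b\<close> followed by a half turn.
\<close>

lemma refl_rho:
  assumes unit: "form c c = 1" "form d d = 1" and cd: "form c d = - cos \<theta>" and s: "sin \<theta> \<noteq> 0"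
  shows form_rho: "form (rho \<theta> c d a) (rho \<theta> c d b) = cos ((a - b) * \<theta>)"
    and "refl (rho \<theta> c d a) (rho \<theta> c d b) = - rho \<theta> c d (2 * a - b)"
proof -
  have f: "form (rho \<theta> c d a) (rho \<theta> c d b) = cos ((a - b) * \<theta>)" for a b
  proof -
    have dc: "form d c = - cos \<theta>" using cd form_sym by metis
    define A B where "A = a * \<theta>" and "B = b * \<theta>"
    have e: "sin ((a - 1) * \<theta>) = sin A * cos \<theta> - cos A * sin \<theta>" "sin ((b - 1) * \<theta>) = sin B * cos \<theta> - cos B * sin \<theta>"
      "cos ((a - b) * \<theta>) = cos A * cos B + sin A * sin B"
      by (simp_all add: A_def B_def left_diff_distrib sin_diff cos_diff)
    have "form (rho \<theta> c d a) (rho \<theta> c d b) * (sin \<theta>)\<^sup>2 =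
        sin A * sin B + sin ((a - 1) * \<theta>) * sin ((b - 1) * \<theta>)
        - cos \<theta> * (sin A * sin ((b - 1) * \<theta>) + sin ((a - 1) * \<theta>) * sin B)"
      unfolding rho_def A_def B_def using s
      by (simp add: unit cd dc power2_eq_square field_simps)
    also have "\<dots> = (sin A * sin B) * (1 - (cos \<theta>)\<^sup>2) + (sin \<theta>)\<^sup>2 * (cos A * cos B)"
      unfolding e by (simp add: algebra_simps power2_eq_square)
    also have "\<dots> = cos ((a - b) * \<theta>) * (sin \<theta>)\<^sup>2"
      unfolding e sin_squared_eq by (simp add: algebra_simps)
    finally show ?thesis using s by simp
  qed
  show "form (rho \<theta> c d a) (rho \<theta> c d b) = cos ((a - b) * \<theta>)" by (rule f)
  have id: "sin (x * \<theta>) - 2 * cos ((b - a) * \<theta>) * sin (y * \<theta>) = - sin ((2 * y - x) * \<theta>)" if "x - y = b - a" for x y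
  proof -
    have "(b - a) * \<theta> = x * \<theta> - y * \<theta>" using that by (simp add: left_diff_distrib[symmetric])
    moreover have "sin ((2 * y - x) * \<theta>) = sin (y * \<theta> - (x * \<theta> - y * \<theta>))" by (simp add: algebra_simps)
    moreover have "sin (x * \<theta>) = sin (y * \<theta> + (x * \<theta> - y * \<theta>))" by simp
    ultimately show ?thesis by (simp only: sin_add sin_diff[of "y * \<theta>" "x * \<theta> - y * \<theta>"]) simp
  qed
  have "refl (rho \<theta> c d a) (rho \<theta> c d b) = rho \<theta> c d b - (2 * cos ((b - a) * \<theta>)) *\<^sub>R rho \<theta> c d a"
    unfolding reflection_def f by simp
  also have "\<dots> = ((sin (b * \<theta>) - 2 * cos ((b - a) * \<theta>) * sin (a * \<theta>)) / sin \<theta>) *\<^sub>R c +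
      ((sin ((b - 1) * \<theta>) - 2 * cos ((b - a) * \<theta>) * sin ((a - 1) * \<theta>)) / sin \<theta>) *\<^sub>R d"
    unfolding rho_def by (simp add: scaleR_diff_left scaleR_add_right diff_divide_distrib)
  also have "\<dots> = - rho \<theta> c d (2 * a - b)"
  proof -
    have e: "2 * (a - 1) - (b - 1) = 2 * a - b - 1" "b - 1 - (a - 1) = b - a" by simp_all
    show ?thesis
      unfolding id[of b a, OF refl] id[of "b - 1" "a - 1", OF e(2), unfolded e(1)] rho_def by simp
  qed
  finally show "refl (rho \<theta> c d a) (rho \<theta> c d b) = - rho \<theta> c d (2 * a - b)" .
qed

lemma rho_swap:
  assumes "real n * \<theta> = pi"
  shows "rho \<theta> d c t = rho \<theta> c d (real n + 1 - t)"
proof -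
  have "(real n + 1 - t) * \<theta> = pi - (t - 1) * \<theta>" "(real n + 1 - t - 1) * \<theta> = pi - t * \<theta>"
    using assms by (simp_all add: algebra_simps)
  then show ?thesis unfolding rho_def by (simp add: add.commute)
qed

lemma rho_in_plane: "in_plane c d (rho \<theta> c d t)"
  unfolding rho_def by (rule in_planeI) (rule refl)

lemma fan_swap: "fan \<theta> n c d \<Longrightarrow> fan \<theta> n d c"
proof -
  assume f: "fan \<theta> n c d"
  have n: "real n * \<theta> = pi" using f by (simp add: fan_def)
  have "\<exists>m\<in>{1..int n}. v = rho \<theta> d c (real_of_int m)" if v: "v \<in> Pos" "in_plane d c v" for v
  proof -
    obtain m where m: "m \<in> {1..int n}" "v = rho \<theta> c d (real_of_int m)"
      using f v in_plane_commute by (auto simp: fan_def)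
    have "v = rho \<theta> d c (real_of_int (int n + 1 - m))"
      using m rho_swap[OF n, of d c "real_of_int (int n + 1 - m)"] by simp
    then show ?thesis using m by (intro bexI[of _ "int n + 1 - m"]) auto
  qed
  then show ?thesis using f form_sym by (auto simp: fan_def)
qed

text \<open>
  If the inner product of \<open>c\<close> and \<open>d\<close> were at most \<open>-1\<close>, alternating products would produce infinitely
  many roots. So it is \<open>- cos \<theta>\<close>, and alternating products produce the roots at all multiples of \<open>\<theta>\<close>.
  No root lies strictly between \<open>- d\<close> and \<open>c\<close>, or between \<open>d\<close> and \<open>- c\<close>, because it would lie neither in
  the cone nor in its negative. Hence \<open>\<pi>\<close> is a multiple of \<open>\<theta>\<close>, and there is no root at an angle that is
  not a multiple of \<open>\<theta>\<close>: reflections in the roots at multiples of \<open>\<theta>\<close> would carry it into the gap.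
\<close>

lemma finite_plane_fan:
  assumes c: "c \<in> Pos" "d \<in> Pos" "c \<noteq> d" and fin: "finite {v \<in> Pos. in_plane c d v}"
    and cone: "\<And>v. v \<in> Pos \<Longrightarrow> in_plane c d v \<Longrightarrow> in_cone c d v"
  obtains \<theta> n where "fan \<theta> n c d"
proof -
  have unit: "form c c = 1" "form d d = 1" using c Pos_unit by auto
  have cone': "in_cone c d v \<or> in_cone c d (- v)" if "v \<in> \<Phi>" "in_plane c d v" for v
    using \<Phi>_cases[OF that(1)] cone that by auto
  have coef: "0 \<le> p \<and> 0 \<le> q \<or> p \<le> 0 \<and> q \<le> 0" if v: "p *\<^sub>R c + q *\<^sub>R d \<in> \<Phi>" for p q
  proof -
    have "in_plane c d (p *\<^sub>R c + q *\<^sub>R d)" by (rule in_planeI) (rule refl)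
    from cone'[OF v this] show ?thesis
    proof
      assume "in_cone c d (p *\<^sub>R c + q *\<^sub>R d)"
      then obtain p' q' where "0 \<le> p'" "0 \<le> q'" "p *\<^sub>R c + q *\<^sub>R d = p' *\<^sub>R c + q' *\<^sub>R d" unfolding in_cone_def by blast
      then show ?thesis using Pos_coefficients_unique[OF c] by metis
    next
      assume "in_cone c d (- (p *\<^sub>R c + q *\<^sub>R d))"
      then obtain p' q' where pq: "0 \<le> p'" "0 \<le> q'" "- (p *\<^sub>R c + q *\<^sub>R d) = p' *\<^sub>R c + q' *\<^sub>R d" unfolding in_cone_def by blast
      then have "(- p) *\<^sub>R c + (- q) *\<^sub>R d = p' *\<^sub>R c + q' *\<^sub>R d" by simp
      then have "- p = p'" "- q = q'" using Pos_coefficients_unique[OF c] by blast+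
      then show ?thesis using pq by auto
    qed
  qed
  have W: "refl c \<in> W" "refl d \<in> W" using c by (auto simp: Pos_iff refl_W)
  have alt_W: "word_prod (alternating (refl c) (refl d) k) \<in> W" for k
  proof (induction k)
    case 0
    show ?case unfolding alternating_0 word_prod_Nil by (rule W_id)
  next
    case (Suc k)
    have "word_prod (alternating (refl c) (refl d) (Suc k)) =
        word_prod (alternating (refl c) (refl d) k) \<circ> (if even k then refl c else refl d)"
      by (simp only: alternating_Suc word_prod_append word_prod_Cons word_prod_Nil comp_id)
    then show ?case using Suc W W_comp by metis
  qed
  define k where "k = - form c d"
  have cdk: "form c d = - k" "form d c = - k" using form_sym[of c d] by (auto simp: k_def)
  have "refl c d = (2 * k) *\<^sub>R c + 1 *\<^sub>R d" by (simp add: reflection_def cdk algebra_simps)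
  moreover have "refl c d \<in> \<Phi>" using W c by (simp add: Pos_iff W_\<Phi>)
  ultimately have k0: "0 \<le> k" using coef[of "2 * k" 1] by simp
  have k1: "k < 1"
  proof (rule ccontr)
    assume "\<not> k < 1"
    then have k: "1 \<le> k" by simp
    define v where "v = (\<lambda>m. cheb k (Suc m) *\<^sub>R c + cheb k m *\<^sub>R d)"
    have "v m \<in> {v \<in> Pos. in_plane c d v}" for m
    proof -
      have "v m = word_prod (alternating (refl c) (refl d) m) (if even m then c else d)"
        using alternating_cheb[OF unit cdk(1)] by (simp add: v_def)
      then have "v m \<in> \<Phi>" using alt_W c by (simp add: Pos_iff W_\<Phi>)
      moreover have "nonneg (v m)"
        unfolding v_def using cheb_grows[OF k, of m] cheb_grows[OF k, of "Suc m"] c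
        by (auto simp: Pos_iff intro!: nonneg_add nonneg_scale)
      ultimately show ?thesis unfolding v_def by (auto simp: Pos_iff intro: in_planeI)
    qed
    moreover have "inj v"
    proof (rule injI)
      fix m m' assume "v m = v m'"
      then have "cheb k m = cheb k m'" unfolding v_def using Pos_coefficients_unique(2)[OF c] by blast
      moreover have "strict_mono (cheb k)"
        unfolding strict_mono_Suc_iff using cheb_grows[OF k] by (metis add_strict_increasing less_add_one less_le_trans)
      ultimately show "m = m'" by (metis strict_mono_eq)
    qed
    ultimately have "infinite {v \<in> Pos. in_plane c d v}"
      by (metis (no_types, lifting) finite_imageD finite_subset image_subsetI infinite_UNIV_nat)
    then show False using fin by blast
  qed
  define \<theta> where "\<theta> = arccos k"
  have th: "0 < \<theta>" "\<theta> \<le> pi / 2" "cos \<theta> = k"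
    using k0 k1 arccos_lt_bounded[of k] arccos_le_pi2[of k] by (auto simp: \<theta>_def)
  have s: "sin \<theta> > 0" using th pi_gt_zero by (intro sin_gt_zero) linarith+
  have cdth: "form c d = - cos \<theta>" using cdk th by simp
  \<comment> \<open>The first multiple of \<open>\<theta>\<close> that reaches \<open>\<pi>\<close> turns out not to exceed it.\<close>
  define n where "n = nat \<lceil>pi / \<theta>\<rceil>"
  have "2 \<le> pi / \<theta>" using th by (simp add: field_simps)
  then have n2: "2 \<le> n" by (simp add: n_def le_nat_iff le_ceiling_iff)
  have "real n = real_of_int \<lceil>pi / \<theta>\<rceil>" using \<open>2 \<le> pi / \<theta>\<close> by (simp add: n_def)
  then have "pi / \<theta> \<le> real n" "real n - 1 < pi / \<theta>" by linarith+
  then have nth: "pi \<le> real n * \<theta>" "(real n - 1) * \<theta> < pi" using th by (simp_all add: field_simps)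
  have rho_\<Phi>: "rho \<theta> c d (real m + 1) \<in> \<Phi>" for m
    using alternating_rho(1)[OF unit cdth, of m] s alt_W[of m] c W_\<Phi>[of "word_prod (alternating (refl c) (refl d) m)"]
    by (metis Pos_iff less_irrefl)
  have "real (n - 1) + 1 = real n" using n2 by simp
  then have "rho \<theta> c d (real n) \<in> \<Phi>" using rho_\<Phi>[of "n - 1"] by simp
  then have "0 \<le> sin (real n * \<theta>) / sin \<theta> \<and> 0 \<le> sin ((real n - 1) * \<theta>) / sin \<theta> \<or>
      sin (real n * \<theta>) / sin \<theta> \<le> 0 \<and> sin ((real n - 1) * \<theta>) / sin \<theta> \<le> 0"
    using coef unfolding rho_def by blast
  moreover have "0 < sin ((real n - 1) * \<theta>)"
    using n2 th nth by (intro sin_gt_zero mult_pos_pos) auto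
  ultimately have sn: "0 \<le> sin (real n * \<theta>)" using s by (auto simp: field_simps)
  have nth': "real n * \<theta> = pi"
  proof (rule ccontr)
    assume "real n * \<theta> \<noteq> pi"
    then have "pi < real n * \<theta>" using nth by simp
    moreover have "real n * \<theta> < 2 * pi" using nth th pi_gt_zero by (simp add: algebra_simps)
    ultimately have "sin (real n * \<theta>) < 0" by (rule sin_lt_zero)
    then show False using sn by simp
  qed
  have s0: "sin \<theta> \<noteq> 0" using s by simp
  note rr = refl_rho[OF unit cdth s0]
  have all: "\<exists>m\<in>{1..int n}. v = rho \<theta> c d (real_of_int m)" if v: "v \<in> Pos" "in_plane c d v" for v
  proof -
    obtain p q where pq: "0 \<le> p" "0 \<le> q" "v = p *\<^sub>R c + q *\<^sub>R d"
      using cone[OF v] unfolding in_cone_def by blast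
    have "form v v = p * p + q * q - 2 * k * p * q"
      unfolding pq(3) by (simp add: unit cdk algebra_simps)
    then have 1: "p * p + q * q - 2 * k * p * q = 1" using Pos_unit v by simp
    have "(p - q * k)\<^sup>2 + (q * sin \<theta>)\<^sup>2 = p * p - 2 * k * p * q + q * q * (k\<^sup>2 + (sin \<theta>)\<^sup>2)"
      by (simp add: algebra_simps power2_eq_square)
    also have "k\<^sup>2 + (sin \<theta>)\<^sup>2 = 1" using sin_cos_squared_add2[of \<theta>] th(3) by simp
    finally have "(p - q * k)\<^sup>2 + (q * sin \<theta>)\<^sup>2 = 1" using 1 by (simp add: algebra_simps)
    then have "\<exists>\<phi>. 0 \<le> \<phi> \<and> \<phi> < 2 * pi \<and> p - q * k = cos \<phi> \<and> q * sin \<theta> = sin \<phi>"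
      by (metis sincos_total_2pi)
    then obtain \<phi> where \<phi>: "0 \<le> \<phi>" "\<phi> < 2 * pi" "p - q * k = cos \<phi>" "q * sin \<theta> = sin \<phi>"
      by blast
    have "0 \<le> sin \<phi>" using pq s \<phi>(4)[symmetric] by simp
    then have \<phi>pi: "\<phi> \<le> pi" using \<phi>(2) sin_lt_zero[of \<phi>] by linarith
    define t where "t = 1 + \<phi> / \<theta>"
    have tth: "(t - 1) * \<theta> = \<phi>" "t * \<theta> = \<theta> + \<phi>" using th by (simp_all add: t_def field_simps)
    have "sin (\<theta> + \<phi>) = sin \<theta> * p"
      unfolding sin_add \<phi>(3,4)[symmetric] th(3) by (simp add: algebra_simps)
    then have vt: "v = rho \<theta> c d t"
      unfolding rho_def tth pq(3) using \<phi>(4)[symmetric] s by simp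
    have t1: "1 \<le> t" using \<phi> th by (simp add: t_def)
    have sp: "0 \<le> sin (\<theta> + \<phi>)" using \<open>sin (\<theta> + \<phi>) = sin \<theta> * p\<close> s pq by simp
    have "\<theta> + \<phi> \<le> pi"
    proof (rule ccontr)
      assume "\<not> ?thesis"
      moreover have "\<theta> + \<phi> < 2 * pi" using th \<phi>pi pi_gt_zero by linarith
      ultimately have "sin (\<theta> + \<phi>) < 0" by (intro sin_lt_zero) auto
      then show False using sp by simp
    qed
    then have "t * \<theta> \<le> real n * \<theta>" using tth nth' by simp
    then have tn: "t \<le> real n" using th by simp
    define m where "m = \<lfloor>t\<rfloor>"
    have m: "1 \<le> m" "m \<le> int n" "real_of_int m \<le> t" "t < real_of_int m + 1"
      using t1 tn by (simp_all add: m_def le_floor_iff floor_le_iff)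
    \<comment> \<open>The gap between \<open>- d\<close> and \<open>c\<close>.\<close>
    have small: False if "rho \<theta> c d x \<in> \<Phi>" "0 < x" "x < 1" for x
    proof -
      have bound: "0 < y * \<theta>" "y * \<theta> < pi" if y: "0 < y" "y < 1" for y
      proof -
        show "0 < y * \<theta>" using y th by simp
        have "y * \<theta> < 1 * \<theta>" using y th by (intro mult_strict_right_mono) auto
        then show "y * \<theta> < pi" using th pi_gt_zero by linarith
      qed
      have "0 < x * \<theta>" "x * \<theta> < pi" using bound that by auto
      then have "0 < sin (x * \<theta>)" by (rule sin_gt_zero)
      moreover have "0 < (1 - x) * \<theta>" "(1 - x) * \<theta> < pi" using bound[of "1 - x"] that by auto
      then have "0 < sin ((1 - x) * \<theta>)" by (rule sin_gt_zero)
      then have "sin ((x - 1) * \<theta>) < 0" by (metis minus_diff_eq minus_mult_left neg_less_0_iff_less sin_minus)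
      ultimately show False using coef[of "sin (x * \<theta>) / sin \<theta>" "sin ((x - 1) * \<theta>) / sin \<theta>"] that(1) s
        unfolding rho_def by (auto simp: zero_le_divide_iff divide_le_0_iff)
    qed
    have nat_\<Phi>: "rho \<theta> c d (real a) \<in> \<Phi>" for a
    proof (cases a)
      case 0
      then show ?thesis using rho_0[OF s0, of c d] c by (simp add: Pos_iff \<Phi>_uminus)
    next
      case (Suc b)
      then show ?thesis using rho_\<Phi>[of b] by (simp add: add.commute)
    qed
    have refl_\<Phi>: "rho \<theta> c d (2 * real a - x) \<in> \<Phi>" if "rho \<theta> c d x \<in> \<Phi>" for a x
    proof -
      have "refl (rho \<theta> c d (real a)) (rho \<theta> c d x) \<in> \<Phi>" using nat_\<Phi> that by (simp add: W_\<Phi> refl_W)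
      then show ?thesis using rr(2)[of "real a" x] \<Phi>_uminus by (metis minus_minus)
    qed
    have vt\<Phi>: "rho \<theta> c d t \<in> \<Phi>" using v vt by (simp add: Pos_iff)
    have "t = real_of_int m"
    proof (rule ccontr)
      assume ne: "t \<noteq> real_of_int m"
      show False
      \<comment> \<open>The index \<open>t\<close> lies between \<open>m\<close> and \<open>m + 1\<close>. If \<open>m\<close> is even, two reflections shift it by \<open>- m\<close>; if
        \<open>m\<close> is odd, one reflection takes it to \<open>m + 1 - t\<close>.\<close>
      proof (cases "even m")
        case True
        then obtain a where a: "m = 2 * a" by (rule evenE)
        then have "rho \<theta> c d (2 * real (nat a) - t) \<in> \<Phi>" using refl_\<Phi>[OF vt\<Phi>] by blast
        from refl_\<Phi>[OF this, of 0] have "rho \<theta> c d (t - real_of_int m) \<in> \<Phi>" using a m by simp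
        then show False by (rule small) (use m ne in auto)
      next
        case False
        then have "even (m + 1)" by simp
        then obtain a where a: "m + 1 = 2 * a" by (rule evenE)
        then have "2 * real (nat a) = real_of_int (m + 1)" using m by linarith
        then have "rho \<theta> c d (real_of_int m + 1 - t) \<in> \<Phi>" using refl_\<Phi>[OF vt\<Phi>, of "nat a"] by simp
        then show False by (rule small) (use m ne in auto)
      qed
    qed
    then show ?thesis using m vt by (intro bexI[of _ m]) auto
  qed
  have "fan \<theta> n c d" unfolding fan_def using c n2 nth' cdth all by blast
  then show ?thesis by (rule that)
qed

section \<open>The dihedral group of a fan\<close>

definition ray :: "real \<Rightarrow> 'v \<Rightarrow> 'v \<Rightarrow> int \<Rightarrow> 'v" where
  "ray \<theta> c d m = rho \<theta> c d (real_of_int m)"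

context
  fixes \<theta> :: real and n :: nat and c d :: 'v
  assumes fan: "fan \<theta> n c d"
begin

abbreviation \<rho> where "\<rho> \<equiv> ray \<theta> c d"

lemma fan_simps: "c \<in> Pos" "d \<in> Pos" "c \<noteq> d" "2 \<le> n" "real n * \<theta> = pi" "form c d = - cos \<theta>"
  "form c c = 1" "form d d = 1"
  using fan Pos_unit by (auto simp: fan_def)

lemma theta_bounds: "0 < \<theta>" "\<theta> \<le> pi / 2"
proof -
  have "0 < real n * \<theta>" using fan_simps(5) pi_gt_zero by simp
  then show pos: "0 < \<theta>" by (rule zero_less_mult_pos) (use fan_simps(4) in auto)
  have "2 * \<theta> \<le> real n * \<theta>" using fan_simps(4) pos by (intro mult_right_mono) auto
  then show "\<theta> \<le> pi / 2" using fan_simps(5) by simp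
qed

lemma sin_theta_pos: "0 < sin \<theta>"
  using theta_bounds pi_gt_zero by (intro sin_gt_zero) linarith+

lemma ray_form: "form (\<rho> a) (\<rho> b) = cos (real_of_int (a - b) * \<theta>)"
  unfolding ray_def using form_rho[of c d \<theta>] fan_simps sin_theta_pos by simp

lemma ray_refl: "refl (\<rho> a) (\<rho> b) = - \<rho> (2 * a - b)"
  unfolding ray_def using refl_rho(2)[of c d \<theta>] fan_simps sin_theta_pos by simp

lemma ray_unit [simp]: "form (\<rho> a) (\<rho> a) = 1"
  by (simp add: ray_form)

lemma ray_period: "\<rho> (m + int n) = - \<rho> m"
  unfolding ray_def using rho_antiperiodic[OF fan_simps(5), of c d "real_of_int m"] by simp

lemma ray_period_minus: "\<rho> (m - int n) = - \<rho> m"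
  using ray_period[of "m - int n"] by simp

lemma ray_1: "\<rho> 1 = c" and ray_n: "\<rho> (int n) = d"
  using rho_0[of \<theta> c d] rho_1[of \<theta> c d] sin_theta_pos ray_period[of 0] by (auto simp: ray_def)

lemma ray_in_plane: "in_plane c d (\<rho> m)"
  unfolding ray_def by (rule rho_in_plane)

lemma alternating_refl_W: "word_prod (alternating (refl c) (refl d) k) \<in> W"
proof (induction k)
  case 0
  show ?case unfolding alternating_0 word_prod_Nil by (rule W_id)
next
  case (Suc k)
  have "word_prod (alternating (refl c) (refl d) (Suc k)) =
      word_prod (alternating (refl c) (refl d) k) \<circ> (if even k then refl c else refl d)"
    by (simp only: alternating_Suc word_prod_append word_prod_Cons word_prod_Nil comp_id)
  moreover have "refl c \<in> W" "refl d \<in> W" using fan_simps by (auto simp: Pos_iff refl_W)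
  ultimately show ?case using Suc W_comp by metis
qed

lemma alternating_ray:
  "word_prod (alternating (refl c) (refl d) k) (if even k then c else d) = \<rho> (int k + 1)"
  "word_prod (alternating (refl c) (refl d) k) (if even k then d else c) = - \<rho> (int k)"
  using alternating_rho[OF fan_simps(7,8,6), of k] sin_theta_pos by (auto simp: ray_def)

lemma sin_multiple_nonneg: "0 \<le> k \<Longrightarrow> k \<le> int n \<Longrightarrow> 0 \<le> sin (real_of_int k * \<theta>)"
proof (rule sin_ge_zero)
  assume k: "0 \<le> k" "k \<le> int n"
  show "0 \<le> real_of_int k * \<theta>" using k theta_bounds by simp
  have "real_of_int k * \<theta> \<le> real n * \<theta>" using k theta_bounds by (intro mult_right_mono) auto
  then show "real_of_int k * \<theta> \<le> pi" using fan_simps(5) by simp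
qed

lemma ray_Pos: "1 \<le> m \<Longrightarrow> m \<le> int n \<Longrightarrow> \<rho> m \<in> Pos"
proof -
  assume m: "1 \<le> m" "m \<le> int n"
  define k where "k = nat (m - 1)"
  have mk: "m = int k + 1" using m by (simp add: k_def)
  have "(if even k then c else d) \<in> \<Phi>" using fan_simps(1,2) by (simp add: Pos_iff)
  then have "\<rho> m \<in> \<Phi>" using alternating_ray(1)[of k] alternating_refl_W[of k] W_\<Phi> unfolding mk by metis
  moreover have "nonneg (\<rho> m)"
    using sin_multiple_nonneg[of m] sin_multiple_nonneg[of "m - 1"] m sin_theta_pos fan_simps(1,2)
    unfolding ray_def rho_def by (auto simp: Pos_iff intro!: nonneg_add nonneg_scale)
  ultimately show ?thesis by (simp add: Pos_iff)
qed

lemma ray_mod: "pm_eq (\<rho> (r + int n * k)) (\<rho> r)"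
proof (induction k rule: int_induct[where k = 0])
  case (step1 i)
  have e: "r + int n * (i + 1) = (r + int n * i) + int n" by (simp add: algebra_simps)
  show ?case unfolding e ray_period using step1 by simp
next
  case (step2 i)
  have e: "r + int n * (i - 1) = (r + int n * i) - int n" by (simp add: algebra_simps)
  show ?case unfolding e ray_period_minus using step2 by simp
qed simp

lemma ray_inject:
  assumes "\<rho> a = \<rho> b" "\<bar>a - b\<bar> < 2 * int n" shows "a = b"
proof (rule ccontr)
  assume ne: "a \<noteq> b"
  have "cos (real_of_int (a - b) * \<theta>) = 1" using ray_form[of a b] assms(1) by simp
  then have "\<exists>k::int. real_of_int (a - b) * \<theta> = real_of_int k * 2 * pi" by (simp only: cos_one_2pi_int)
  then obtain k :: int where "real_of_int (a - b) * \<theta> = real_of_int k * 2 * pi" by blast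
  then have "real_of_int (a - b) * \<theta> = (real_of_int k * 2 * real n) * \<theta>"
    using fan_simps(5) by (simp only: mult.assoc)
  then have "real_of_int (a - b) = real_of_int k * 2 * real n"
    using theta_bounds by (simp only: mult_cancel_right) auto
  then have "real_of_int (a - b) = real_of_int (k * (2 * int n))" by simp
  then have ab: "a - b = k * (2 * int n)" by (simp only: of_int_eq_iff)
  then have "k \<noteq> 0" using ne by auto
  then have "1 \<le> \<bar>k\<bar>" by linarith
  then have "1 * (2 * int n) \<le> \<bar>k\<bar> * (2 * int n)" by (intro mult_right_mono) auto
  then show False using assms(2) ab by (simp add: abs_mult)
qed

lemma ray_ne_neg:
  assumes "\<rho> a = - \<rho> b" shows "int n \<le> \<bar>a - b\<bar>"
proof (rule ccontr)
  assume "\<not> ?thesis"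
  then have lt: "\<bar>a - b\<bar> < int n" by simp
  have "\<rho> a = \<rho> (b + int n)" "\<rho> a = \<rho> (b - int n)" using assms ray_period ray_period_minus by auto
  then have "a = b + int n" using ray_inject[of a "b + int n"] ray_inject[of a "b - int n"] lt by linarith
  then show False using lt by simp
qed

lemma in_plane_ray:
  assumes "v \<in> \<Phi>" "in_plane c d v"
  shows "\<exists>m. 1 \<le> m \<and> m \<le> int n \<and> (v = \<rho> m \<or> v = - \<rho> m)"
proof -
  have *: "\<exists>m. 1 \<le> m \<and> m \<le> int n \<and> u = \<rho> m" if "u \<in> Pos" "in_plane c d u" for u
  proof -
    have "\<exists>m\<in>{1..int n}. u = \<rho> m" using fan that unfolding fan_def ray_def by blast
    then show ?thesis by auto
  qed
  show ?thesis using \<Phi>_cases[OF assms(1)] *[of v] *[of "- v"] assms(2) by (metis in_plane_uminus minus_minus)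
qed

text \<open>
  For \<open>1 \<le> k \<le> n\<close> both coefficients are nonnegative, and this exhibits a ray inside a half turn as a
  combination of the two extreme ones.
\<close>

lemma ray_combination:
  "sin \<theta> *\<^sub>R \<rho> (f + k) = sin (real_of_int k * \<theta>) *\<^sub>R \<rho> (f + 1) + sin (real_of_int (k - 1) * \<theta>) *\<^sub>R \<rho> (f + int n)"
proof -
  have trig: "sin \<theta> * sin ((F + K) * \<theta>) = sin (K * \<theta>) * sin ((F + 1) * \<theta>) - sin ((K - 1) * \<theta>) * sin (F * \<theta>)" for F K
  proof -
    define A B where "A = F * \<theta>" and "B = K * \<theta>"
    have e: "(F + K) * \<theta> = A + B" "(F + 1) * \<theta> = A + \<theta>" "(K - 1) * \<theta> = B - \<theta>" "K * \<theta> = B" "F * \<theta> = A"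
      by (simp_all add: A_def B_def algebra_simps)
    show ?thesis unfolding e sin_add sin_diff by (simp add: algebra_simps)
  qed
  define F K where "F = real_of_int f" and "K = real_of_int k"
  have s: "sin \<theta> \<noteq> 0" using sin_theta_pos by simp
  have r: "\<rho> (f + k) = (sin ((F + K) * \<theta>) / sin \<theta>) *\<^sub>R c + (sin ((F - 1 + K) * \<theta>) / sin \<theta>) *\<^sub>R d"
    "\<rho> (f + 1) = (sin ((F + 1) * \<theta>) / sin \<theta>) *\<^sub>R c + (sin ((F - 1 + 1) * \<theta>) / sin \<theta>) *\<^sub>R d"
    "\<rho> (f + int n) = - ((sin (F * \<theta>) / sin \<theta>) *\<^sub>R c + (sin ((F - 1) * \<theta>) / sin \<theta>) *\<^sub>R d)"
    unfolding ray_period by (simp_all add: ray_def rho_def F_def K_def algebra_simps)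
  have "sin \<theta> *\<^sub>R \<rho> (f + k) = ((sin \<theta> * sin ((F + K) * \<theta>)) / sin \<theta>) *\<^sub>R c + ((sin \<theta> * sin ((F - 1 + K) * \<theta>)) / sin \<theta>) *\<^sub>R d"
    unfolding r by (simp add: scaleR_add_right)
  also have "\<dots> = sin (K * \<theta>) *\<^sub>R \<rho> (f + 1) + sin ((K - 1) * \<theta>) *\<^sub>R \<rho> (f + int n)"
    unfolding trig r by (simp add: diff_divide_distrib scaleR_diff_left scaleR_add_right scaleR_diff_right)
  finally show ?thesis by (simp add: K_def)
qed

subsection \<open>Order and canonical generators\<close>

abbreviation altc where "altc k \<equiv> word_prod (alternating (refl c) (refl d) k)"

lemma altc_Suc: "altc (Suc k) = altc k \<circ> (if even k then refl c else refl d)"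
  by (simp only: alternating_Suc word_prod_append word_prod_Cons word_prod_Nil comp_id)

lemma altc_2n: "altc (2 * n) = id"
  using alternating_eq_id[OF fan_simps(7,8,6) _ fan_simps(5)] sin_theta_pos by simp

definition dihedral :: "('v \<Rightarrow> 'v) set" where
  "dihedral = generate GL {refl c, refl d}"

lemma dihedral_iff: "u \<in> dihedral \<longleftrightarrow> (\<exists>us. set us \<subseteq> {refl c, refl d} \<and> word_prod us = u)"
  unfolding dihedral_def
  by (rule generate_GL_iff) (use fan_simps(7,8) in auto)

text \<open>
  Multiplying an alternating product by one of the two letters lengthens it by one, and by the other
  shortens it by one; the alternating product of length \<open>2 * n\<close> is trivial.
\<close>

lemma dihedral_eq: "dihedral = altc ` {..<2 * n}"
proof (rule subset_antisym)
  show "altc ` {..<2 * n} \<subseteq> dihedral"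
    unfolding subset_iff dihedral_iff using set_alternating[of "refl c" "refl d"] by blast
  have inv: "refl c \<circ> refl c = id" "refl d \<circ> refl d = id" using fan_simps(7,8) by simp_all
  have n2: "2 \<le> n" by (rule fan_simps(4))
  have cancel: "altc (Suc k) \<circ> (if even k then refl c else refl d) = altc k" for k
    unfolding altc_Suc using inv by (cases "even k") (simp_all only: comp_assoc if_True if_False comp_id)
  have step: "altc k \<circ> t \<in> altc ` {..<2 * n}" if k: "k < 2 * n" and t: "t \<in> {refl c, refl d}" for k t
  proof (cases "t = (if even k then refl c else refl d)")
    case True
    then have e: "altc k \<circ> t = altc (Suc k)" by (simp only: altc_Suc)
    show ?thesis
    proof (cases "Suc k = 2 * n")
      case True
      then have "altc k \<circ> t = altc 0" unfolding e using altc_2n by simp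
      then show ?thesis using n2 by (intro image_eqI[of _ _ 0]) auto
    qed (use e k in auto)
  next
    case False
    then have t': "t = (if odd k then refl c else refl d)" using t by auto
    show ?thesis
    proof (cases k)
      case 0
      have "2 * n = Suc (2 * n - 1)" "odd (2 * n - 1)" using n2 by auto
      then have "altc (2 * n) \<circ> refl d = altc (2 * n - 1)" using cancel[of "2 * n - 1"] by simp
      then have "altc k \<circ> t = altc (2 * n - 1)" using 0 t' altc_2n by simp
      then show ?thesis using n2 by auto
    next
      case (Suc j)
      then have "altc k \<circ> t = altc j" using cancel[of j] t' by simp
      then show ?thesis using k Suc by auto
    qed
  qed
  have "word_prod us \<in> altc ` {..<2 * n}" if "set us \<subseteq> {refl c, refl d}" for us
    using that
  proof (induction us rule: rev_induct)
    case Nil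
    have "0 < 2 * n" using n2 by simp
    then have "altc 0 \<in> altc ` {..<2 * n}" by blast
    then show ?case by (simp only: alternating_0)
  next
    case (snoc t us)
    then have "word_prod us \<in> altc ` {..<2 * n}" by simp
    then obtain k where "k < 2 * n" "word_prod us = altc k" by blast
    moreover have "word_prod (us @ [t]) = word_prod us \<circ> t"
      by (simp only: word_prod_append word_prod_Cons word_prod_Nil comp_id)
    ultimately show ?case using step snoc.prems by (metis insert_subset list.simps(15) set_append le_sup_iff)
  qed
  then show "dihedral \<subseteq> altc ` {..<2 * n}" unfolding subset_iff dihedral_iff by blast
qed

lemma altc_inject:
  assumes "altc p = altc q" "p < 2 * n" "q < 2 * n" shows "p = q"
proof (cases "even p = even q")
  case True
  then have "\<rho> (int p + 1) = \<rho> (int q + 1)" using alternating_ray(1)[of p] alternating_ray(1)[of q] assms(1) by simp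
  then show ?thesis using ray_inject[of "int p + 1" "int q + 1"] assms by auto
next
  case False
  have e: "\<rho> (int p + 1) = - \<rho> (int q)" "- \<rho> (int p) = \<rho> (int q + 1)"
    using alternating_ray[of p] alternating_ray[of q] assms(1) False by (auto split: if_splits)
  define x where "x = real_of_int (int p - int q) * \<theta>"
  have xp: "real_of_int (int p + 1 - int q) * \<theta> = x + \<theta>" "real_of_int (int p - (int q + 1)) * \<theta> = x - \<theta>"
    by (simp_all add: x_def algebra_simps)
  have "form (\<rho> (int p + 1)) (\<rho> (int q)) = - 1" unfolding e(1) by simp
  then have 1: "cos (x + \<theta>) = - 1" unfolding ray_form xp .
  have "form (\<rho> (int p)) (\<rho> (int q + 1)) = - 1" unfolding e(2)[symmetric] by simp
  then have 2: "cos (x - \<theta>) = - 1" unfolding ray_form xp .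
  have "cos x * cos \<theta> = - 1" using 1 2 unfolding cos_add cos_diff by linarith
  moreover have "\<bar>cos \<theta>\<bar> < 1"
  proof -
    have "0 < (sin \<theta>)\<^sup>2" using sin_theta_pos by simp
    then have "(cos \<theta>)\<^sup>2 < 1\<^sup>2" using sin_cos_squared_add[of \<theta>] unfolding one_power2 by linarith
    then show ?thesis by (metis abs_1 abs_le_square_iff not_le power_one)
  qed
  moreover have "\<bar>cos x * cos \<theta>\<bar> \<le> 1 * \<bar>cos \<theta>\<bar>" unfolding abs_mult by (rule mult_right_mono) auto
  ultimately show ?thesis by simp
qed

lemma card_dihedral: "card dihedral = 2 * n" and finite_dihedral: "finite dihedral"
proof -
  have "inj_on altc {..<2 * n}" by (rule inj_onI) (use altc_inject in auto)
  then show "card dihedral = 2 * n" unfolding dihedral_eq by (simp add: card_image)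
  show "finite dihedral" unfolding dihedral_eq by simp
qed

lemma refl_ray_dihedral: "0 \<le> m \<Longrightarrow> refl (\<rho> (m + 1)) \<in> dihedral"
proof -
  assume m: "0 \<le> m"
  define k where "k = nat m"
  have mk: "m = int k" using m by (simp add: k_def)
  let ?x = "if even k then c else d"
  have iso: "isometry (altc k)" using W_isometry alternating_refl_W by blast
  have "refl (\<rho> (m + 1)) \<circ> altc k = altc k \<circ> refl ?x"
    using refl_conj_comp[OF iso, of ?x] alternating_ray(1)[of k] unfolding mk by simp
  also have "\<dots> = altc (Suc k)" unfolding altc_Suc by (cases "even k") simp_all
  finally have e: "refl (\<rho> (m + 1)) \<circ> altc k = altc (Suc k)" .
  have invs: "t \<circ> t = id" if "t \<in> set (alternating (refl c) (refl d) k)" for t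
  proof -
    have "t = refl c \<or> t = refl d" using that set_alternating[of "refl c" "refl d" k] by blast
    then show ?thesis using fan_simps(7,8) by auto
  qed
  let ?w = "alternating (refl c) (refl d)"
  have "altc k \<circ> word_prod (rev (?w k)) = id" by (rule word_prod_rev[OF invs])
  then have "refl (\<rho> (m + 1)) = altc (Suc k) \<circ> word_prod (rev (?w k))"
    using e by (metis comp_assoc comp_id)
  then have "refl (\<rho> (m + 1)) = word_prod (?w (Suc k) @ rev (?w k))" by (simp only: word_prod_append)
  moreover have "set (?w (Suc k) @ rev (?w k)) \<subseteq> {refl c, refl d}"
    using set_alternating[of "refl c" "refl d"] by auto
  ultimately show ?thesis unfolding dihedral_iff by metis
qed

lemma dihedral_moves_in_plane: "u \<in> dihedral \<Longrightarrow> in_plane c d (u v - v)"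
proof -
  assume "u \<in> dihedral"
  then obtain us where "set us \<subseteq> {refl c, refl d}" "word_prod us = u" unfolding dihedral_iff by blast
  then show ?thesis
  proof (induction us arbitrary: u)
    case Nil
    then show ?case by (auto intro: in_planeI[of _ 0 _ 0])
  next
    case (Cons t us)
    obtain p q where pq: "word_prod us v - v = p *\<^sub>R c + q *\<^sub>R d" using Cons unfolding in_plane_def by auto
    define x where "x = word_prod us v"
    have u: "u v = t x" using Cons.prems by (auto simp: x_def)
    have "t = refl c \<or> t = refl d" using Cons.prems by auto
    then have "\<exists>p' q'. t x - x = p' *\<^sub>R c + q' *\<^sub>R d"
    proof
      assume "t = refl c"
      then have "t x - x = (- 2 * form x c) *\<^sub>R c + 0 *\<^sub>R d" by (simp add: reflection_def)
      then show ?thesis by blast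
    next
      assume "t = refl d"
      then have "t x - x = 0 *\<^sub>R c + (- 2 * form x d) *\<^sub>R d" by (simp add: reflection_def)
      then show ?thesis by blast
    qed
    then obtain p' q' where pq': "t x - x = p' *\<^sub>R c + q' *\<^sub>R d" by blast
    have "u v - v = (t x - x) + (word_prod us v - v)" by (simp add: u x_def)
    then have "u v - v = (p' + p) *\<^sub>R c + (q' + q) *\<^sub>R d" unfolding pq pq' by (simp add: algebra_simps)
    then show ?case by (rule in_planeI)
  qed
qed

text \<open>
  The group moves every vector by a vector in the plane, and a reflection moves its own root by a
  multiple of it.
\<close>

lemma dihedral_reflection:
  assumes "\<beta> \<in> Pos" "refl \<beta> \<in> dihedral"
  obtains m where "1 \<le> m" "m \<le> int n" "\<beta> = \<rho> m"
proof -
  have u: "form \<beta> \<beta> = 1" using assms Pos_unit by blast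
  have "in_plane c d (refl \<beta> \<beta> - \<beta>)" by (rule dihedral_moves_in_plane[OF assms(2)])
  then obtain p q where "refl \<beta> \<beta> - \<beta> = p *\<^sub>R c + q *\<^sub>R d" unfolding in_plane_def by blast
  then have "(- 2) *\<^sub>R \<beta> = p *\<^sub>R c + q *\<^sub>R d" using u by (simp add: scaleR_2)
  then have "(- 1 / 2) *\<^sub>R ((- 2) *\<^sub>R \<beta>) = (- p / 2) *\<^sub>R c + (- q / 2) *\<^sub>R d"
    by (simp add: scaleR_add_right)
  then have "\<beta> = (- p / 2) *\<^sub>R c + (- q / 2) *\<^sub>R d" by simp
  then have "in_plane c d \<beta>" by (rule in_planeI)
  then have "\<exists>m\<in>{1..int n}. \<beta> = \<rho> m" using fan assms(1) unfolding fan_def ray_def by blast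
  then show ?thesis using that by auto
qed

lemma inversions_refl:
  assumes "\<beta> \<in> Pos"
  shows "inversions form \<Delta> (refl \<beta>) = {refl \<beta>' | \<beta>'. \<beta>' \<in> Pos \<and> - refl \<beta> \<beta>' \<in> Pos}"
proof -
  have u: "form \<beta> \<beta> = 1" "refl \<beta> \<in> W" using assms Pos_unit by (auto simp: Pos_iff refl_W)
  have "ell (refl \<beta>' \<circ> refl \<beta>) < ell (refl \<beta>) \<longleftrightarrow> - refl \<beta> \<beta>' \<in> Pos" if "\<beta>' \<in> Pos" for \<beta>'
    using reflection_shortens_iff[OF u(2) that] u(1) by simp
  then show ?thesis unfolding inversions_def using T_iff by auto
qed

text \<open>
  The reflection in \<open>\<rho> m\<close> takes \<open>\<rho> j\<close> to \<open>- \<rho> (2 * m - j)\<close>. For an inner ray this makes the neighbour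
  \<open>\<rho> (m - 1)\<close> negative. For an extreme ray the other positive rays stay positive.
\<close>

lemma canonical_generators_dihedral: "canonical_generators form \<Delta> dihedral = {refl c, refl d}"
proof (rule subset_antisym; rule subsetI)
  fix t assume "t \<in> canonical_generators form \<Delta> dihedral"
  then have t: "t \<in> T" "inversions form \<Delta> t \<inter> dihedral = {t}" unfolding canonical_generators_def by blast+
  obtain \<beta> where \<beta>: "\<beta> \<in> Pos" "t = refl \<beta>" using t(1) T_iff by blast
  have "refl \<beta> \<in> dihedral" using t(2) \<beta> by blast
  then obtain m where m: "1 \<le> m" "m \<le> int n" "\<beta> = \<rho> m" using dihedral_reflection \<beta>(1) by blast
  have "m = 1 \<or> m = int n"
  proof (rule ccontr)
    assume ne: "\<not> ?thesis"
    let ?b = "\<rho> (m - 1)"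
    have "?b \<in> Pos" by (rule ray_Pos) (use m ne in auto)
    moreover have "- refl \<beta> ?b = \<rho> (m + 1)" using ray_refl[of m "m - 1"] m by (simp add: algebra_simps)
    moreover have "\<rho> (m + 1) \<in> Pos" by (rule ray_Pos) (use m ne in auto)
    moreover have "refl ?b \<in> dihedral" using refl_ray_dihedral[of "m - 2"] m ne by simp
    ultimately have "refl ?b \<in> inversions form \<Delta> t \<inter> dihedral" using inversions_refl[OF \<beta>(1)] \<beta>(2) by auto
    then have "refl ?b = refl \<beta>" using t(2) \<beta>(2) by blast
    then have "?b = \<beta>" using refl_eq_iff[of ?b \<beta>] Pos_pm_eq[OF \<open>?b \<in> Pos\<close> \<beta>(1)] m Pos_unit[OF \<beta>(1)] by simp
    then show False using ray_inject[of "m - 1" m] m by auto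
  qed
  then show "t \<in> {refl c, refl d}" using \<beta>(2) m(3) ray_1 ray_n by auto
next
  have *: "refl (\<rho> m) \<in> canonical_generators form \<Delta> dihedral" if m: "m = 1 \<or> m = int n" for m
  proof -
    have mb: "1 \<le> m" "m \<le> int n" using m fan_simps(4) by auto
    then have P: "\<rho> m \<in> Pos" by (rule ray_Pos)
    have D: "refl (\<rho> m) \<in> dihedral" using refl_ray_dihedral[of "m - 1"] mb by simp
    have "- refl (\<rho> m) (\<rho> m) \<in> Pos" using P by simp
    then have in1: "refl (\<rho> m) \<in> inversions form \<Delta> (refl (\<rho> m))" using inversions_refl[OF P] P by blast
    have "t = refl (\<rho> m)" if t: "t \<in> inversions form \<Delta> (refl (\<rho> m)) \<inter> dihedral" for t
    proof -
      obtain \<beta> where \<beta>: "\<beta> \<in> Pos" "t = refl \<beta>" "- refl (\<rho> m) \<beta> \<in> Pos" using t inversions_refl[OF P] by auto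
      then obtain j where j: "1 \<le> j" "j \<le> int n" "\<beta> = \<rho> j" using dihedral_reflection[of \<beta>] t by blast
      have pos: "\<rho> (2 * m - j) \<in> Pos" using \<beta>(3) ray_refl[of m j] j by simp
      have "j = m"
      proof (rule ccontr)
        assume ne: "j \<noteq> m"
        define m' where "m' = (if m = 1 then 2 * m - j + int n else 2 * m - j - int n)"
        have "1 \<le> m'" "m' \<le> int n" using m mb j ne fan_simps(4) by (auto simp: m'_def)
        then have "\<rho> m' \<in> Pos" by (rule ray_Pos)
        moreover have "\<rho> m' = - \<rho> (2 * m - j)" unfolding m'_def using ray_period ray_period_minus by simp
        ultimately show False using pos not_Pos_both by simp
      qed
      then show ?thesis using \<beta> j by simp
    qed
    then have "inversions form \<Delta> (refl (\<rho> m)) \<inter> dihedral = {refl (\<rho> m)}" using in1 D by blast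
    moreover have "refl (\<rho> m) \<in> T" using P T_iff by blast
    ultimately show ?thesis unfolding canonical_generators_def by blast
  qed
  fix t assume "t \<in> {refl c, refl d}"
  then show "t \<in> canonical_generators form \<Delta> dihedral" using *[of 1] *[of "int n"] ray_1 ray_n by auto
qed

lemma refl_c_ne_refl_d: "refl c \<noteq> refl d"
  using refl_eq_iff[OF fan_simps(7,8)] Pos_pm_eq[OF fan_simps(1,2)] fan_simps(3) by simp

lemma dihedral_is_reflection_subgroup: "dihedral_reflection_subgroup form \<Delta> dihedral"
  unfolding dihedral_reflection_subgroup_def dihedral_def
  using refl_c_ne_refl_d T_iff fan_simps(1,2) by blast

end

end

section \<open>The walk of a subexpression\<close>

text \<open>
  The last time before \<open>b\<close> at which \<open>f\<close> is at most \<open>p + int i\<close> serves as \<open>\<tau> i\<close>.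
\<close>

lemma rising_times:
  fixes f :: "nat \<Rightarrow> int"
  assumes step: "\<And>t. a \<le> t \<Longrightarrow> t < b \<Longrightarrow> f (Suc t) \<le> f t + 1" and ab: "a \<le> b"
    and fa: "f a \<le> p" and fb: "p + int N \<le> f b"
  obtains \<tau> where "\<And>i. i < N \<Longrightarrow> a \<le> \<tau> i \<and> \<tau> i < b \<and> f (\<tau> i) = p + int i \<and> f (Suc (\<tau> i)) = p + int i + 1"
    and "\<And>i j. i < j \<Longrightarrow> j < N \<Longrightarrow> \<tau> i < \<tau> j"
proof -
  define X where "X = (\<lambda>i::nat. {t. a \<le> t \<and> t < b \<and> f t \<le> p + int i})"
  define \<tau> where "\<tau> = (\<lambda>i. Max (X i))"
  have fin: "finite (X i)" for i by (rule finite_subset[of _ "{..<b}"]) (auto simp: X_def)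
  have in_X: "\<tau> i \<in> X i" if "i < N" for i
  proof -
    have "a \<noteq> b" using fa fb that by auto
    then have "a \<in> X i" using ab fa by (simp add: X_def)
    then show ?thesis unfolding \<tau>_def using fin by (intro Max_in) auto
  qed
  have max: "t \<le> \<tau> i" if "t \<in> X i" for t i unfolding \<tau>_def using fin that by simp
  have val: "a \<le> \<tau> i \<and> \<tau> i < b \<and> f (\<tau> i) = p + int i \<and> f (Suc (\<tau> i)) = p + int i + 1" if i: "i < N" for i
  proof -
    have m: "a \<le> \<tau> i" "\<tau> i < b" "f (\<tau> i) \<le> p + int i" using in_X[OF i] by (auto simp: X_def)
    have "f (Suc (\<tau> i)) > p + int i"
    proof (cases "Suc (\<tau> i) = b")
      case True
      then show ?thesis using fb i by simp
    next
      case False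
      then show ?thesis using max[of "Suc (\<tau> i)" i] m by (force simp: X_def)
    qed
    then show ?thesis using m step[OF m(1,2)] by auto
  qed
  have "\<tau> i < \<tau> j" if ij: "i < j" "j < N" for i j
  proof -
    have i: "i < N" using ij by simp
    note v = val[OF i]
    have "Suc (\<tau> i) \<noteq> b" using v fb ij by auto
    then have "Suc (\<tau> i) \<in> X j" using v ij by (auto simp: X_def)
    then show ?thesis using max by (meson Suc_le_lessD)
  qed
  then show ?thesis using that val by blast
qed

context based_root_system
begin

text \<open>
  For a positive root this means that multiplication on the left by its reflection shortens the
  partial product.
\<close>

definition inverted :: "('v \<Rightarrow> 'v) list \<Rightarrow> subexpression \<Rightarrow> nat \<Rightarrow> 'v \<Rightarrow> bool" where
  "inverted s \<gamma> t \<alpha> \<longleftrightarrow> - fun_inv (before s \<gamma> t) \<alpha> \<in> Pos"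

context
  fixes s :: "('v \<Rightarrow> 'v) list" and \<gamma> :: subexpression
  assumes sS: "set s \<subseteq> S" and g: "\<gamma> \<in> Sub s"
begin

lemma re_s: "root_expression s"
  using sS S_T by (auto simp: root_expression_def)

abbreviation arrows where "arrows \<equiv> arr s \<gamma>"
abbreviation u_inv where "u_inv t \<equiv> fun_inv (before s \<gamma> t)"

lemma before_iso: "t \<le> length s \<Longrightarrow> isometry (before s \<gamma> t)"
  by (rule before_isometry[OF re_s g])

lemma simple_letter:
  assumes "t < length s"
  obtains \<delta> where "\<delta> \<in> \<Delta>" "s ! t = refl \<delta>" "arrows t = - before s \<gamma> t \<delta>" "u_inv t (arrows t) = - \<delta>"
proof -
  obtain \<delta> where d: "\<delta> \<in> \<Delta>" "s ! t = refl \<delta>" using assms sS S_iff nth_mem by blast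
  have iso: "isometry (before s \<gamma> t)" using before_iso assms by simp
  have "arrows t = - before s \<gamma> t \<delta>"
    using d root_of_refl[OF simple_Pos[OF d(1)]] iso by (simp add: arrow_def isometry_simps)
  moreover have "u_inv t (- before s \<gamma> t \<delta>) = - \<delta>"
    using iso by (simp add: isometry_simps[OF isometry_inv[OF iso]])
  ultimately show ?thesis using that d by simp
qed

lemma u_inv_Suc:
  assumes "t < length s"
  shows "u_inv (Suc t) v = (if \<gamma> ! t then (s ! t) (u_inv t v) else u_inv t v)"
proof (cases "\<gamma> ! t")
  case True
  obtain \<delta> where d: "\<delta> \<in> \<Delta>" "s ! t = refl \<delta>" using simple_letter[OF assms] by metis
  have u: "form \<delta> \<delta> = 1" using d form_unit by simp
  have iso: "isometry (before s \<gamma> t)" using before_iso assms by simp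
  have "before s \<gamma> (Suc t) = before s \<gamma> t \<circ> refl \<delta>" using before_Suc[OF g assms] True d(2) by simp
  then have "u_inv (Suc t) = refl \<delta> \<circ> u_inv t"
    using inv_comp_isometry[OF iso isometry_refl[OF u]] inv_refl[OF u] by metis
  then have "u_inv (Suc t) v = (refl \<delta> \<circ> u_inv t) v" by (rule fun_cong)
  then show ?thesis using True d(2) by simp
next
  case False
  then have "before s \<gamma> (Suc t) = before s \<gamma> t" using before_Suc[OF g assms] by simp
  then show ?thesis using False by simp
qed

lemma u_inv_\<Phi>: "t \<le> length s \<Longrightarrow> v \<in> \<Phi> \<Longrightarrow> u_inv t v \<in> \<Phi>"
  using before_W[OF re_s g] by (simp add: W_\<Phi> W_inv)

lemma u_inv_linear:
  assumes "t \<le> length s"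
  shows "u_inv t (p *\<^sub>R a + q *\<^sub>R b) = p *\<^sub>R u_inv t a + q *\<^sub>R u_inv t b" "u_inv t (- a) = - u_inv t a"
    "u_inv t a = u_inv t b \<longleftrightarrow> a = b"
  using isometry_inv[OF before_iso[OF assms]] by (simp_all add: isometry_simps isometry_eq_iff)

lemma not_inverted_iff: "t \<le> length s \<Longrightarrow> \<alpha> \<in> Pos \<Longrightarrow> \<not> inverted s \<gamma> t \<alpha> \<longleftrightarrow> u_inv t \<alpha> \<in> Pos"
  unfolding inverted_def using u_inv_\<Phi>[of t \<alpha>] \<Phi>_cases[of "u_inv t \<alpha>"] not_Pos_both by (auto simp: Pos_iff)

lemma not_inverted_0: "\<alpha> \<in> Pos \<Longrightarrow> \<not> inverted s \<gamma> 0 \<alpha>"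
  unfolding inverted_def using not_Pos_both by auto

lemma arrow_eq_iff_inverted:
  assumes "t < length s" "\<alpha> \<in> Pos" "pm_eq (arrows t) \<alpha>"
  shows "arrows t = \<alpha> \<longleftrightarrow> inverted s \<gamma> t \<alpha>"
proof -
  obtain \<delta> where d: "\<delta> \<in> \<Delta>" "u_inv t (arrows t) = - \<delta>" using simple_letter[OF assms(1)] by metis
  have P: "\<delta> \<in> Pos" using d simple_Pos by blast
  consider "arrows t = \<alpha>" | "arrows t = - \<alpha>" "arrows t \<noteq> \<alpha>" using assms(3) unfolding pm_eq_def by blast
  then show ?thesis
  proof cases
    case 1
    then show ?thesis using d P by (simp add: inverted_def)
  next
    case 2
    then have "- u_inv t \<alpha> = - \<delta>" using d u_inv_linear(2)[of t \<alpha>] assms(1) by simp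
    then show ?thesis using 2 P not_Pos_both unfolding inverted_def by auto
  qed
qed

text \<open>
  The next letter is a simple reflection, and it can only change the sign of the roots that are
  mapped to its simple root up to sign: these are the arrow and its negative.
\<close>

lemma inverted_Suc:
  assumes "t < length s" "\<alpha> \<in> Pos" "\<not> pm_eq (arrows t) \<alpha>"
  shows "inverted s \<gamma> (Suc t) \<alpha> \<longleftrightarrow> inverted s \<gamma> t \<alpha>"
proof -
  obtain \<delta> where d: "\<delta> \<in> \<Delta>" "s ! t = refl \<delta>" "arrows t = - before s \<gamma> t \<delta>"
    using simple_letter[OF assms(1)] by metis
  have tl: "t \<le> length s" using assms by simp
  have ne: "u_inv t \<alpha> \<noteq> \<delta>" "u_inv t \<alpha> \<noteq> - \<delta>"
    using assms(3) before_iso[OF tl] unfolding d(3) pm_eq_def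
    by (metis isometry_inv_simps(1) minus_minus, metis isometry_inv_simps(1) isometry_simps(3))
  have *: "refl \<delta> v \<in> Pos \<longleftrightarrow> v \<in> Pos" if "v \<noteq> \<delta>" "v \<noteq> - \<delta>" for v
    using simple_refl_Pos[of v \<delta>] simple_refl_Pos[of "refl \<delta> v" \<delta>] that d(1) form_unit
    by (metis refl_invol refl_self)
  have "- refl \<delta> (u_inv t \<alpha>) \<in> Pos \<longleftrightarrow> - u_inv t \<alpha> \<in> Pos"
    using *[of "- u_inv t \<alpha>"] ne by (metis minus_minus refl_simps(4))
  then show ?thesis unfolding inverted_def u_inv_Suc[OF assms(1)] using d(2) by simp
qed

lemma touched_between:
  assumes "a \<le> b" "b \<le> length s" "\<alpha> \<in> Pos" "inverted s \<gamma> a \<alpha> \<noteq> inverted s \<gamma> b \<alpha>"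
  shows "\<exists>t. a \<le> t \<and> t < b \<and> pm_eq (arrows t) \<alpha>"
proof (rule ccontr)
  assume none: "\<not> ?thesis"
  have "inverted s \<gamma> b \<alpha> = inverted s \<gamma> a \<alpha>"
    using assms(1,2) none
  proof (induction b rule: dec_induct)
    case (step b)
    then show ?case using inverted_Suc[of b \<alpha>] assms(3) by (metis Suc_le_lessD less_SucI Suc_leD lessI)
  qed simp
  then show False using assms(4) by simp
qed

text \<open>
  No positive root is inverted at the start, so an inverted one is an arrow somewhere, up to sign.
\<close>

lemma finite_inverted:
  assumes "t \<le> length s" shows "finite {\<alpha> \<in> Pos. inverted s \<gamma> t \<alpha>}"
proof -
  have "{\<alpha> \<in> Pos. inverted s \<gamma> t \<alpha>} \<subseteq> (\<Union>k<length s. {arrows k, - arrows k})"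
  proof
    fix \<alpha> assume "\<alpha> \<in> {\<alpha> \<in> Pos. inverted s \<gamma> t \<alpha>}"
    then have a: "\<alpha> \<in> Pos" "inverted s \<gamma> t \<alpha>" by auto
    then obtain k where k: "k < t" "pm_eq (arrows k) \<alpha>"
      using touched_between[of 0 t \<alpha>] not_inverted_0[of \<alpha>] assms by auto
    then have "\<alpha> \<in> {arrows k, - arrows k}" by (auto simp: pm_eq_def)
    then show "\<alpha> \<in> (\<Union>k<length s. {arrows k, - arrows k})" using k assms by auto
  qed
  then show ?thesis by (rule finite_subset) auto
qed

lemma inverted_cone:
  assumes t: "t \<le> length s" and P: "a \<in> Pos" "b \<in> Pos" "v \<in> Pos" and v: "in_cone a b v"
  shows "inverted s \<gamma> t a \<Longrightarrow> inverted s \<gamma> t b \<Longrightarrow> inverted s \<gamma> t v"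
    and "\<not> inverted s \<gamma> t a \<Longrightarrow> \<not> inverted s \<gamma> t b \<Longrightarrow> \<not> inverted s \<gamma> t v"
proof -
  obtain p q where pq: "0 \<le> p" "0 \<le> q" "v = p *\<^sub>R a + q *\<^sub>R b" using v unfolding in_cone_def by blast
  have e: "u_inv t v = p *\<^sub>R u_inv t a + q *\<^sub>R u_inv t b" unfolding pq(3) by (rule u_inv_linear(1)[OF t])
  have v\<Phi>: "u_inv t v \<in> \<Phi>" using u_inv_\<Phi>[OF t] P by (simp add: Pos_iff)
  {
    assume i: "inverted s \<gamma> t a" "inverted s \<gamma> t b"
    have "nonneg (p *\<^sub>R (- u_inv t a) + q *\<^sub>R (- u_inv t b))"
      by (intro nonneg_add nonneg_scale) (use i pq in \<open>auto simp: inverted_def Pos_iff\<close>)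
    then have "nonneg (- u_inv t v)" by (simp add: e)
    then show "inverted s \<gamma> t v" using v\<Phi> \<Phi>_uminus by (simp add: inverted_def Pos_iff)
  }
  {
    assume "\<not> inverted s \<gamma> t a" "\<not> inverted s \<gamma> t b"
    then have "u_inv t a \<in> Pos" "u_inv t b \<in> Pos" using not_inverted_iff[OF t] P by auto
    then have "nonneg (u_inv t v)" unfolding e using pq by (auto simp: Pos_iff intro!: nonneg_add nonneg_scale)
    then show "\<not> inverted s \<gamma> t v" using not_inverted_iff[OF t P(3)] v\<Phi> by (simp add: Pos_iff)
  }
qed

text \<open>
  If all lowering pairs for two roots interleave, the second root becomes inverted once and for all
  before the first one is used, and the first root is inverted at that time.
\<close>

lemma interleaved_structure:
  assumes low: "lowering s \<gamma> i k" "lowering s \<gamma> j l" and a1: "arrows k = \<alpha>1" and a2: "arrows l = \<alpha>2"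
    and ne: "\<alpha>1 \<noteq> \<alpha>2" and ord: "i < j" "j < k" "k < l"
    and NI: "\<And>i' k' j' l'. lowering s \<gamma> i' k' \<Longrightarrow> arrows k' = \<alpha>1 \<Longrightarrow> lowering s \<gamma> j' l' \<Longrightarrow> arrows l' = \<alpha>2 \<Longrightarrow>
      (i' < j' \<and> j' < k' \<and> k' < l') \<or> (j' < i' \<and> i' < l' \<and> l' < k')"
  obtains h where "h < k" "pm_eq (arrows h) \<alpha>2" "\<And>t. t \<le> h \<Longrightarrow> \<not> inverted s \<gamma> t \<alpha>2"
    "\<And>t. h < t \<Longrightarrow> t \<le> l \<Longrightarrow> inverted s \<gamma> t \<alpha>2" "inverted s \<gamma> h \<alpha>1" "inverted s \<gamma> k \<alpha>1"
proof -
  have len: "k < length s" "l < length s" using low by (auto simp: lowering_def)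
  have P: "\<alpha>1 \<in> Pos" "\<alpha>2 \<in> Pos" using low a1 a2 by (auto simp: lowering_def)
  have not_both: "\<not> (pm_eq (arrows t) \<alpha>1 \<and> pm_eq (arrows t) \<alpha>2)" for t
    using P ne Pos_pm_eq pm_eq_sym pm_eq_trans by blast
  have k2: "\<not> pm_eq (arrows k) \<alpha>2" using not_both[of k] a1 by auto
  have invk: "inverted s \<gamma> k \<alpha>1" using arrow_eq_iff_inverted[OF len(1) P(1)] a1 by simp
  have invl: "inverted s \<gamma> l \<alpha>2" using arrow_eq_iff_inverted[OF len(2) P(2)] a2 by simp
  have lowl: "lowering s \<gamma> t l" if "pm_eq (arrows t) \<alpha>2" "t < l" for t
    using that a2 len P by (simp add: lowering_def)
  have lowk: "lowering s \<gamma> t k" if "pm_eq (arrows t) \<alpha>1" "t < k" for t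
    using that a1 len P by (simp add: lowering_def)
  \<comment> \<open>Touching the second root between \<open>k\<close> and \<open>l\<close> would give a pair disjoint from \<open>(i, k)\<close>.\<close>
  have after: "inverted s \<gamma> t \<alpha>2" if t: "k \<le> t" "t \<le> l" for t
  proof (rule ccontr)
    assume "\<not> inverted s \<gamma> t \<alpha>2"
    then obtain t' where t': "t \<le> t'" "t' < l" "pm_eq (arrows t') \<alpha>2"
      using touched_between[of t l \<alpha>2] invl t len P by auto
    have "t' \<noteq> k" using k2 t'(3) by blast
    then show False using NI[OF low(1) a1 lowl[OF t'(3,2)] a2] t t' by linarith
  qed
  define h where "h = Max {t. t < k \<and> \<not> inverted s \<gamma> t \<alpha>2}"
  have "0 \<in> {t. t < k \<and> \<not> inverted s \<gamma> t \<alpha>2}" using not_inverted_0[OF P(2)] ord by simp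
  then have hin: "h \<in> {t. t < k \<and> \<not> inverted s \<gamma> t \<alpha>2}" unfolding h_def by (intro Max_in) auto
  then have h: "h < k" "\<not> inverted s \<gamma> h \<alpha>2" by auto
  have between: "inverted s \<gamma> t \<alpha>2" if "h < t" "t < k" for t
  proof (rule ccontr)
    assume "\<not> inverted s \<gamma> t \<alpha>2"
    then have "t \<le> h" unfolding h_def using that by (intro Max_ge) auto
    then show False using that by simp
  qed
  have inv: "inverted s \<gamma> t \<alpha>2" if "h < t" "t \<le> l" for t
    using between after that by (cases "t < k") auto
  have "\<exists>t. h \<le> t \<and> t < Suc h \<and> pm_eq (arrows t) \<alpha>2"
    by (rule touched_between) (use inv[of "Suc h"] h ord len P in auto)
  then have th: "pm_eq (arrows h) \<alpha>2" by (metis le_antisym less_Suc_eq_le)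
  have hl: "lowering s \<gamma> h l" by (rule lowl[OF th]) (use h ord in simp)
  have before: "\<not> inverted s \<gamma> t \<alpha>2" if t: "t \<le> h" for t
  proof
    assume it: "inverted s \<gamma> t \<alpha>2"
    obtain t1 where t1: "t1 < t" "pm_eq (arrows t1) \<alpha>2"
      using touched_between[of 0 t \<alpha>2] not_inverted_0[OF P(2)] it t h len P by auto
    \<comment> \<open>The last time in \<open>[t, h)\<close> at which the root is inverted is a touch with positive arrow.\<close>
    define t2 where "t2 = Max {t'. t \<le> t' \<and> t' < h \<and> inverted s \<gamma> t' \<alpha>2}"
    have "t < h" using it h t by (metis le_neq_implies_less)
    then have "t2 \<in> {t'. t \<le> t' \<and> t' < h \<and> inverted s \<gamma> t' \<alpha>2}" unfolding t2_def using it
      by (intro Max_in) auto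
    then have t2: "t \<le> t2" "t2 < h" "inverted s \<gamma> t2 \<alpha>2" by auto
    have "\<not> inverted s \<gamma> (Suc t2) \<alpha>2"
    proof
      assume i2: "inverted s \<gamma> (Suc t2) \<alpha>2"
      then have "Suc t2 < h" using t2 h(2) by (metis Suc_leI le_neq_implies_less)
      then have "Suc t2 \<le> t2" unfolding t2_def using i2 t2
        by (intro Max_ge) (auto simp: t2_def[symmetric])
      then show False by simp
    qed
    then have pm2: "pm_eq (arrows t2) \<alpha>2" using inverted_Suc[of t2 \<alpha>2] t2 h len P by auto
    then have "arrows t2 = \<alpha>2" using arrow_eq_iff_inverted[of t2 \<alpha>2] t2 h len P by auto
    then have low12: "lowering s \<gamma> t1 t2" using t1 t2 pm2 h len P by (simp add: lowering_def)
    have "(i < t1 \<and> t1 < k \<and> k < t2) \<or> (t1 < i \<and> i < t2 \<and> t2 < k)"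
      by (rule NI[OF low(1) a1 low12 \<open>arrows t2 = \<alpha>2\<close>])
    then have "t1 < i" using t2 h by linarith
    have "lowering s \<gamma> t1 l" by (rule lowl[OF t1(2)]) (use t1 t h ord in linarith)
    then have "(i < t1 \<and> t1 < k \<and> k < l) \<or> (t1 < i \<and> i < l \<and> l < k)" by (rule NI[OF low(1) a1 _ a2])
    then show False using \<open>t1 < i\<close> ord by linarith
  qed
  have "inverted s \<gamma> h \<alpha>1"
  proof (rule ccontr)
    assume "\<not> inverted s \<gamma> h \<alpha>1"
    then obtain t where t: "h \<le> t" "t < k" "pm_eq (arrows t) \<alpha>1"
      using touched_between[of h k \<alpha>1] invk h len P by auto
    have "t \<noteq> h" using not_both[of h] th t(3) by blast
    then show False using NI[OF lowk[OF t(3,2)] a1 hl a2] t ord by linarith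
  qed
  then show ?thesis using that[of h] h(1) th before inv invk by blast
qed

text \<open>
  Every positive root \<open>v\<close> of the plane is inverted at \<open>h\<close> or at \<open>k\<close>. This is clear by convexity if \<open>v\<close>
  lies between \<open>\<alpha>1\<close> and \<open>\<alpha>2\<close> (use \<open>k\<close>) or \<open>\<alpha>1\<close> between \<open>v\<close> and \<open>\<alpha>2\<close> (use \<open>h\<close>). If \<open>\<alpha>2\<close> lies between
  \<open>\<alpha>1\<close> and \<open>v\<close>, the arrow at \<open>k\<close> matters: the inverse of the partial product maps \<open>\<alpha>1\<close> to a negative
  simple root there, and the reflection in it would make \<open>\<alpha>1\<close>, and hence \<open>\<alpha>2\<close>, positive if \<open>v\<close> were
  not inverted.
\<close>

lemma finite_plane:
  assumes P: "\<alpha>1 \<in> Pos" "\<alpha>2 \<in> Pos" and len: "h < length s" "k < length s"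
    and h: "inverted s \<gamma> h \<alpha>1" "\<not> inverted s \<gamma> h \<alpha>2"
    and k: "inverted s \<gamma> k \<alpha>1" "inverted s \<gamma> k \<alpha>2" "arrows k = \<alpha>1"
  shows "finite {v \<in> Pos. in_plane \<alpha>1 \<alpha>2 v}"
proof -
  obtain \<delta> where d: "\<delta> \<in> \<Delta>" "u_inv k (arrows k) = - \<delta>" using simple_letter[OF len(2)] by metis
  have d1: "u_inv k \<alpha>1 = - \<delta>" using d k(3) by simp
  have "v \<in> {v \<in> Pos. inverted s \<gamma> h v} \<union> {v \<in> Pos. inverted s \<gamma> k v}"
    if v: "v \<in> Pos" "in_plane \<alpha>1 \<alpha>2 v" for v
  proof -
    have "in_cone \<alpha>1 \<alpha>2 v \<or> in_cone v \<alpha>2 \<alpha>1 \<or> in_cone \<alpha>1 v \<alpha>2"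
      using three_in_plane[OF P v] .
    then consider "in_cone \<alpha>1 \<alpha>2 v" | "in_cone v \<alpha>2 \<alpha>1" | "in_cone \<alpha>1 v \<alpha>2" by blast
    then show ?thesis
    proof cases
      case 1
      then show ?thesis using inverted_cone(1)[of k \<alpha>1 \<alpha>2 v] P v k len by simp
    next
      case 2
      then show ?thesis using inverted_cone(2)[of h v \<alpha>2 \<alpha>1] P v h len by auto
    next
      case 3
      then obtain p q where pq: "0 \<le> p" "0 \<le> q" "\<alpha>2 = p *\<^sub>R \<alpha>1 + q *\<^sub>R v" unfolding in_cone_def by blast
      have "inverted s \<gamma> k v"
      proof (rule ccontr)
        assume "\<not> inverted s \<gamma> k v"
        then have vP: "u_inv k v \<in> Pos" using not_inverted_iff[of k v] v len by simp
        have ne: "- u_inv k \<alpha>2 \<noteq> \<delta>"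
        proof
          assume "- u_inv k \<alpha>2 = \<delta>"
          then have "u_inv k \<alpha>2 = u_inv k \<alpha>1" using d1 by (metis minus_minus)
          then have "\<alpha>1 = \<alpha>2" using u_inv_linear(3)[of k \<alpha>2 \<alpha>1] len by simp
          then show False using h by simp
        qed
        have "- u_inv k \<alpha>2 \<in> Pos" using k(2) by (simp add: inverted_def)
        then have neg: "refl \<delta> (- u_inv k \<alpha>2) \<in> Pos" using simple_refl_Pos ne d(1) by blast
        have "u_inv k v \<noteq> \<delta>"
        proof
          assume "u_inv k v = \<delta>"
          then have "u_inv k \<alpha>2 = (q - p) *\<^sub>R \<delta>"
            using u_inv_linear(1)[of k p \<alpha>1 q v] len d1 unfolding pq(3)[symmetric] by (simp add: algebra_simps)
          then have e: "- u_inv k \<alpha>2 = (p - q) *\<^sub>R \<delta>" by (simp add: algebra_simps)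
          have "form (- u_inv k \<alpha>2) (- u_inv k \<alpha>2) = 1" using \<open>- u_inv k \<alpha>2 \<in> Pos\<close> Pos_unit by blast
          then have "(p - q) * (p - q) = 1" unfolding e using d(1) form_unit by simp
          then have "p - q = 1 \<or> p - q = -1" by (simp only: square_eq_1_iff)
          then have "- u_inv k \<alpha>2 = - \<delta>" using e ne by auto
          then show False using \<open>- u_inv k \<alpha>2 \<in> Pos\<close> simple_Pos[OF d(1)] not_Pos_both by metis
        qed
        then have "refl \<delta> (u_inv k v) \<in> Pos" using simple_refl_Pos vP d(1) by blast
        moreover have "refl \<delta> (u_inv k \<alpha>1) = \<delta>" using d1 d(1) form_unit by simp
        ultimately have "nonneg (p *\<^sub>R refl \<delta> (u_inv k \<alpha>1) + q *\<^sub>R refl \<delta> (u_inv k v))"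
          using pq d(1) by (auto simp: Pos_iff nonneg_simple intro!: nonneg_add nonneg_scale)
        moreover have "refl \<delta> (u_inv k \<alpha>2) = p *\<^sub>R refl \<delta> (u_inv k \<alpha>1) + q *\<^sub>R refl \<delta> (u_inv k v)"
          using u_inv_linear(1)[of k p \<alpha>1 q v] len unfolding pq(3)[symmetric] by simp
        ultimately have "nonneg (refl \<delta> (u_inv k \<alpha>2))" by simp
        moreover have "nonneg (- refl \<delta> (u_inv k \<alpha>2))" using neg by (simp add: Pos_iff)
        ultimately have "refl \<delta> (u_inv k \<alpha>2) = 0" by (rule nonneg_antisym)
        then show False using neg Pos_unit[OF neg] by simp
      qed
      then show ?thesis using v by simp
    qed
  qed
  then have "{v \<in> Pos. in_plane \<alpha>1 \<alpha>2 v} \<subseteq> {v \<in> Pos. inverted s \<gamma> h v} \<union> {v \<in> Pos. inverted s \<gamma> k v}"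
    by blast
  then show ?thesis using finite_inverted len by (meson finite_UnI finite_subset less_imp_le)
qed

text \<open>
  In a fan the partial products of a subexpression perform a walk on the integers. At position
  \<open>x\<close> the rays \<open>x + 1, \<dots>, x + n\<close> are mapped to positive roots by the inverse of the partial
  product, and only the first and the last of them can be an arrow, up to sign.
\<close>

lemma walk_step:
  assumes fan: "fan \<theta> n c d" and t: "t < length s"
    and win: "\<And>m. x < m \<Longrightarrow> m \<le> x + int n \<Longrightarrow> u_inv t (ray \<theta> c d m) \<in> Pos"
  shows "\<exists>y. (\<forall>m. y < m \<longrightarrow> m \<le> y + int n \<longrightarrow> u_inv (Suc t) (ray \<theta> c d m) \<in> Pos) \<and>
    (in_plane c d (arrows t) \<longrightarrow> arrows t = - ray \<theta> c d (x + 1) \<or> arrows t = ray \<theta> c d x) \<and>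
    (y = x \<or> y = x + 1 \<and> arrows t = - ray \<theta> c d (x + 1) \<or> y = x - 1 \<and> arrows t = ray \<theta> c d x)"
proof -
  let ?r = "ray \<theta> c d"
  have tl: "t \<le> length s" using t by simp
  have n2: "2 \<le> n" using fan by (simp add: fan_def)
  obtain \<delta> where d: "\<delta> \<in> \<Delta>" "s ! t = refl \<delta>" "u_inv t (arrows t) = - \<delta>" using simple_letter[OF t] by metis
  have du: "form \<delta> \<delta> = 1" "\<delta> \<in> Pos" using d form_unit simple_Pos by auto
  show ?thesis
  proof (cases "in_plane c d (arrows t)")
    case False
    have "u_inv (Suc t) (?r m) \<in> Pos" if m: "x < m" "m \<le> x + int n" for m
    proof -
      have "u_inv t (?r m) \<noteq> \<delta>"
      proof
        assume "u_inv t (?r m) = \<delta>"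
        then have "u_inv t (- ?r m) = u_inv t (arrows t)" using d(3) u_inv_linear(2)[OF tl] by simp
        then have "arrows t = - ?r m" using u_inv_linear(3)[OF tl] by metis
        then show False using False ray_in_plane[OF fan, of m] by simp
      qed
      then show ?thesis using win[OF m] simple_refl_Pos d u_inv_Suc[OF t] by simp
    qed
    then show ?thesis using False by (intro exI[of _ x]) auto
  next
    case True
    obtain q' where q': "arrows t = ?r q' \<or> arrows t = - ?r q'"
      using in_plane_ray[OF fan arr_\<Phi>[OF re_s g t] True] by blast
    \<comment> \<open>The representative of the ray, up to sign, in the window \<open>x + 1, \<dots>, x + n\<close>.\<close>
    define q where "q = x + 1 + (q' - x - 1) mod int n"
    have n0: "0 < int n" using n2 by simp
    have q: "x < q" "q \<le> x + int n" using pos_mod_sign[OF n0, of "q' - x - 1"] pos_mod_bound[OF n0, of "q' - x - 1"]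
      by (auto simp: q_def)
    have "q' - x - 1 = int n * ((q' - x - 1) div int n) + (q' - x - 1) mod int n" by (simp only: mult_div_mod_eq)
    then have "q' = q + int n * ((q' - x - 1) div int n)" by (simp add: q_def)
    then have "pm_eq (?r q') (?r q)" using ray_mod[OF fan] by metis
    then have "arrows t = ?r q \<or> arrows t = - ?r q" using q' unfolding pm_eq_def by (metis minus_minus)
    moreover have "arrows t \<noteq> ?r q" using win[OF q] d(3) du not_Pos_both by auto
    ultimately have aq: "arrows t = - ?r q" by blast
    then have uq: "u_inv t (?r q) = \<delta>" using d(3) u_inv_linear(2)[OF tl, of "?r q"] by simp
    have ne: "u_inv t (?r m) \<noteq> \<delta>" if "x < m" "m \<le> x + int n" "m \<noteq> q" for m
    proof
      assume "u_inv t (?r m) = \<delta>"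
      then have "?r m = ?r q" using uq u_inv_linear(3)[OF tl] by metis
      moreover have "\<bar>m - q\<bar> < 2 * int n" using that q n2 by linarith
      ultimately show False using ray_inject[OF fan, of m q] that by blast
    qed
    have rP: "refl \<delta> (u_inv t (?r m)) \<in> Pos" if "x < m" "m \<le> x + int n" "m \<noteq> q" for m
      using simple_refl_Pos[OF win _ ne] that d(1) by simp
    \<comment> \<open>A simple root is not a nonnegative combination of two other positive roots, since the reflection in
      it keeps those positive.\<close>
    have q_end: "q = x + 1 \<or> q = x + int n"
    proof (rule ccontr)
      assume ne: "\<not> ?thesis"
      have P: "refl \<delta> (u_inv t (?r (x + 1))) \<in> Pos" "refl \<delta> (u_inv t (?r (x + int n))) \<in> Pos"
        using rP[of "x + 1"] rP[of "x + int n"] ne n2 by auto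
      have e: "sin \<theta> *\<^sub>R ?r q = sin (real_of_int (q - x) * \<theta>) *\<^sub>R ?r (x + 1) + sin (real_of_int (q - x - 1) * \<theta>) *\<^sub>R ?r (x + int n)"
        using ray_combination[OF fan, of x "q - x"] by simp
      have s0: "0 \<le> sin (real_of_int (q - x) * \<theta>)" "0 \<le> sin (real_of_int (q - x - 1) * \<theta>)"
        using sin_multiple_nonneg[OF fan, of "q - x"] sin_multiple_nonneg[OF fan, of "q - x - 1"] q by auto
      have "sin \<theta> *\<^sub>R u_inv t (?r q) = sin (real_of_int (q - x) * \<theta>) *\<^sub>R u_inv t (?r (x + 1)) +
          sin (real_of_int (q - x - 1) * \<theta>) *\<^sub>R u_inv t (?r (x + int n))"
        using arg_cong[OF e, of "u_inv t"] u_inv_linear(1)[OF tl] u_inv_linear(1)[OF tl, of "sin \<theta>" "?r q" 0 0] by simp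
      then have "refl \<delta> (sin \<theta> *\<^sub>R \<delta>) = sin (real_of_int (q - x) * \<theta>) *\<^sub>R refl \<delta> (u_inv t (?r (x + 1))) +
          sin (real_of_int (q - x - 1) * \<theta>) *\<^sub>R refl \<delta> (u_inv t (?r (x + int n)))"
        unfolding uq by (metis refl_simps(1,3))
      moreover have "refl \<delta> (sin \<theta> *\<^sub>R \<delta>) = sin \<theta> *\<^sub>R (- \<delta>)" using du by simp
      moreover have "nonneg (sin (real_of_int (q - x) * \<theta>) *\<^sub>R refl \<delta> (u_inv t (?r (x + 1))) +
          sin (real_of_int (q - x - 1) * \<theta>) *\<^sub>R refl \<delta> (u_inv t (?r (x + int n))))"
        by (intro nonneg_add nonneg_scale) (use s0 P in \<open>simp_all add: Pos_iff\<close>)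
      ultimately have "nonneg (sin \<theta> *\<^sub>R (- \<delta>))" by metis
      then have "nonneg ((1 / sin \<theta>) *\<^sub>R (sin \<theta> *\<^sub>R (- \<delta>)))"
        by (rule nonneg_scale) (use sin_theta_pos[OF fan] in simp)
      moreover have "(1 / sin \<theta>) *\<^sub>R (sin \<theta> *\<^sub>R (- \<delta>)) = - \<delta>"
        using sin_theta_pos[OF fan] by simp
      ultimately have "nonneg (- \<delta>)" by metis
      then have "\<delta> = 0" using nonneg_antisym[of \<delta>] nonneg_simple d(1) by blast
      then show False using du by simp
    qed
    have arrow_ends: "arrows t = - ?r (x + 1) \<or> arrows t = ?r x"
      using q_end aq ray_period[OF fan, of x] by auto
    show ?thesis
    proof (cases "\<gamma> ! t")
      case False
      then show ?thesis using arrow_ends win u_inv_Suc[OF t] by (intro exI[of _ x]) auto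
    next
      case gt: True
      have uS: "u_inv (Suc t) v = refl \<delta> (u_inv t v)" for v using u_inv_Suc[OF t] gt d(2) by simp
      have uSq: "u_inv (Suc t) (- ?r q) = \<delta>" unfolding uS using u_inv_linear(2)[OF tl, of "?r q"] uq du by simp
      show ?thesis
      \<comment> \<open>The ray that turns negative leaves the window at one end, and its negative enters at the other.\<close>
      proof (cases "q = x + 1")
        case True
        have "u_inv (Suc t) (?r m) \<in> Pos" if m: "x + 1 < m" "m \<le> x + 1 + int n" for m
        proof (cases "m = x + 1 + int n")
          case True
          then have "?r m = - ?r q" using \<open>q = x + 1\<close> ray_period[OF fan, of "x + 1"] by simp
          then show ?thesis using uSq du by simp
        next
          case False
          then show ?thesis unfolding uS using rP[of m] m True by simp
        qed
        then show ?thesis using arrow_ends aq True by (intro exI[of _ "x + 1"]) auto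
      next
        case False
        then have qn: "q = x + int n" using q_end by simp
        then have ax: "arrows t = ?r x" using aq ray_period[OF fan, of x] by simp
        have "u_inv (Suc t) (?r m) \<in> Pos" if m: "x - 1 < m" "m \<le> x - 1 + int n" for m
        proof (cases "m = x")
          case True
          then have "?r m = - ?r q" using qn ray_period[OF fan, of x] by simp
          then show ?thesis using uSq du by simp
        next
          case False
          then show ?thesis unfolding uS using rP[of m] m qn by simp
        qed
        then show ?thesis using arrow_ends ax by (intro exI[of _ "x - 1"]) auto
      qed
    qed
  qed
qed

lemma walk_exists:
  assumes fan: "fan \<theta> n c d"
  shows "\<exists>f :: nat \<Rightarrow> int. f 0 = 0 \<and>
    (\<forall>t m. t \<le> length s \<longrightarrow> f t < m \<longrightarrow> m \<le> f t + int n \<longrightarrow> u_inv t (ray \<theta> c d m) \<in> Pos) \<and>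
    (\<forall>t. t < length s \<longrightarrow> in_plane c d (arrows t) \<longrightarrow>
       arrows t = - ray \<theta> c d (f t + 1) \<or> arrows t = ray \<theta> c d (f t)) \<and>
    (\<forall>t. t < length s \<longrightarrow> f (Suc t) = f t \<or> f (Suc t) = f t + 1 \<and> arrows t = - ray \<theta> c d (f t + 1) \<or>
       f (Suc t) = f t - 1 \<and> arrows t = ray \<theta> c d (f t))"
proof -
  define P where "P = (\<lambda>t x. (t = 0 \<longrightarrow> x = 0) \<and> (t \<le> length s \<longrightarrow>
      (\<forall>m. x < m \<longrightarrow> m \<le> x + int n \<longrightarrow> u_inv t (ray \<theta> c d m) \<in> Pos)))"
  define Q where "Q = (\<lambda>t x y. t < length s \<longrightarrow>
      (in_plane c d (arrows t) \<longrightarrow> arrows t = - ray \<theta> c d (x + 1) \<or> arrows t = ray \<theta> c d x) \<and>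
      (y = x \<or> y = x + 1 \<and> arrows t = - ray \<theta> c d (x + 1) \<or> y = x - 1 \<and> arrows t = ray \<theta> c d x))"
  have "P 0 0" unfolding P_def using ray_Pos[OF fan] by (auto simp: inv_id[unfolded id_def] id_def)
  moreover have "\<exists>y. P (Suc t) y \<and> Q t x y" if "P t x" for t x
  proof (cases "t < length s")
    case True
    have "\<And>m. x < m \<Longrightarrow> m \<le> x + int n \<Longrightarrow> u_inv t (ray \<theta> c d m) \<in> Pos" using that True by (auto simp: P_def)
    from walk_step[OF fan True this] show ?thesis unfolding P_def Q_def by auto
  next
    case False
    then show ?thesis by (auto simp: P_def Q_def)
  qed
  ultimately obtain f where f: "\<And>t. P t (f t)" "\<And>t. Q t (f t) (f (Suc t))" "f 0 = 0"
    using dependent_nat_choice[of P Q] by (metis P_def)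
  show ?thesis by (rule exI[of _ f]) (use f in \<open>auto simp: P_def Q_def\<close>)
qed

end

section \<open>Links through dihedral cycles\<close>

lemma ray_swap: "fan \<theta> n c d \<Longrightarrow> ray \<theta> d c m = ray \<theta> c d (int n + 1 - m)"
  unfolding ray_def using rho_swap[of n \<theta> d c "real_of_int m"] by (simp add: fan_def)

lemma in_plane_trans:
  assumes "in_plane a b c" "in_plane a b d" "in_plane c d v" shows "in_plane a b v"
proof -
  obtain p1 q1 where c: "c = p1 *\<^sub>R a + q1 *\<^sub>R b" using assms(1) unfolding in_plane_def by blast
  obtain p2 q2 where d: "d = p2 *\<^sub>R a + q2 *\<^sub>R b" using assms(2) unfolding in_plane_def by blast
  obtain p q where v: "v = p *\<^sub>R c + q *\<^sub>R d" using assms(3) unfolding in_plane_def by blast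
  have "v = (p * p1 + q * p2) *\<^sub>R a + (p * q1 + q * q2) *\<^sub>R b"
    unfolding v c d by (simp add: algebra_simps)
  then show ?thesis by (rule in_planeI)
qed

lemma root_expression_alternating:
  assumes "fan \<theta> n c d" shows "root_expression (alternating (refl c) (refl d) z)"
proof -
  have "{refl c, refl d} \<subseteq> T" using fan_simps(1,2)[OF assms] T_iff by blast
  then show ?thesis unfolding root_expression_def using set_alternating[of "refl c" "refl d" z] by blast
qed

text \<open>
  In terms of walks: using every factor, one rises at every step.
\<close>

lemma arr_ones:
  assumes fan: "fan \<theta> n c d" and i: "i < z"
  shows "arr (alternating (refl c) (refl d) z) (zeros_at (int z) {}) i = - ray \<theta> c d (int i + 1)"
proof -
  let ?t = "alternating (refl c) (refl d) z" and ?\<delta> = "zeros_at (int z) {}"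
  have S: "?\<delta> \<in> Sub ?t" by (simp add: Sub_def)
  have re: "root_expression ?t" by (rule root_expression_alternating[OF fan])
  have bef: "before ?t ?\<delta> k = word_prod (alternating (refl c) (refl d) k)" if "k \<le> z" for k
    using that
  proof (induction k)
    case 0
    show ?case by (simp only: before_0 alternating_0 word_prod_Nil)
  next
    case (Suc k)
    then have "before ?t ?\<delta> (Suc k) = before ?t ?\<delta> k \<circ> (if even k then refl c else refl d)"
      using before_Suc[OF S, of k] by (simp add: nth_zeros_at)
    also have "\<dots> = word_prod (alternating (refl c) (refl d) k) \<circ> (if even k then refl c else refl d)"
      using Suc by simp
    finally show ?case unfolding altc_Suc[OF fan] .
  qed
  have "rt (?t ! i) = (if even i then c else d)"
    using i fan_simps(1,2)[OF fan] by (simp add: root_of_refl)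
  then have "arr ?t ?\<delta> i = before ?t ?\<delta> i (- (if even i then c else d))" unfolding arrow_def by simp
  also have "\<dots> = - before ?t ?\<delta> i (if even i then c else d)"
    using before_isometry[OF re S, of i] i by (simp only: isometry_simps length_alternating less_imp_le)
  also have "before ?t ?\<delta> i (if even i then c else d) = ray \<theta> c d (int i + 1)"
    unfolding bef[OF less_imp_le[OF i]] by (rule alternating_ray(1)[OF fan])
  finally show ?thesis .
qed

text \<open>
  In terms of walks: one rises to \<open>m - 1\<close>, where the factor is omitted, and falls from there on.
\<close>

lemma arr_one_zero:
  assumes fan: "fan \<theta> n c d" and i: "i < z" and m: "1 \<le> m" "m \<le> z"
  shows "arr (alternating (refl c) (refl d) z) (zeros_at (int z) {int m}) i =
    (if i < m then - ray \<theta> c d (int i + 1) else ray \<theta> c d (2 * int m - int i - 1))"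
proof -
  let ?t = "alternating (refl c) (refl d) z" and ?\<delta> = "zeros_at (int z) {}"
  have S: "?\<delta> \<in> Sub ?t" by (simp add: Sub_def)
  have e: "zeros_at (int z) {int m} = flip (m - 1) ?\<delta>"
    by (rule nth_equalityI) (use m in \<open>auto simp: nth_zeros_at nth_flip\<close>)
  have m1: "m - 1 < length ?t" "i < length ?t" using m i by auto
  have im: "int (m - 1) + 1 = int m" using m by simp
  have "arr ?t (zeros_at (int z) {int m}) i =
      (if m - 1 < i then refl (- ray \<theta> c d (int m)) (- ray \<theta> c d (int i + 1)) else - ray \<theta> c d (int i + 1))"
    unfolding e arr_flip[OF root_expression_alternating[OF fan] S m1]
    using arr_ones[OF fan i] arr_ones[OF fan, of "m - 1" z] m im by simp
  also have "refl (- ray \<theta> c d (int m)) (- ray \<theta> c d (int i + 1)) = ray \<theta> c d (2 * int m - int i - 1)"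
    using ray_refl[OF fan, of "int m" "int i + 1"] by (simp add: algebra_simps)
  finally show ?thesis using m by (auto simp: not_less)
qed

context
  fixes s :: "('v \<Rightarrow> 'v) list" and w :: "'v \<Rightarrow> 'v" and \<gamma> :: subexpression
  assumes sS: "set s \<subseteq> S" and gw: "\<gamma> \<in> vertices s w"
begin

lemma \<gamma>_Sub: "\<gamma> \<in> Sub s"
  using gw by (simp add: vertices_def)

lemma letters_root_expression: "root_expression s"
  using sS S_T by (auto simp: root_expression_def)

lemma dihedral_half: "fan \<theta> n c d \<Longrightarrow> card (dihedral c d) div 2 = n"
  using card_dihedral[of \<theta> n c d] by simp

text \<open>
  For each \<open>m\<close> from \<open>x\<close> to \<open>y - 1\<close> the cycle of the first family with parameter \<open>m\<close> links the pairs for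
  the rays \<open>m\<close> and \<open>m + 1\<close>.
\<close>

lemma linked_straight:
  assumes fan: "fan \<theta> n c d" and xy: "1 \<le> x" "x < y" "y \<le> n"
    and mono: "\<And>i j. i < j \<Longrightarrow> j < n + y \<Longrightarrow> p i < p j" and range: "\<And>i. i < n + y \<Longrightarrow> p i < length s"
    and match: "\<And>i. i < n + y \<Longrightarrow> arr s \<gamma> (p i) = - ray \<theta> c d (int i + 1)"
  shows "linked s w \<gamma> {\<gamma>, flip2 (p (x - 1)) (p (x + n - 1)) \<gamma>} {\<gamma>, flip2 (p (y - 1)) (p (y + n - 1)) \<gamma>}"
proof -
  have step: "linked s w \<gamma> {\<gamma>, flip2 (p (m - 1)) (p (m + n - 1)) \<gamma>} {\<gamma>, flip2 (p m) (p (m + n)) \<gamma>}"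
    if m: "1 \<le> m" "m < y" for m
  proof (rule linked_sym)
    define z where "z = m + n + 1"
    let ?t = "alternating (refl c) (refl d) z" and ?\<delta> = "zeros_at (int z) {}"
    have zn: "z \<le> n + y" using m by (simp add: z_def)
    note ar = arr_ones[OF fan, of _ z]
    have per: "ray \<theta> c d (int (m + n - 1) + 1) = - ray \<theta> c d (int (m - 1) + 1)"
      "ray \<theta> c d (int (m + n) + 1) = - ray \<theta> c d (int m + 1)"
      using ray_period[OF fan, of "int m"] ray_period[OF fan, of "int m + 1"] m by (simp_all add: algebra_simps)
    show "linked s w \<gamma> {\<gamma>, flip2 (p m) (p (m + n)) \<gamma>} {\<gamma>, flip2 (p (m - 1)) (p (m + n - 1)) \<gamma>}"
    proof (rule linked_Cyc1[OF letters_root_expression gw dihedral_is_reflection_subgroup[OF fan] finite_dihedral[OF fan]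
          canonical_generators_dihedral[OF fan] refl_c_ne_refl_d[OF fan] dihedral_half[OF fan] m(1) _ z_def refl refl])
      show "m < n" using m xy by simp
      show "pm_eq (arr ?t ?\<delta> (m - 1)) (arr ?t ?\<delta> (m + n - 1))"
        using ar[of "m - 1"] ar[of "m + n - 1"] per m by (simp add: z_def)
      show "pm_eq (arr ?t ?\<delta> m) (arr ?t ?\<delta> (m + n))"
        using ar[of m] ar[of "m + n"] per m by (simp add: z_def)
      show "arr ?t ?\<delta> (m + n - 1) \<in> Pos"
        using ar[of "m + n - 1"] per m xy ray_Pos[OF fan, of "int m"] by (simp add: z_def)
      show "arr ?t ?\<delta> (m + n) \<in> Pos"
        using ar[of "m + n"] per m xy ray_Pos[OF fan, of "int m + 1"] by (simp add: z_def)
      show "strict_mono_on {..<z} p" using mono zn by (auto intro!: strict_mono_onI)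
      show "p i < length s" if "i < z" for i using range that zn by simp
      show "arr s \<gamma> (p i) = arr ?t ?\<delta> i" if "i < z" for i using match ar that zn by simp
    qed
  qed
  have "m \<le> y \<longrightarrow> linked s w \<gamma> {\<gamma>, flip2 (p (x - 1)) (p (x + n - 1)) \<gamma>} {\<gamma>, flip2 (p (m - 1)) (p (m + n - 1)) \<gamma>}"
    if "x \<le> m" for m
    using that
  proof (induction m rule: dec_induct)
    case base
    show ?case using linked_refl by blast
  next
    case (step m)
    show ?case
    proof
      assume my: "Suc m \<le> y"
      have "linked s w \<gamma> {\<gamma>, flip2 (p (m - 1)) (p (m + n - 1)) \<gamma>} {\<gamma>, flip2 (p m) (p (m + n)) \<gamma>}"
        by (rule \<open>\<And>m. 1 \<le> m \<Longrightarrow> m < y \<Longrightarrow> linked s w \<gamma> {\<gamma>, flip2 (p (m - 1)) (p (m + n - 1)) \<gamma>} {\<gamma>, flip2 (p m) (p (m + n)) \<gamma>}\<close>)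
          (use my step xy in auto)
      then show "linked s w \<gamma> {\<gamma>, flip2 (p (x - 1)) (p (x + n - 1)) \<gamma>} {\<gamma>, flip2 (p (Suc m - 1)) (p (Suc m + n - 1)) \<gamma>}"
        using linked_trans step.IH my by simp
    qed
  qed
  then show ?thesis using xy by simp
qed

text \<open>
  This is a single cycle of the second family. Its third condition holds because the reflection in
  \<open>\<rho> x\<close> exchanges the rays \<open>y\<close> and \<open>2 * x + n - y\<close>, up to sign.
\<close>

lemma linked_turning:
  assumes fan: "fan \<theta> n c d" and xy: "1 \<le> x" "x < y" "y \<le> n" and z: "z = 2 * x + 2 * n - y"
    and mono: "\<And>i j. i < j \<Longrightarrow> j < z \<Longrightarrow> p i < p j" and range: "\<And>i. i < z \<Longrightarrow> p i < length s"
    and match: "\<And>i. i < z \<Longrightarrow> arr s \<gamma> (p i) =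
      (if i < x + n then - ray \<theta> c d (int i + 1) else ray \<theta> c d (2 * int (x + n) - int i - 1))"
  shows "linked s w \<gamma> {\<gamma>, flip2 (p (x - 1)) (p (x + n - 1)) \<gamma>} {\<gamma>, flip2 (p (y - 1)) (p (z - 1)) \<gamma>}"
proof (rule linked_sym)
  let ?t = "alternating (refl c) (refl d) z" and ?\<delta> = "zeros_at (int z) {int (x + n)}"
  have xz: "1 \<le> x + n" "x + n \<le> z" using xy z by auto
  note ar = arr_one_zero[OF fan _ xz]
  have idx: "int (x - 1) + 1 = int x" "int (x + n - 1) + 1 = int x + int n" "int (y - 1) + 1 = int y"
    "2 * int (x + n) - int (z - 1) - 1 = int y" "int (2 * x + n - y - 1) + 1 = 2 * int x + int n - int y"
    using xy z by auto
  have lt: "x - 1 < z" "x - 1 < x + n" "x + n - 1 < z" "x + n - 1 < x + n" "y - 1 < z" "y - 1 < x + n"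
    "z - 1 < z" "\<not> z - 1 < x + n" "2 * x + n - y - 1 < z" "2 * x + n - y - 1 < x + n"
    using xy z by auto
  have a1: "arr ?t ?\<delta> (x - 1) = - ray \<theta> c d (int x)"
    using ar[OF lt(1)] unfolding if_P[OF lt(2)] idx .
  have a2: "arr ?t ?\<delta> (x + n - 1) = ray \<theta> c d (int x)"
    using ar[OF lt(3)] unfolding if_P[OF lt(4)] idx ray_period[OF fan] minus_minus .
  have a3: "arr ?t ?\<delta> (y - 1) = - ray \<theta> c d (int y)"
    using ar[OF lt(5)] unfolding if_P[OF lt(6)] idx .
  have a4: "arr ?t ?\<delta> (z - 1) = ray \<theta> c d (int y)"
    using ar[OF lt(7)] unfolding if_not_P[OF lt(8)] idx .
  have a5: "arr ?t ?\<delta> (2 * x + n - y - 1) = - ray \<theta> c d (2 * int x + int n - int y)"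
    using ar[OF lt(9)] unfolding if_P[OF lt(10)] idx .
  have a6: "refl (- ray \<theta> c d (int x)) (- ray \<theta> c d (2 * int x + int n - int y)) = - ray \<theta> c d (int y)"
    using ray_refl[OF fan, of "int x" "2 * int x + int n - int y"] ray_period_minus[OF fan, of "int y"] by simp
  show "linked s w \<gamma> {\<gamma>, flip2 (p (y - 1)) (p (z - 1)) \<gamma>} {\<gamma>, flip2 (p (x - 1)) (p (x + n - 1)) \<gamma>}"
  proof (rule linked_Cyc2[OF letters_root_expression gw dihedral_is_reflection_subgroup[OF fan] finite_dihedral[OF fan]
        canonical_generators_dihedral[OF fan] refl_c_ne_refl_d[OF fan] dihedral_half[OF fan] xy z refl refl])
    show "pm_eq (arr ?t ?\<delta> (x - 1)) (arr ?t ?\<delta> (x + n - 1))" unfolding a1 a2 by simp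
    show "pm_eq (arr ?t ?\<delta> (y - 1)) (arr ?t ?\<delta> (z - 1))" unfolding a3 a4 by simp
    show "pm_eq (refl (arr ?t ?\<delta> (x - 1)) (arr ?t ?\<delta> (2 * x + n - y - 1))) (arr ?t ?\<delta> (z - 1))"
      unfolding a1 a5 a4 a6 by simp
    show "arr ?t ?\<delta> (x + n - 1) \<in> Pos" unfolding a2 by (rule ray_Pos[OF fan]) (use xy in auto)
    show "arr ?t ?\<delta> (z - 1) \<in> Pos" unfolding a4 by (rule ray_Pos[OF fan]) (use xy in auto)
    show "strict_mono_on {..<z} p" using mono by (auto intro!: strict_mono_onI)
    show "p i < length s" if "i < z" for i using range that by simp
    show "arr s \<gamma> (p i) = arr ?t ?\<delta> i" if "i < z" for i using match[OF that] ar[OF that] by simp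
  qed
qed

text \<open>
  At a position with value \<open>f\<close> of the walk, the rays \<open>f + 1, \<dots>, f + n\<close> are not inverted and the
  rays \<open>f - n + 1, \<dots>, f\<close> are. The hypotheses thus say that the walk stays between \<open>y - n\<close> and \<open>y - 1\<close>
  until \<open>h\<close>, steps up at \<open>h\<close>, and stays between \<open>y\<close> and \<open>y + n - 1\<close> until \<open>l\<close>. The arrow \<open>\<rho> x\<close> at \<open>k\<close> then
  forces the value \<open>n + x - 1\<close>. For the arrow \<open>\<rho> y\<close> at \<open>l\<close> there are two possible values, at the two ends
  of the range: the upper one requires all rising steps up to it, and the lower one requires
  falling from \<open>n + x - 1\<close> to \<open>y\<close> after \<open>k\<close>. The pairs that are linked this way are chosen among these
  steps and need not be the original ones.
\<close>

lemma linked_in_fan: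
  assumes fan: "fan \<theta> n c d" and xy: "1 \<le> x" "x < y" "y \<le> n"
    and ord: "h < k" "k < l" "l < length s"
    and h: "pm_eq (arr s \<gamma> h) (ray \<theta> c d (int y))" "\<And>t. t \<le> h \<Longrightarrow> \<not> inverted s \<gamma> t (ray \<theta> c d (int y))"
      "\<And>t. h < t \<Longrightarrow> t \<le> l \<Longrightarrow> inverted s \<gamma> t (ray \<theta> c d (int y))" "inverted s \<gamma> h (ray \<theta> c d (int x))"
    and ak: "arr s \<gamma> k = ray \<theta> c d (int x)" and al: "arr s \<gamma> l = ray \<theta> c d (int y)"
  shows "\<exists>i' k' j' l'. lowering s \<gamma> i' k' \<and> arr s \<gamma> k' = ray \<theta> c d (int x) \<and>
    lowering s \<gamma> j' l' \<and> arr s \<gamma> l' = ray \<theta> c d (int y) \<and>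
    linked s w \<gamma> {\<gamma>, flip2 i' k' \<gamma>} {\<gamma>, flip2 j' l' \<gamma>}"
proof -
  let ?r = "ray \<theta> c d" and ?X = "int x" and ?Y = "int y" and ?N = "int n"
  have n2: "2 \<le> n" by (rule fan_simps(4)[OF fan])
  have PX: "?r ?X \<in> Pos" and PY: "?r ?Y \<in> Pos" using ray_Pos[OF fan] xy by auto
  obtain f :: "nat \<Rightarrow> int" where f: "f 0 = 0 \<and>
    (\<forall>t m. t \<le> length s \<longrightarrow> f t < m \<longrightarrow> m \<le> f t + ?N \<longrightarrow> fun_inv (before s \<gamma> t) (?r m) \<in> Pos) \<and>
    (\<forall>t. t < length s \<longrightarrow> in_plane c d (arr s \<gamma> t) \<longrightarrow>
       arr s \<gamma> t = - ?r (f t + 1) \<or> arr s \<gamma> t = ?r (f t)) \<and>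
    (\<forall>t. t < length s \<longrightarrow> f (Suc t) = f t \<or> f (Suc t) = f t + 1 \<and> arr s \<gamma> t = - ?r (f t + 1) \<or>
       f (Suc t) = f t - 1 \<and> arr s \<gamma> t = ?r (f t))"
    using walk_exists[OF sS \<gamma>_Sub fan] by (elim exE) simp
  have f0: "f 0 = 0"
    and win: "\<And>t m. t \<le> length s \<Longrightarrow> f t < m \<Longrightarrow> m \<le> f t + ?N \<Longrightarrow> fun_inv (before s \<gamma> t) (?r m) \<in> Pos"
    and ends: "\<And>t. t < length s \<Longrightarrow> in_plane c d (arr s \<gamma> t) \<Longrightarrow> arr s \<gamma> t = - ?r (f t + 1) \<or> arr s \<gamma> t = ?r (f t)"
    and step: "\<And>t. t < length s \<Longrightarrow> f (Suc t) = f t \<or> f (Suc t) = f t + 1 \<and> arr s \<gamma> t = - ?r (f t + 1) \<or>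
       f (Suc t) = f t - 1 \<and> arr s \<gamma> t = ?r (f t)"
    using f by simp_all
  have out: "\<not> inverted s \<gamma> t (?r m)" if "t \<le> length s" "f t < m" "m \<le> f t + ?N" for t m
    using win[OF that] not_Pos_both unfolding inverted_def by blast
  have neg: "fun_inv (before s \<gamma> t) (?r (m + ?N)) = - fun_inv (before s \<gamma> t) (?r m)" if "t \<le> length s" for t m
    unfolding ray_period[OF fan] using u_inv_linear(2)[OF sS \<gamma>_Sub that] .
  have "in": "inverted s \<gamma> t (?r m)" if "t \<le> length s" "f t - ?N < m" "m \<le> f t" for t m
    using win[of t "m + ?N"] that neg[of t m] unfolding inverted_def by simp
  have up: "arr s \<gamma> t = - ?r (f t + 1)" if "t < length s" "f (Suc t) = f t + 1" for t
    using step[OF that(1)] that(2) by auto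
  have down: "arr s \<gamma> t = ?r (f t)" if "t < length s" "f (Suc t) = f t - 1" for t
    using step[OF that(1)] that(2) by auto
  have b1: "?Y - ?N \<le> f t \<and> f t \<le> ?Y - 1" if "t \<le> h" for t
    using that
  proof (induction t)
    case 0
    then show ?case using f0 xy by simp
  next
    case (Suc t)
    then have IH: "?Y - ?N \<le> f t" "f t \<le> ?Y - 1" and tl: "t < length s" "Suc t \<le> length s" using ord by auto
    have ni: "\<not> inverted s \<gamma> (Suc t) (?r ?Y)" by (rule h(2)[OF Suc.prems])
    have "f (Suc t) \<noteq> ?Y" using "in"[OF tl(2), of ?Y] ni n2 by auto
    moreover have "f (Suc t) \<noteq> ?Y - ?N - 1"
    proof
      assume e: "f (Suc t) = ?Y - ?N - 1"
      have "fun_inv (before s \<gamma> (Suc t)) (?r (?Y - ?N)) \<in> Pos" by (rule win[OF tl(2)]) (use e n2 in auto)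
      then have "- fun_inv (before s \<gamma> (Suc t)) (?r ?Y) \<in> Pos" using neg[OF tl(2), of "?Y - ?N"] by simp
      then show False using ni by (simp add: inverted_def)
    qed
    ultimately show ?case using step[OF tl(1)] IH by auto
  qed
  have hl: "h < length s" "Suc h \<le> length s" using ord by auto
  have fh: "f h = ?Y - 1"
  proof -
    have b: "?Y - ?N \<le> f h" "f h \<le> ?Y - 1" using b1[of h] by auto
    have xf: "?X \<le> f h"
    proof (rule ccontr)
      assume "\<not> ?thesis"
      then show False using out[of h ?X] h(4) b xy hl by auto
    qed
    have "arr s \<gamma> h \<noteq> ?r ?Y" using arrow_eq_iff_inverted[OF sS \<gamma>_Sub hl(1) PY h(1)] h(2)[of h] by simp
    then have ah: "arr s \<gamma> h = - ?r ?Y" using h(1) unfolding pm_eq_def by blast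
    have "in_plane c d (arr s \<gamma> h)" unfolding ah using ray_in_plane[OF fan] by simp
    from ends[OF hl(1) this] show ?thesis
    proof
      assume "arr s \<gamma> h = - ?r (f h + 1)"
      then have "?r (f h + 1) = ?r ?Y" using ah by simp
      then have "f h + 1 = ?Y" by (rule ray_inject[OF fan]) (use b n2 in linarith)
      then show ?thesis by simp
    next
      assume "arr s \<gamma> h = ?r (f h)"
      then have "?N \<le> \<bar>f h - ?Y\<bar>" using ray_ne_neg[OF fan, of "f h" ?Y] ah by simp
      then show ?thesis using xf b xy by linarith
    qed
  qed
  have iSh: "inverted s \<gamma> (Suc h) (?r ?Y)" by (rule h(3)) (use ord in auto)
  have fSh: "f (Suc h) = ?Y"
  proof -
    have "\<not> f (Suc h) < ?Y"
    proof
      assume lt: "f (Suc h) < ?Y"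
      moreover have "?Y \<le> f (Suc h) + ?N" using step[OF hl(1)] fh n2 by auto
      ultimately show False using out[OF hl(2)] iSh by blast
    qed
    then show ?thesis using step[OF hl(1)] fh by auto
  qed
  have b4: "?Y \<le> f t \<and> f t \<le> ?Y + ?N - 1" if "Suc h \<le> t" "t \<le> l" for t
    using that
  proof (induction t rule: dec_induct)
    case base
    then show ?case using fSh n2 by simp
  next
    case (step t)
    then have IH: "?Y \<le> f t" "f t \<le> ?Y + ?N - 1" and tl: "t < length s" "Suc t \<le> length s" using ord by auto
    have i: "inverted s \<gamma> (Suc t) (?r ?Y)" by (rule h(3)) (use step in auto)
    have "f (Suc t) \<noteq> ?Y - 1" using out[OF tl(2), of ?Y] i n2 by auto
    moreover have "f (Suc t) \<noteq> ?Y + ?N"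
    proof
      assume e: "f (Suc t) = ?Y + ?N"
      have "?r (?Y + ?N + ?N) = ?r ?Y" by (simp only: ray_period[OF fan] minus_minus)
      moreover have "\<not> inverted s \<gamma> (Suc t) (?r (?Y + ?N + ?N))" by (rule out[OF tl(2)]) (use e n2 in auto)
      ultimately show False using i by simp
    qed
    moreover have "f (Suc t) = f t \<or> f (Suc t) = f t + 1 \<or> f (Suc t) = f t - 1"
      using \<open>\<And>t. t < length s \<Longrightarrow> f (Suc t) = f t \<or> f (Suc t) = f t + 1 \<and> arr s \<gamma> t = - ?r (f t + 1) \<or>
       f (Suc t) = f t - 1 \<and> arr s \<gamma> t = ?r (f t)\<close>[OF tl(1)] by auto
    ultimately show ?case using IH by linarith
  qed
  have kl: "k < length s" using ord by simp
  have fk: "f k = ?N + ?X - 1"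
  proof -
    have b: "?Y \<le> f k" "f k \<le> ?Y + ?N - 1" using b4[of k] ord by auto
    have "in_plane c d (arr s \<gamma> k)" unfolding ak by (rule ray_in_plane[OF fan])
    from ends[OF kl this] show ?thesis
    proof
      assume "arr s \<gamma> k = - ?r (f k + 1)"
      then have "?r ?X = ?r (f k + 1 - ?N)" unfolding ak using ray_period_minus[OF fan, of "f k + 1"] by simp
      then have "?X = f k + 1 - ?N" by (rule ray_inject[OF fan]) (use b xy n2 in linarith)
      then show ?thesis by simp
    next
      assume "arr s \<gamma> k = ?r (f k)"
      then have "?r ?X = ?r (f k)" unfolding ak .
      then have "?X = f k" by (rule ray_inject[OF fan]) (use b xy n2 in linarith)
      then show ?thesis using b xy by simp
    qed
  qed
  have fl: "f l = ?Y + ?N - 1 \<or> f l = ?Y"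
  proof -
    have b: "?Y \<le> f l" "f l \<le> ?Y + ?N - 1" using b4[of l] ord by auto
    have "in_plane c d (arr s \<gamma> l)" unfolding al by (rule ray_in_plane[OF fan])
    from ends[OF ord(3) this] show ?thesis
    proof
      assume "arr s \<gamma> l = - ?r (f l + 1)"
      then have "?r ?Y = ?r (f l + 1 - ?N)" unfolding al using ray_period_minus[OF fan, of "f l + 1"] by simp
      then have "?Y = f l + 1 - ?N" by (rule ray_inject[OF fan]) (use b n2 in linarith)
      then show ?thesis by simp
    next
      assume "arr s \<gamma> l = ?r (f l)"
      then have "?r ?Y = ?r (f l)" unfolding al .
      then have "?Y = f l" by (rule ray_inject[OF fan]) (use b n2 in linarith)
      then show ?thesis by simp
    qed
  qed
  have lowering: "lowering s \<gamma> a b" if "a < b" "b < length s" "arr s \<gamma> a = - v" "arr s \<gamma> b = v" "v \<in> Pos" for a b v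
    using that by (simp add: lowering_def)
  from fl show ?thesis
  proof
    assume fl: "f l = ?Y + ?N - 1"
    obtain \<tau> where \<tau>: "\<And>i. i < n + y - 1 \<Longrightarrow> 0 \<le> \<tau> i \<and> \<tau> i < l \<and> f (\<tau> i) = 0 + int i \<and> f (Suc (\<tau> i)) = 0 + int i + 1"
      and \<tau>_mono: "\<And>i j. i < j \<Longrightarrow> j < n + y - 1 \<Longrightarrow> \<tau> i < \<tau> j"
    proof (rule rising_times[of 0 l f 0 "n + y - 1"])
      show "f (Suc t) \<le> f t + 1" if "0 \<le> t" "t < l" for t using step[of t] that ord by auto
      show "0 + int (n + y - 1) \<le> f l" using fl xy by simp
    qed (use f0 in auto)
    define p where "p = (\<lambda>i. if i < n + y - 1 then \<tau> i else l)"
    have mono: "p i < p j" if "i < j" "j < n + y" for i j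
      using that \<tau>_mono[of i j] \<tau>[of i] by (auto simp: p_def)
    have range: "p i < length s" if "i < n + y" for i
      using that \<tau>[of i] ord by (auto simp: p_def)
    have match: "arr s \<gamma> (p i) = - ?r (int i + 1)" if "i < n + y" for i
    proof (cases "i < n + y - 1")
      case True
      then show ?thesis using up[of "\<tau> i"] \<tau>[OF True] ord by (simp add: p_def)
    next
      case False
      then have "int i + 1 = ?Y + ?N" using that by linarith
      then show ?thesis using False al by (simp add: p_def ray_period[OF fan])
    qed
    have a: "arr s \<gamma> (p (m - 1)) = - ?r (int m)" "arr s \<gamma> (p (m + n - 1)) = ?r (int m)" if "1 \<le> m" "m \<le> y" for m
    proof -
      have e: "int (m - 1) + 1 = int m" "int (m + n - 1) + 1 = int m + ?N" using that by auto
      show "arr s \<gamma> (p (m - 1)) = - ?r (int m)" using match[of "m - 1"] that n2 unfolding e by simp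
      show "arr s \<gamma> (p (m + n - 1)) = ?r (int m)"
        using match[of "m + n - 1"] that n2 unfolding e by (simp add: ray_period[OF fan])
    qed
    have "lowering s \<gamma> (p (x - 1)) (p (x + n - 1))"
      by (rule lowering[OF _ _ a[of x] PX]) (use mono range xy n2 in auto)
    moreover have "lowering s \<gamma> (p (y - 1)) (p (y + n - 1))"
      by (rule lowering[OF _ _ a[of y] PY]) (use mono range xy n2 in auto)
    moreover have "arr s \<gamma> (p (x + n - 1)) = ?r ?X" "arr s \<gamma> (p (y + n - 1)) = ?r ?Y" using a xy by auto
    moreover have "linked s w \<gamma> {\<gamma>, flip2 (p (x - 1)) (p (x + n - 1)) \<gamma>} {\<gamma>, flip2 (p (y - 1)) (p (y + n - 1)) \<gamma>}"
      by (rule linked_straight[OF fan xy mono range match])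
    ultimately show ?thesis by blast
  next
    assume fl: "f l = ?Y"
    define z where "z = 2 * x + 2 * n - y"
    obtain \<tau> where \<tau>: "\<And>i. i < n + x - 1 \<Longrightarrow> 0 \<le> \<tau> i \<and> \<tau> i < k \<and> f (\<tau> i) = 0 + int i \<and> f (Suc (\<tau> i)) = 0 + int i + 1"
      and \<tau>_mono: "\<And>i j. i < j \<Longrightarrow> j < n + x - 1 \<Longrightarrow> \<tau> i < \<tau> j"
    proof (rule rising_times[of 0 k f 0 "n + x - 1"])
      show "f (Suc t) \<le> f t + 1" if "0 \<le> t" "t < k" for t using step[of t] that ord by auto
      show "0 + int (n + x - 1) \<le> f k" using fk xy by simp
    qed (use f0 in auto)
    \<comment> \<open>The number of falling steps between \<open>k\<close> and \<open>l\<close>.\<close>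
    define M where "M = n + x - 1 - y"
    have M: "int M = ?N + ?X - 1 - ?Y" using xy by (simp add: M_def)
    \<comment> \<open>A fall at \<open>k\<close> would require the arrow \<open>\<rho> (n + x - 1)\<close>, but the arrow is \<open>\<rho> x\<close>.\<close>
    have fSk: "?N + ?X - 1 \<le> f (Suc k)"
    proof -
      have "f (Suc k) \<noteq> f k - 1"
      proof
        assume "f (Suc k) = f k - 1"
        then have "?r ?X = ?r (f k)" using down[OF kl] ak by simp
        then have "?X = f k" by (rule ray_inject[OF fan]) (use fk n2 in linarith)
        then show False using fk n2 by simp
      qed
      then show ?thesis using step[OF kl] fk by auto
    qed
    obtain \<tau>' where \<tau>': "\<And>i. i < M \<Longrightarrow> Suc k \<le> \<tau>' i \<and> \<tau>' i < l \<and> - f (\<tau>' i) = - (?N + ?X - 1) + int i \<and>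
        - f (Suc (\<tau>' i)) = - (?N + ?X - 1) + int i + 1"
      and \<tau>'_mono: "\<And>i j. i < j \<Longrightarrow> j < M \<Longrightarrow> \<tau>' i < \<tau>' j"
    proof (rule rising_times[of "Suc k" l "\<lambda>t. - f t" "- (?N + ?X - 1)" M])
      show "- f (Suc t) \<le> - f t + 1" if "Suc k \<le> t" "t < l" for t using step[of t] that ord by auto
      show "- (?N + ?X - 1) + int M \<le> - f l" using fl M by simp
      show "Suc k \<le> l" using ord by simp
      show "- f (Suc k) \<le> - (?N + ?X - 1)" using fSk by simp
    qed auto
    define p where "p = (\<lambda>i. if i < n + x - 1 then \<tau> i else if i = n + x - 1 then k
        else if i < z - 1 then \<tau>' (i - (n + x)) else l)"
    have zM: "z - 1 = n + x + M" "1 \<le> z" using xy n2 by (auto simp: z_def M_def)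
    have low: "p i < k" if "i < n + x - 1" for i using \<tau>[OF that] that by (simp add: p_def)
    have high: "k < p j" if "n + x - 1 < j" "j < z" for j
    proof (cases "j < z - 1")
      case True
      then have "j - (n + x) < M" using that zM by simp
      from \<tau>'[OF this] show ?thesis using that True by (simp add: p_def)
    next
      case False
      then show ?thesis using that ord by (simp add: p_def)
    qed
    have pk: "p (n + x - 1) = k" by (simp add: p_def)
    have mono: "p i < p j" if ij: "i < j" "j < z" for i j
    proof -
      consider "j < n + x - 1" | "i < n + x - 1" "n + x - 1 \<le> j" | "i = n + x - 1" | "n + x - 1 < i" using ij by linarith
      then show ?thesis
      proof cases
        case 1
        then show ?thesis using \<tau>_mono[OF ij(1) 1] ij by (simp add: p_def)
      next
        case 2
        then show ?thesis using low[of i] high[of j] pk ij by (cases "j = n + x - 1") auto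
      next
        case 3
        then show ?thesis using pk high[of j] ij by simp
      next
        case 4
        then have iM: "i - (n + x) < M" using ij zM by simp
        have "\<not> i < n + x - 1" "i \<noteq> n + x - 1" "i < z - 1" using 4 ij by linarith+
        then have pi: "p i = \<tau>' (i - (n + x))" unfolding p_def by argo
        show ?thesis
        proof (cases "j < z - 1")
          case True
          have "i - (n + x) < j - (n + x)" "j - (n + x) < M" using 4 True ij zM by auto
          from \<tau>'_mono[OF this] show ?thesis unfolding pi using 4 True ij by (simp add: p_def)
        next
          case False
          then have "p j = l" using 4 ij by (simp add: p_def)
          then show ?thesis unfolding pi using \<tau>'[OF iM] by simp
        qed
      qed
    qed
    have "\<not> z - 1 < n + x - 1" "z - 1 \<noteq> n + x - 1" "\<not> z - 1 < z - 1" using zM xy by linarith+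
    then have plast: "p (z - 1) = l" unfolding p_def by argo
    have range: "p i < length s" if "i < z" for i
    proof (cases "i = z - 1")
      case True
      then show ?thesis using plast ord(3) by simp
    next
      case False
      then have "i < z - 1" "z - 1 < z" using that by linarith+
      from mono[OF this] show ?thesis using plast ord(3) by linarith
    qed
    have match: "arr s \<gamma> (p i) = (if i < x + n then - ?r (int i + 1) else ?r (2 * int (x + n) - int i - 1))" if iz: "i < z" for i
    proof -
      consider "i < n + x - 1" | "i = n + x - 1" | "n + x \<le> i" "i < z - 1" | "n + x \<le> i" "i = z - 1"
        using iz by linarith
      then show ?thesis
      proof cases
        case 1
        then have "i < x + n" "p i = \<tau> i" by (simp_all add: p_def)
        then show ?thesis using up[of "\<tau> i"] \<tau>[OF 1] ord by simp
      next
        case 2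
        then have "int i + 1 = ?X + ?N" "i < x + n" using xy by linarith+
        moreover have "p i = k" using 2 pk by (simp only:)
        ultimately show ?thesis using ak by (simp add: ray_period[OF fan])
      next
        case 3
        then have iM: "i - (n + x) < M" using zM by linarith
        have e: "f (\<tau>' (i - (n + x))) = 2 * int (x + n) - int i - 1"
          using \<tau>'[OF iM] of_nat_diff[OF 3(1), where ?'a = int] by simp
        have "arr s \<gamma> (\<tau>' (i - (n + x))) = ?r (f (\<tau>' (i - (n + x))))"
          by (rule down) (use \<tau>'[OF iM] ord in linarith)+
        moreover have "\<not> i < n + x - 1" "i \<noteq> n + x - 1" "\<not> i < x + n" using 3 xy by linarith+
        moreover from this have "p i = \<tau>' (i - (n + x))" unfolding p_def using 3 by argo
        ultimately show ?thesis unfolding e by (simp only: if_False)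
      next
        case 4
        then have e: "2 * int (x + n) - int i - 1 = ?Y" using xy by (simp add: z_def)
        have "\<not> i < x + n" "p i = l" using 4 plast by (simp_all only: not_less add.commute)
        then show ?thesis using al unfolding e by (simp only: if_False)
      qed
    qed
    have idx: "int (x - 1) + 1 = ?X" "int (y - 1) + 1 = ?Y" using xy by auto
    have pos: "x - 1 < z" "y - 1 < z" "x - 1 < x + n" "y - 1 < x + n" "x - 1 < x + n - 1" "x + n - 1 < z"
      "y - 1 < z - 1" "z - 1 < z"
      using xy n2 unfolding z_def by linarith+
    have a: "arr s \<gamma> (p (x - 1)) = - ?r ?X" "arr s \<gamma> (p (y - 1)) = - ?r ?Y"
      using match[OF pos(1)] match[OF pos(2)] pos(3,4) idx by simp_all
    have pk: "p (x + n - 1) = k" "p (z - 1) = l" using pk plast by (simp_all add: add.commute)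
    have "lowering s \<gamma> (p (x - 1)) (p (x + n - 1))"
      unfolding pk(1) using mono[OF pos(5,6)] by (intro lowering[OF _ kl a(1) ak PX]) (simp only: pk(1))
    moreover have "lowering s \<gamma> (p (y - 1)) (p (z - 1))"
      unfolding pk(2) using mono[OF pos(7,8)] by (intro lowering[OF _ ord(3) a(2) al PY]) (simp only: pk(2))
    moreover have "arr s \<gamma> (p (x + n - 1)) = ?r ?X" "arr s \<gamma> (p (z - 1)) = ?r ?Y" using pk ak al by auto
    moreover have "linked s w \<gamma> {\<gamma>, flip2 (p (x - 1)) (p (x + n - 1)) \<gamma>} {\<gamma>, flip2 (p (y - 1)) (p (z - 1)) \<gamma>}"
      by (rule linked_turning[OF fan xy z_def mono range match])
    ultimately show ?thesis by blast
  qed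
qed

text \<open>
  If the pairs were not linked, no pair with the root \<open>\<alpha>1\<close> would be linked to a pair with the root \<open>\<alpha>2\<close>,
  so all these pairs would interleave. This contradicts the links found in the fan of the plane of the
  two roots. Exchanging the pairs and the ends of the fan settles the remaining orders.
\<close>

theorem linked_lowering:
  assumes low: "lowering s \<gamma> i k" "lowering s \<gamma> j l"
  shows "linked s w \<gamma> {\<gamma>, flip2 i k \<gamma>} {\<gamma>, flip2 j l \<gamma>}"
proof (rule ccontr)
  assume nl: "\<not> ?thesis"
  define \<alpha>1 \<alpha>2 where "\<alpha>1 = arr s \<gamma> k" and "\<alpha>2 = arr s \<gamma> l"
  have ne: "\<alpha>1 \<noteq> \<alpha>2" using linked_same_root[OF letters_root_expression gw low] nl by (auto simp: \<alpha>1_def \<alpha>2_def)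
  have nl': "\<not> linked s w \<gamma> {\<gamma>, flip2 i' k' \<gamma>} {\<gamma>, flip2 j' l' \<gamma>}"
    if "lowering s \<gamma> i' k'" "arr s \<gamma> k' = \<alpha>1" "lowering s \<gamma> j' l'" "arr s \<gamma> l' = \<alpha>2" for i' k' j' l'
    using linked_same_root[OF letters_root_expression gw low(1) that(1)] linked_same_root[OF letters_root_expression gw that(3) low(2)] that nl
      linked_trans unfolding \<alpha>1_def \<alpha>2_def by metis
  have NI: "(i' < j' \<and> j' < k' \<and> k' < l') \<or> (j' < i' \<and> i' < l' \<and> l' < k')"
    if l1: "lowering s \<gamma> i' k'" "arr s \<gamma> k' = \<alpha>1" and l2: "lowering s \<gamma> j' l'" "arr s \<gamma> l' = \<alpha>2" for i' k' j' l'
  proof -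
    note n = nl'[OF l1 l2]
    have P: "\<alpha>1 \<in> Pos" "\<alpha>2 \<in> Pos" using l1 l2 by (auto simp: lowering_def)
    have no: "\<not> (pm_eq (arr s \<gamma> t) \<alpha>1 \<and> pm_eq (arr s \<gamma> t) \<alpha>2)" for t
      using P ne Pos_pm_eq pm_eq_sym pm_eq_trans by blast
    have pm: "pm_eq (arr s \<gamma> i') \<alpha>1" "pm_eq (arr s \<gamma> k') \<alpha>1" "pm_eq (arr s \<gamma> j') \<alpha>2" "pm_eq (arr s \<gamma> l') \<alpha>2"
      using l1 l2 by (auto simp: lowering_def)
    have d: "i' \<noteq> j'" "i' \<noteq> l'" "k' \<noteq> j'" "k' \<noteq> l'" using no pm by blast+
    have o: "i' < k'" "j' < l'" using l1 l2 by (auto simp: lowering_def)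
    have "\<not> k' < j'" using linked_disjoint[OF letters_root_expression gw l1(1) l2(1)] n by blast
    moreover have "\<not> l' < i'" using linked_disjoint[OF letters_root_expression gw l2(1) l1(1)] n linked_sym by blast
    moreover have "\<not> (i' < j' \<and> l' < k')" using linked_nested[OF letters_root_expression gw l1(1) l2(1)] n by blast
    moreover have "\<not> (j' < i' \<and> k' < l')" using linked_nested[OF letters_root_expression gw l2(1) l1(1)] n linked_sym by blast
    ultimately show ?thesis using d o by linarith
  qed
  \<comment> \<open>The argument is symmetric in the two roots, which are therefore generalised here.\<close>
  have core: False
    if low: "lowering s \<gamma> i k" "lowering s \<gamma> j l" and a: "arr s \<gamma> k = \<alpha>1" "arr s \<gamma> l = \<alpha>2" and ne: "\<alpha>1 \<noteq> \<alpha>2"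
      and ord: "i < j" "j < k" "k < l"
      and NI: "\<And>i' k' j' l'. lowering s \<gamma> i' k' \<Longrightarrow> arr s \<gamma> k' = \<alpha>1 \<Longrightarrow> lowering s \<gamma> j' l' \<Longrightarrow> arr s \<gamma> l' = \<alpha>2 \<Longrightarrow>
        (i' < j' \<and> j' < k' \<and> k' < l') \<or> (j' < i' \<and> i' < l' \<and> l' < k')"
      and nl': "\<And>i' k' j' l'. lowering s \<gamma> i' k' \<Longrightarrow> arr s \<gamma> k' = \<alpha>1 \<Longrightarrow> lowering s \<gamma> j' l' \<Longrightarrow> arr s \<gamma> l' = \<alpha>2 \<Longrightarrow>
        \<not> linked s w \<gamma> {\<gamma>, flip2 i' k' \<gamma>} {\<gamma>, flip2 j' l' \<gamma>}"
    for i k j l \<alpha>1 \<alpha>2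
  proof -
    have P: "\<alpha>1 \<in> Pos" "\<alpha>2 \<in> Pos" and ll: "l < length s" using low a by (auto simp: lowering_def)
    obtain h where h: "h < k" "pm_eq (arr s \<gamma> h) \<alpha>2" "\<And>t. t \<le> h \<Longrightarrow> \<not> inverted s \<gamma> t \<alpha>2"
      "\<And>t. h < t \<Longrightarrow> t \<le> l \<Longrightarrow> inverted s \<gamma> t \<alpha>2" "inverted s \<gamma> h \<alpha>1" "inverted s \<gamma> k \<alpha>1"
      using interleaved_structure[OF sS \<gamma>_Sub low a ne ord NI] by blast
    have fin: "finite {v \<in> Pos. in_plane \<alpha>1 \<alpha>2 v}"
      by (rule finite_plane[OF sS \<gamma>_Sub P, of h k]) (use h ord ll a in auto)
    obtain c d where c: "c \<in> Pos" "d \<in> Pos" "c \<noteq> d" "in_plane \<alpha>1 \<alpha>2 c" "in_plane \<alpha>1 \<alpha>2 d"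
      and cone: "\<And>v. v \<in> Pos \<Longrightarrow> in_plane \<alpha>1 \<alpha>2 v \<Longrightarrow> in_cone c d v"
      using extreme_roots[OF P ne fin] by metis
    have sub: "in_plane \<alpha>1 \<alpha>2 v" if "in_plane c d v" for v by (rule in_plane_trans[OF c(4,5) that])
    have fin': "finite {v \<in> Pos. in_plane c d v}"
      by (rule finite_subset[OF _ fin]) (use sub in blast)
    obtain \<theta> n where fan: "fan \<theta> n c d"
      using finite_plane_fan[OF c(1-3) fin'] cone sub by metis
    have "\<exists>m. 1 \<le> m \<and> m \<le> int n \<and> \<alpha> = ray \<theta> c d m" if "\<alpha> \<in> Pos" "in_plane \<alpha>1 \<alpha>2 \<alpha>" for \<alpha>
    proof -
      have "in_plane c d \<alpha>" using cone[OF that] by (rule in_cone_in_plane)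
      then have "\<exists>m\<in>{1..int n}. \<alpha> = rho \<theta> c d (real_of_int m)" using fan that(1) unfolding fan_def by blast
      then show ?thesis unfolding ray_def by auto
    qed
    then obtain x y where x: "1 \<le> x" "x \<le> int n" "\<alpha>1 = ray \<theta> c d x" and y: "1 \<le> y" "y \<le> int n" "\<alpha>2 = ray \<theta> c d y"
      using P in_plane_base by metis
    have xy: "x \<noteq> y" using x y ne by auto
    have conclude: False
      if fan: "fan \<theta> n c d" and x: "1 \<le> x" "\<alpha>1 = ray \<theta> c d x" and y: "y \<le> int n" "\<alpha>2 = ray \<theta> c d y" and "x < y"
      for c d x y
    proof -
      have e: "int (nat x) = x" "int (nat y) = y" using x y \<open>x < y\<close> by auto
      have "\<exists>i' k' j' l'. lowering s \<gamma> i' k' \<and> arr s \<gamma> k' = ray \<theta> c d (int (nat x)) \<and>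
        lowering s \<gamma> j' l' \<and> arr s \<gamma> l' = ray \<theta> c d (int (nat y)) \<and>
        linked s w \<gamma> {\<gamma>, flip2 i' k' \<gamma>} {\<gamma>, flip2 j' l' \<gamma>}"
        by (rule linked_in_fan[OF fan _ _ _ h(1) ord(3) ll])
          (use x y \<open>x < y\<close> h a in \<open>auto simp: e nat_less_iff\<close>)
      then show False using nl' x y unfolding e by blast
    qed
    show False
    proof (cases "x < y")
      case True
      then show False using conclude[OF fan x(1,3) y(2,3)] by blast
    next
      case False
      have "\<alpha>1 = ray \<theta> d c (int n + 1 - x)" "\<alpha>2 = ray \<theta> d c (int n + 1 - y)"
        using x y ray_swap[OF fan] by simp_all
      then show False using conclude[OF fan_swap[OF fan], of "int n + 1 - x" "int n + 1 - y"] x y False xy by simp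
    qed
  qed
  have "(i < j \<and> j < k \<and> k < l) \<or> (j < i \<and> i < l \<and> l < k)"
    by (rule NI[OF low(1) _ low(2)]) (simp_all add: \<alpha>1_def \<alpha>2_def)
  then show False
  proof
    assume o: "i < j \<and> j < k \<and> k < l"
    show False
      by (rule core[OF low, of \<alpha>1 \<alpha>2]) (use o ne NI nl' in \<open>auto simp: \<alpha>1_def \<alpha>2_def\<close>)
  next
    assume o: "j < i \<and> i < l \<and> l < k"
    have NI2: "(j' < i' \<and> i' < l' \<and> l' < k') \<or> (i' < j' \<and> j' < k' \<and> k' < l')"
      if "lowering s \<gamma> j' l'" "arr s \<gamma> l' = \<alpha>2" "lowering s \<gamma> i' k'" "arr s \<gamma> k' = \<alpha>1" for i' k' j' l'
      using NI[OF that(3,4,1,2)] by blast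
    have nl2: "\<not> linked s w \<gamma> {\<gamma>, flip2 j' l' \<gamma>} {\<gamma>, flip2 i' k' \<gamma>}"
      if "lowering s \<gamma> j' l'" "arr s \<gamma> l' = \<alpha>2" "lowering s \<gamma> i' k'" "arr s \<gamma> k' = \<alpha>1" for i' k' j' l'
      using nl'[OF that(3,4,1,2)] linked_sym by blast
    show False
      by (rule core[OF low(2,1) \<alpha>2_def[symmetric] \<alpha>1_def[symmetric] ne[symmetric] _ _ _ NI2 nl2]) (use o in auto)
  qed
qed

end

end

theorem theorem5p3p3:
  fixes form :: "'v::real_vector \<Rightarrow> 'v \<Rightarrow> real"
    and \<Delta> :: "'v set"
    and s :: "('v \<Rightarrow> 'v) list"
    and w :: "'v \<Rightarrow> 'v"
    and \<gamma> :: subexpression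
    and F :: "subexpression set set"
  assumes "based_root_system form \<Delta>"
    and "set s = simple_reflections form \<Delta>"
    and "w \<in> coxeter_group form \<Delta>"
    and "\<gamma> \<in> Sub s" and "target s \<gamma> = w"
    and "even_subgraph s w F"
    and "supported_below form \<Delta> s \<gamma> F"
  shows "\<exists>Cs :: subexpression set set list.
    (\<forall>C\<in>set Cs.
       C \<in> Cyc form \<Delta> s w \<union> Tr1 form \<Delta> s w \<union> Tr2 form \<Delta> s w \<union> Tr3 form \<Delta> s w
             \<union> Sq1 form \<Delta> s w \<union> Sq2 form \<Delta> s w \<and>
       C \<subseteq> edges s w \<and> supported_below form \<Delta> s \<gamma> C) \<and>
    F = foldr sym_diff Cs {}"
proof -
  interpret based_root_system form \<Delta> by fact
  have sS: "set s \<subseteq> S" using assms(2) by simp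
  have re: "root_expression s" using sS S_T by (auto simp: root_expression_def)
  have g: "\<gamma> \<in> Sub s" "target s \<gamma> = w" by fact+
  have FE: "F \<subseteq> edges s w" using assms(6) by (simp add: even_subgraph_def)
  have vertex_key: "sub_less form \<Delta> s \<delta> \<gamma> \<or> \<delta> = \<gamma> \<longleftrightarrow> key s \<delta> \<le> key s \<gamma>" if "\<delta> \<in> vertices s w" for \<delta>
  proof -
    have d: "\<delta> \<in> Sub s" "target s \<delta> = w" using that by (auto simp: vertices_def)
    have "key s \<delta> = key s \<gamma> \<longleftrightarrow> \<delta> = \<gamma>" using key_inject[OF re d(1) g(1)] d(2) g(2) by auto
    then show ?thesis using sub_less_iff_key[OF sS g(1) d(1)] d(2) g(2) by auto
  qed
  have below: "supported_below form \<Delta> s \<gamma> C \<longleftrightarrow> (\<forall>e\<in>C. \<forall>\<delta>\<in>e. key s \<delta> \<le> key s \<gamma>)" if C: "C \<subseteq> edges s w" for C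
  proof -
    have "\<delta> \<in> vertices s w" if "e \<in> C" "\<delta> \<in> e" for e \<delta> using C edges_subset[of e s w] that by blast
    then show ?thesis unfolding supported_below_def using vertex_key by blast
  qed
  have "F \<in> cycle_sums s w (key s \<gamma>)"
  proof (rule even_subgraph_in_cycle_sums[OF re _ FE])
    show "linked s w \<gamma>' {\<gamma>', flip2 i j \<gamma>'} {\<gamma>', flip2 k l \<gamma>'}"
      if "\<gamma>' \<in> vertices s w" "lowering s \<gamma>' i j" "lowering s \<gamma>' k l" for \<gamma>' i j k l
      by (rule linked_lowering[OF sS that])
    show "even (card (star v F))" if "v \<in> vertices s w" for v
      using assms(6) that by (simp add: even_subgraph_def star_def)
    show "\<forall>e\<in>F. \<forall>\<delta>\<in>e. key s \<delta> \<le> key s \<gamma>" using assms(7) below[OF FE] by blast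
  qed
  then obtain Cs where Cs: "\<forall>C\<in>set Cs. elementary s w (key s \<gamma>) C" "F = foldr sym_diff Cs {}"
    using cycle_sums_list by blast
  show ?thesis
  proof (intro exI[of _ Cs] conjI ballI)
    fix C assume "C \<in> set Cs"
    then have el: "elementary s w (key s \<gamma>) C" using Cs(1) by blast
    show "C \<in> Cyc form \<Delta> s w \<union> Tr1 form \<Delta> s w \<union> Tr2 form \<Delta> s w \<union> Tr3 form \<Delta> s w
             \<union> Sq1 form \<Delta> s w \<union> Sq2 form \<Delta> s w" using el unfolding elementary_def by blast
    show sub: "C \<subseteq> edges s w" using el unfolding elementary_def by blast
    show "supported_below form \<Delta> s \<gamma> C" using el below[OF sub] unfolding elementary_def by blast
  qed (rule Cs(2))
qed

end
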